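(* If $M$ is a strictly causal and unipotent flat complete Lorentzian manifold, then $M$ admits a finite covering by $V/\Gamma$ with $\Gamma$ of type (i) or of type (ii) (defined in the context); in the latter case $$\ker(\mathbf 1+ta)=0\quad\text{for all } t\in\mathbb R,\qquad( * )$$ where $\mathbf 1$ is the identity map of $T$ (so $\mathbf 1+ta$ is a linear map $T\to N$). Conversely, if $\Gamma$ is of type (i), or of type (ii) with $( * )$ fulfilled, then $V/\Gamma$ is strictly causal. In both cases, $V/\Gamma$ is homeomorphic to the product of the torus $T/\Gamma$ and the vector space $V/T$.
   Context: Setting. $V$ is a real vector space of dimension $n$ with a Lorentzian symmetric bilinear form $\ell$ of signature $(+,-,\dots,-)$. The set $\{v:\ell(v,v)\ge 0\}$ is the union of two closed convex round cones $C$ and $-C$; $C$ is one of them, fixed. A flat complete Lorentzian manifold is a quotient $M=V/\Gamma$ where $\Gamma$ is a discrete group acting freely and properly on $V$ by affine transformations $\gamma(v)=\lambda(\gamma)v+\tau(\gamma)$, $\tau(\gamma)\in V$, whose linear parts $\lambda(\gamma)$ preserve $\ell$ and $C$. $M$ and $\Gamma$ are called unipotent if every $\lambda(\gamma)$, $\gamma\in\Gamma$, is a unipotent linear transformation. Let $\kappa:V\to M$ be the quotient map. For $p=\kappa(v)$, the past and the future of $p$ are $P_p=\kappa(v-C)$ and $F_p=\kappa(v+C)$. The cone $C$ induces a field of cones $C_p=d_v\kappa(C)\subset T_pM$. A piecewise smooth path $\eta$ in $M$ is timelike if $\eta'(t)\in C_{\eta(t)}$ for all $t$. $M$ is causal if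 it admits no nonconstant closed piecewise smooth timelike path; equivalently, $\gamma(v)\in v+C$ with $v\in V$, $\gamma\in\Gamma$ implies $\gamma=e$. $M$ is strictly causal if it is causal and every $p\in M$ has a neighbourhood $U_p$ such that $U_p\cap F_p$ and $U_p\cap P_p$ are closed in $U_p$. A linear subspace $X\subset V$ is spacelike if $X\cap C=\{0\}$. Type (i). $T,L\subset V$ are linear subspaces with $V=T\oplus L$, the sum being $\ell$-orthogonal, $T$ spacelike, $\dim L=1$, $L\cap\mathrm{Int}(C)\ne\emptyset$; $\Gamma$ is a uniform lattice in $T$ acting on $V$ by translations. Type (ii). Let $v_0,v_1\in\partial C$ with $\ell(v_0,v_1)=1$; set $L=\mathbb R v_0$, $W=L^\perp$, $N=W\cap v_1^\perp$, $l_0(v)=\ell(v,v_0)$ (orthogonality with respect to $\ell$). For $x\in N$ define $\nu(x)\in \mathrm{SO}(\ell)$ by $$\nu(x)v=v+l_0(v)x-\Bigl(\ell(v,x)+\tfrac12 l_0(v)\ell(x,x)\Bigr)v_0 .$$ Let $T\subseteq N$ be a linear subspace, $\Gamma$ a uniform lattice in $T$, and $a:T\to N$ a linear map with $\ell(ax,y)=\ell(x,ay)$ for all $x,y\in T$. Then $T$ (and hence $\Gamma$) acts on $V$ by the affine transformations $$\gamma_x(v)=\lambda(x)v+\tau(x),\qquad \lambda(x)=\nu(ax),\qquad \tau(x)=x-\tfrac12\ell(ax,x)v_0 .$$ *)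

theory Defs
  imports "HOL-Analysis.Analysis"
begin

text \<open>
  The type \<open>'a::euclidean_space\<close> serves as a real vector space of arbitrary finite dimension
  at least 1 with its standard topology.  Its Euclidean inner product plays no role other than
  inducing that topology; orthogonality always refers to the Lorentzian form \<open>l\<close>.
\<close>

definition lorentzian_form :: "('a::euclidean_space \<Rightarrow> 'a \<Rightarrow> real) \<Rightarrow> bool" where
  "lorentzian_form l \<longleftrightarrow>
     bilinear l \<and> (\<forall>x y. l x y = l y x) \<and>
     (\<exists>e B. e \<notin> B \<and> independent (insert e B) \<and> span (insert e B) = UNIV \<and>
        l e e = 1 \<and> (\<forall>b\<in>B. l b b = -1) \<and>
        pairwise (\<lambda>x y. l x y = 0) (insert e B))"

definition time_cone :: "('a::euclidean_space \<Rightarrow> 'a \<Rightarrow> real) \<Rightarrow> 'a set \<Rightarrow> bool" where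
  "time_cone l C \<longleftrightarrow>
     closed C \<and> convex C \<and> cone C \<and>
     C \<union> uminus ` C = {v. l v v \<ge> 0} \<and> C \<inter> uminus ` C = {0}"

definition spacelike :: "'a::euclidean_space set \<Rightarrow> 'a set \<Rightarrow> bool" where
  "spacelike C X \<longleftrightarrow> subspace X \<and> X \<inter> C = {0}"

definition perp :: "('a \<Rightarrow> 'a \<Rightarrow> real) \<Rightarrow> 'a set \<Rightarrow> 'a set" where
  "perp l S = {v. \<forall>s\<in>S. l v s = 0}"

text \<open>
  A group of transformations is given as the set \<open>G\<close> of its elements, and a point of the
  quotient is an orbit.  Hence \<open>orbit G\<close> is the quotient map \<open>\<kappa>\<close>.
\<close>

definition orbit :: "('a \<Rightarrow> 'a) set \<Rightarrow> 'a \<Rightarrow> 'a set" where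
  "orbit G v = (\<lambda>g. g v) ` G"

definition orbit_space :: "'a topology \<Rightarrow> ('a \<Rightarrow> 'a) set \<Rightarrow> 'a set topology" where
  "orbit_space X G =
     topology (\<lambda>U. U \<subseteq> orbit G ` topspace X \<and> openin X {x \<in> topspace X. orbit G x \<in> U})"

lemma openin_orbit_space:
  "openin (orbit_space X G) U \<longleftrightarrow>
     U \<subseteq> orbit G ` topspace X \<and> openin X {x \<in> topspace X. orbit G x \<in> U}"
proof -
  let ?L = "\<lambda>U. U \<subseteq> orbit G ` topspace X \<and> openin X {x \<in> topspace X. orbit G x \<in> U}"
  have "istopology ?L"
    unfolding istopology_def
  proof (intro conjI allI impI)
    fix S T assume "?L S" "?L T"
    moreover have "{x \<in> topspace X. orbit G x \<in> S \<inter> T} =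
        {x \<in> topspace X. orbit G x \<in> S} \<inter> {x \<in> topspace X. orbit G x \<in> T}" by auto
    ultimately show "S \<inter> T \<subseteq> orbit G ` topspace X"
      and "openin X {x \<in> topspace X. orbit G x \<in> S \<inter> T}" by auto
  next
    fix \<K> assume "\<forall>K\<in>\<K>. ?L K"
    moreover have "{x \<in> topspace X. orbit G x \<in> \<Union>\<K>} =
        (\<Union>K\<in>\<K>. {x \<in> topspace X. orbit G x \<in> K})" by auto
    ultimately show "\<Union>\<K> \<subseteq> orbit G ` topspace X"
      and "openin X {x \<in> topspace X. orbit G x \<in> \<Union>\<K>}" by auto
  qed
  then show ?thesis
    by (simp add: orbit_space_def topology_inverse')
qed

lemma topspace_orbit_space: "topspace (orbit_space X G) = orbit G ` topspace X"
proof -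
  have "{x \<in> topspace X. orbit G x \<in> orbit G ` topspace X} = topspace X" by auto
  then have "openin (orbit_space X G) (orbit G ` topspace X)"
    by (simp add: openin_orbit_space)
  then show ?thesis
    by (meson openin_orbit_space openin_subset openin_topspace subset_antisym)
qed

lemma quotient_map_orbit_space: "quotient_map X (orbit_space X G) (orbit G)"
  unfolding quotient_map_def by (simp add: topspace_orbit_space openin_orbit_space)

definition translation_group :: "'a::ab_group_add set \<Rightarrow> ('a \<Rightarrow> 'a) set" where
  "translation_group A = (+) ` A"

definition linear_part :: "('a::real_vector \<Rightarrow> 'a) \<Rightarrow> 'a \<Rightarrow> 'a" where
  "linear_part g v = g v - g 0"

definition lorentz_affine ::
    "('a::euclidean_space \<Rightarrow> 'a \<Rightarrow> real) \<Rightarrow> 'a set \<Rightarrow> ('a \<Rightarrow> 'a) \<Rightarrow> bool" where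
  "lorentz_affine l C g \<longleftrightarrow>
     bij g \<and> linear (linear_part g) \<and>
     (\<forall>v w. l (linear_part g v) (linear_part g w) = l v w) \<and>
     linear_part g ` C = C"

text \<open>
  The group \<open>\<Gamma>\<close> carries the discrete topology, so properness of the action means that only
  finitely many elements move a given compact set to a set meeting it.  In particular
  \<open>\<Gamma>\<close> is then a discrete subgroup of the affine group.
\<close>

definition flat_lorentz_group ::
    "('a::euclidean_space \<Rightarrow> 'a \<Rightarrow> real) \<Rightarrow> 'a set \<Rightarrow> ('a \<Rightarrow> 'a) set \<Rightarrow> bool" where
  "flat_lorentz_group l C \<Gamma> \<longleftrightarrow>
     id \<in> \<Gamma> \<and> (\<forall>g\<in>\<Gamma>. \<forall>h\<in>\<Gamma>. g \<circ> h \<in> \<Gamma>) \<and> (\<forall>g\<in>\<Gamma>. inv g \<in> \<Gamma>) \<and>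
     (\<forall>g\<in>\<Gamma>. lorentz_affine l C g) \<and>
     (\<forall>g\<in>\<Gamma>. \<forall>v. g v = v \<longrightarrow> g = id) \<and>
     (\<forall>K. compact K \<longrightarrow> finite {g \<in> \<Gamma>. g ` K \<inter> K \<noteq> {}})"

definition unipotent :: "('a::real_vector \<Rightarrow> 'a) \<Rightarrow> bool" where
  "unipotent A \<longleftrightarrow> (\<exists>k. \<forall>v. ((\<lambda>u. A u - u) ^^ k) v = 0)"

definition unipotent_group :: "('a::real_vector \<Rightarrow> 'a) set \<Rightarrow> bool" where
  "unipotent_group \<Gamma> \<longleftrightarrow> (\<forall>g\<in>\<Gamma>. unipotent (linear_part g))"

abbreviation quotient_manifold :: "('a::euclidean_space \<Rightarrow> 'a) set \<Rightarrow> 'a set topology" where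
  "quotient_manifold \<Gamma> \<equiv> orbit_space euclidean \<Gamma>"

text \<open>Infinitely differentiable curves; derivatives are one-sided at end points of \<open>S\<close>.\<close>

definition smooth_curve_on :: "(real \<Rightarrow> 'a::real_normed_vector) \<Rightarrow> real set \<Rightarrow> bool" where
  "smooth_curve_on c S \<longleftrightarrow>
     (\<exists>D. D 0 = c \<and>
        (\<forall>k::nat. \<forall>t\<in>S. (D k has_vector_derivative D (Suc k) t) (at t within S)))"

text \<open>
  The manifold structure of \<open>V/\<Gamma>\<close> is the one whose charts are the local inverses of \<open>\<kappa>\<close>: a curve
  \<open>\<eta>\<close> in \<open>V/\<Gamma>\<close> is smooth iff locally \<open>\<eta> = \<kappa> \<circ> c\<close> for a smooth curve \<open>c\<close> in \<open>V\<close>,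
  and since \<open>C\<^sub>p = d\<^sub>v\<kappa>(C)\<close>, its velocity lies in the cone field iff the velocity of \<open>c\<close> lies
  in \<open>C\<close>.  Continuity of \<open>\<eta>\<close> on \<open>{a..b}\<close> is a consequence.
\<close>

definition timelike_segment ::
    "'a::euclidean_space set \<Rightarrow> ('a \<Rightarrow> 'a) set \<Rightarrow> (real \<Rightarrow> 'a set) \<Rightarrow> real \<Rightarrow> real \<Rightarrow> bool" where
  "timelike_segment C \<Gamma> \<eta> a b \<longleftrightarrow>
     (\<forall>t\<in>{a..b}. \<exists>\<epsilon>>0. \<exists>c. let I = {a..b} \<inter> {t-\<epsilon>..t+\<epsilon>} in
        smooth_curve_on c I \<and>
        (\<forall>s\<in>I. \<eta> s = orbit \<Gamma> (c s) \<and>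
           (\<exists>u\<in>C. (c has_vector_derivative u) (at s within I))))"

definition timelike_path ::
    "'a::euclidean_space set \<Rightarrow> ('a \<Rightarrow> 'a) set \<Rightarrow> (real \<Rightarrow> 'a set) \<Rightarrow> real \<Rightarrow> real \<Rightarrow> bool" where
  "timelike_path C \<Gamma> \<eta> a b \<longleftrightarrow>
     (\<exists>(m::nat) t. t 0 = a \<and> t m = b \<and>
        (\<forall>i<m. t i < t (Suc i) \<and> timelike_segment C \<Gamma> \<eta> (t i) (t (Suc i))))"

definition causal :: "'a::euclidean_space set \<Rightarrow> ('a \<Rightarrow> 'a) set \<Rightarrow> bool" where
  "causal C \<Gamma> \<longleftrightarrow>
     \<not> (\<exists>\<eta> a b. a < b \<and> timelike_path C \<Gamma> \<eta> a b \<and> \<eta> a = \<eta> b \<and> (\<exists>t\<in>{a..b}. \<eta> t \<noteq> \<eta> a))"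

text \<open>Past and future of \<open>p = \<kappa>(v)\<close>; independent of the choice of \<open>v\<close> as \<open>\<Gamma>\<close> preserves \<open>C\<close>.\<close>

definition past :: "'a::euclidean_space set \<Rightarrow> ('a \<Rightarrow> 'a) set \<Rightarrow> 'a \<Rightarrow> 'a set set" where
  "past C \<Gamma> v = orbit \<Gamma> ` {v - c | c. c \<in> C}"

definition future :: "'a::euclidean_space set \<Rightarrow> ('a \<Rightarrow> 'a) set \<Rightarrow> 'a \<Rightarrow> 'a set set" where
  "future C \<Gamma> v = orbit \<Gamma> ` {v + c | c. c \<in> C}"

definition strictly_causal :: "'a::euclidean_space set \<Rightarrow> ('a \<Rightarrow> 'a) set \<Rightarrow> bool" where
  "strictly_causal C \<Gamma> \<longleftrightarrow>
     causal C \<Gamma> \<and>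
     (\<forall>v. \<exists>U. U \<subseteq> topspace (quotient_manifold \<Gamma>) \<and>
        orbit \<Gamma> v \<in> (quotient_manifold \<Gamma>) interior_of U \<and>
        closedin (subtopology (quotient_manifold \<Gamma>) U) (U \<inter> future C \<Gamma> v) \<and>
        closedin (subtopology (quotient_manifold \<Gamma>) U) (U \<inter> past C \<Gamma> v))"

text \<open>\<open>covering_space\<close> is only available for type-class topologies; this is its counterpart for
  abstract topologies, with finite fibres.\<close>

definition finite_covering_map :: "'a topology \<Rightarrow> 'b topology \<Rightarrow> ('a \<Rightarrow> 'b) \<Rightarrow> bool" where
  "finite_covering_map X Y p \<longleftrightarrow>
     continuous_map X Y p \<and> p ` topspace X = topspace Y \<and>
     (\<forall>y\<in>topspace Y. finite {x \<in> topspace X. p x = y} \<and>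
        (\<exists>U. y \<in> U \<and> openin Y U \<and>
           (\<exists>\<V>. \<Union>\<V> = {x \<in> topspace X. p x \<in> U} \<and> (\<forall>S\<in>\<V>. openin X S) \<and>
              pairwise disjnt \<V> \<and>
              (\<forall>S\<in>\<V>. homeomorphic_map (subtopology X S) (subtopology Y U) p))))"

text \<open>
  A covering of flat Lorentzian manifolds respects the Lorentzian structures and the cone
  fields: in the flat charts it is locally an affine Lorentz transformation.
\<close>

definition finite_lorentz_covering ::
    "('a::euclidean_space \<Rightarrow> 'a \<Rightarrow> real) \<Rightarrow> 'a set \<Rightarrow> ('a \<Rightarrow> 'a) set \<Rightarrow> ('a \<Rightarrow> 'a) set \<Rightarrow>
      ('a set \<Rightarrow> 'a set) \<Rightarrow> bool" where
  "finite_lorentz_covering l C \<Gamma>' \<Gamma> p \<longleftrightarrow>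
     finite_covering_map (quotient_manifold \<Gamma>') (quotient_manifold \<Gamma>) p \<and>
     (\<forall>v. \<exists>g S. lorentz_affine l C g \<and> open S \<and> v \<in> S \<and>
        (\<forall>u\<in>S. p (orbit \<Gamma>' u) = orbit \<Gamma> (g u)))"

definition uniform_lattice :: "'a::euclidean_space set \<Rightarrow> 'a set \<Rightarrow> bool" where
  "uniform_lattice T \<Lambda> \<longleftrightarrow>
     \<Lambda> \<subseteq> T \<and> 0 \<in> \<Lambda> \<and> (\<forall>x\<in>\<Lambda>. \<forall>y\<in>\<Lambda>. x - y \<in> \<Lambda>) \<and> discrete \<Lambda> \<and>
     compact_space (orbit_space (top_of_set T) (translation_group \<Lambda>))"

text \<open>In type (i) the transformation group is \<open>translation_group \<Lambda>\<close>.\<close>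

definition type_i ::
    "('a::euclidean_space \<Rightarrow> 'a \<Rightarrow> real) \<Rightarrow> 'a set \<Rightarrow> 'a set \<Rightarrow> 'a set \<Rightarrow> 'a set \<Rightarrow> bool" where
  "type_i l C T L \<Lambda> \<longleftrightarrow>
     subspace T \<and> subspace L \<and>
     {x + y | x y. x \<in> T \<and> y \<in> L} = UNIV \<and> T \<inter> L = {0} \<and>
     (\<forall>x\<in>T. \<forall>y\<in>L. l x y = 0) \<and>
     spacelike C T \<and> dim L = 1 \<and> L \<inter> interior C \<noteq> {} \<and>
     uniform_lattice T \<Lambda>"

definition nu :: "('a::euclidean_space \<Rightarrow> 'a \<Rightarrow> real) \<Rightarrow> 'a \<Rightarrow> 'a \<Rightarrow> 'a \<Rightarrow> 'a" where
  "nu l v0 x v = v + l v v0 *\<^sub>R x - (l v x + 1/2 * l v v0 * l x x) *\<^sub>R v0"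

definition type_ii_action ::
    "('a::euclidean_space \<Rightarrow> 'a \<Rightarrow> real) \<Rightarrow> 'a \<Rightarrow> ('a \<Rightarrow> 'a) \<Rightarrow> 'a \<Rightarrow> 'a \<Rightarrow> 'a" where
  "type_ii_action l v0 a x v = nu l v0 (a x) v + (x - (1/2 * l (a x) x) *\<^sub>R v0)"

text \<open>
  The map \<open>a\<close> is only required to be linear on \<open>T\<close>; its values outside \<open>T\<close> are irrelevant.
  The transformation group is \<open>type_ii_action l v0 a ` \<Lambda>\<close>.
\<close>

definition type_ii ::
    "('a::euclidean_space \<Rightarrow> 'a \<Rightarrow> real) \<Rightarrow> 'a set \<Rightarrow> 'a \<Rightarrow> 'a \<Rightarrow> 'a set \<Rightarrow> ('a \<Rightarrow> 'a) \<Rightarrow> 'a set \<Rightarrow> bool"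
  where
  "type_ii l C v0 v1 T a \<Lambda> \<longleftrightarrow>
     v0 \<in> frontier C \<and> v1 \<in> frontier C \<and> l v0 v1 = 1 \<and>
     (let L = span {v0}; W = perp l L; N = W \<inter> perp l {v1} in
        subspace T \<and> T \<subseteq> N \<and> uniform_lattice T \<Lambda> \<and>
        a ` T \<subseteq> N \<and>
        (\<forall>x\<in>T. \<forall>y\<in>T. a (x + y) = a x + a y) \<and>
        (\<forall>r. \<forall>x\<in>T. a (r *\<^sub>R x) = r *\<^sub>R a x) \<and>
        (\<forall>x\<in>T. \<forall>y\<in>T. l (a x) y = l x (a y)))"

definition trivial_kernels :: "'a::euclidean_space set \<Rightarrow> ('a \<Rightarrow> 'a) \<Rightarrow> bool" where
  "trivial_kernels T a \<longleftrightarrow> (\<forall>t::real. {x \<in> T. x + t *\<^sub>R a x = 0} = {0})"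

text \<open>\<open>V/\<Gamma>\<close> is homeomorphic to \<open>T/\<Lambda> \<times> V/T\<close>, both factors with their quotient topologies.\<close>

definition splits_as_torus_times_vector_space ::
    "('a::euclidean_space \<Rightarrow> 'a) set \<Rightarrow> 'a set \<Rightarrow> 'a set \<Rightarrow> bool" where
  "splits_as_torus_times_vector_space \<Gamma> T \<Lambda> \<longleftrightarrow>
     quotient_manifold \<Gamma> homeomorphic_space
       prod_topology (orbit_space (top_of_set T) (translation_group \<Lambda>))
                     (orbit_space euclidean (translation_group T))"

end

theory Submission
  imports Defs
begin

text \<open>
  \<^emph>\<open>From a strictly causal group to its type.\<close>  A nontrivial unipotent isometry fixes exactly one null
  line, and the isometries \<open>A\<^sup>j B\<close> cannot all be unipotent if \<open>A\<close> and \<open>B\<close> fix different ones.  So either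
  \<open>\<Gamma>\<close> consists of translations or all linear parts are \<open>nu v0 y\<close> for one null vector \<open>v0\<close>.  In the second
  case causality (\<open>g v - v\<close> is never causal for \<open>g \<noteq> id\<close>) forces the translation parts into the hyperplane
  \<open>v0\<^sup>\<bottom>\<close>, makes \<open>\<Gamma>\<close> abelian (commutators are translations along \<open>v0\<close>) and makes \<open>x + t y \<noteq> 0\<close>, where
  \<open>x\<close> is the \<open>N\<close>-component of the translation part.  Strict causality makes
  \<open>{x + t y}\<close> discrete for every \<open>t\<close>: otherwise some \<open>g v\<close> would be close to the line \<open>v + \<real>v0\<close> but far
  from \<open>v\<close>, so the future or the past of \<open>v\<close> would not be closed near \<open>v\<close>.  Hence \<open>y = a x\<close> with \<open>a\<close> linear,
  and recurrence of the multiples of a kernel vector of \<open>1 + t a\<close> modulo the lattice contradicts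
  discreteness.  No covering is needed: \<open>\<Gamma>\<close> itself has the required form.

  \<^emph>\<open>Converse.\<close>  On each hyperplane \<open>l0 = t\<close> the group acts by \<open>w \<mapsto> w + (1 + t a) x\<close> on \<open>N\<close> and by a
  coboundary in the \<open>v0\<close> direction.  A continuous family of automorphisms of \<open>N\<close> extending \<open>1 + t a\<close>
  therefore conjugates the action of \<open>T\<close> to translations by a homeomorphism of \<open>V\<close>.
\<close>

section \<open>The cone of a Lorentzian form\<close>

locale lorentz_cone =
  fixes l :: "'a::euclidean_space \<Rightarrow> 'a \<Rightarrow> real" and C :: "'a set"
  assumes lorentzian: "lorentzian_form l" and time_cone: "time_cone l C"
begin

lemma bilinear_form: "bilinear l"
  and form_commute: "l x y = l y x"
  using lorentzian by (auto simp: lorentzian_form_def)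

lemmas form_linear =
  bilinear_ladd[OF bilinear_form] bilinear_radd[OF bilinear_form]
  bilinear_lsub[OF bilinear_form] bilinear_rsub[OF bilinear_form]
  bilinear_lmul[OF bilinear_form, unfolded real_scaleR_def]
  bilinear_rmul[OF bilinear_form, unfolded real_scaleR_def]
  bilinear_lneg[OF bilinear_form] bilinear_rneg[OF bilinear_form]
  bilinear_lzero[OF bilinear_form] bilinear_rzero[OF bilinear_form]

lemma bounded_bilinear_form: "bounded_bilinear l"
  using bilinear_form bilinear_conv_bounded_bilinear by blast

lemmas form_continuous_intros [continuous_intros] =
  bounded_bilinear.continuous_on[OF bounded_bilinear_form]
  bounded_bilinear.continuous[OF bounded_bilinear_form]

lemma linear_form_left: "linear (\<lambda>v. l v w)" and linear_form_right: "linear (l w)"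
  using bilinear_form by (auto simp: bilinear_def)

lemma form_sum_left: "l (sum f S) w = (\<Sum>s\<in>S. l (f s) w)"
  using linear_sum[OF linear_form_left] by (simp add: o_def)

lemma form_sum_right: "l w (sum f S) = (\<Sum>s\<in>S. l w (f s))"
  using linear_sum[OF linear_form_right] by (simp add: o_def)

lemma cone_closed: "closed C" and cone_convex: "convex C" and cone_cone: "cone C"
  and cone_cases: "l v v \<ge> 0 \<longleftrightarrow> v \<in> C \<or> - v \<in> C"
  and cone_pointed: "v \<in> C \<Longrightarrow> - v \<in> C \<Longrightarrow> v = 0"
proof -
  have u: "C \<union> uminus ` C = {v. l v v \<ge> 0}" and i: "C \<inter> uminus ` C = {0}"
    using time_cone by (auto simp: time_cone_def)
  have m: "v \<in> uminus ` C \<longleftrightarrow> - v \<in> C" for v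
    by (metis (no_types, lifting) image_iff minus_minus)
  show "l v v \<ge> 0 \<longleftrightarrow> v \<in> C \<or> - v \<in> C" using u m by blast
  show "v \<in> C \<Longrightarrow> - v \<in> C \<Longrightarrow> v = 0" using i m by blast
qed (use time_cone in \<open>auto simp: time_cone_def\<close>)

lemma cone_scale: "v \<in> C \<Longrightarrow> r \<ge> 0 \<Longrightarrow> r *\<^sub>R v \<in> C"
  using cone_cone by (auto simp: cone_def)

lemma cone_add: "v \<in> C \<Longrightarrow> w \<in> C \<Longrightarrow> v + w \<in> C"
  using convex_cone[of C] cone_convex cone_cone by auto

lemma cone_form_nonneg: "v \<in> C \<Longrightarrow> l v v \<ge> 0"
  using cone_cases by blast

lemma zero_in_cone [simp]: "0 \<in> C"
  using cone_cases[of 0] by (simp add: form_linear)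

text \<open>In the orthogonal basis \<open>l v v\<close> is minus a sum of squares once the
  \<open>e\<close>-coordinate vanishes. The basis of the definition is used only here; later sign
  arguments rest on this \<open>e\<close>.\<close>

lemma negative_on_perp:
  obtains e where "l e e = 1" "\<And>v. l v e = 0 \<Longrightarrow> v \<noteq> 0 \<Longrightarrow> l v v < 0"
proof -
  let ?P = "\<lambda>e B. e \<notin> B \<and> independent (insert e B) \<and> span (insert e B) = UNIV \<and>
    l e e = 1 \<and> (\<forall>b\<in>B. l b b = -1) \<and> pairwise (\<lambda>x y. l x y = 0) (insert e B)"
  have "\<exists>e B. ?P e B" 
    using lorentzian[unfolded lorentzian_form_def, THEN conjunct2, THEN conjunct2] .
  then obtain e where "\<exists>B. ?P e B" ..
  then obtain B where eB': "?P e B" ..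
  have eB: "e \<notin> B" "independent (insert e B)" "span (insert e B) = UNIV"
    "l e e = 1" "\<forall>b\<in>B. l b b = -1" "pairwise (\<lambda>x y. l x y = 0) (insert e B)"
    using eB' by simp_all
  have fin: "finite B" using independent_imp_finite[OF eB(2)] by simp
  have orth: "l b c = 0" if "b \<in> insert e B" "c \<in> insert e B" "b \<noteq> c" for b c
    using eB(6) that by (auto simp: pairwise_def)
  have "l v v < 0" if v: "l v e = 0" "v \<noteq> 0" for v
  proof -
    have "v \<in> span (insert e B)" using eB(3) by simp
    then obtain u where u: "v = (\<Sum>b\<in>insert e B. u b *\<^sub>R b)"
      using fin by (metis (mono_tags, lifting) finite.insertI rangeE span_finite)
    have le: "l v c = u c * l c c" if "c \<in> insert e B" for c
    proof -
      have "l v c = (\<Sum>b\<in>insert e B. u b * l b c)"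
        by (simp only: u form_sum_left form_linear)
      also have "\<dots> = (\<Sum>b\<in>insert e B. if b = c then u c * l c c else 0)"
        by (rule sum.cong) (use orth that in auto)
      also have "\<dots> = u c * l c c" using fin that by (subst sum.delta) auto
      finally show ?thesis .
    qed
    have "u e = 0" using le[of e] eB(4) v by simp
    then have v': "v = (\<Sum>b\<in>B. u b *\<^sub>R b)" using u fin eB(1) by simp
    have "l v v = (\<Sum>b\<in>B. u b * l v b)"
      by (subst (2) v') (simp only: form_sum_right form_linear)
    also have "\<dots> = (\<Sum>b\<in>B. - (u b)\<^sup>2)"
      by (rule sum.cong) (use le eB(5) in \<open>auto simp: power2_eq_square\<close>)
    finally have q: "l v v = - (\<Sum>b\<in>B. (u b)\<^sup>2)" by (simp add: sum_negf)
    have "\<exists>b\<in>B. u b \<noteq> 0"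
    proof (rule ccontr)
      assume "\<not> ?thesis"
      then have "v = 0" unfolding v' by (intro sum.neutral) auto
      then show False using v by simp
    qed
    then have "(\<Sum>b\<in>B. (u b)\<^sup>2) > 0" using fin by (auto intro: sum_pos2)
    then show ?thesis using q by simp
  qed
  then show ?thesis using that eB(4) by blast
qed

text \<open>A two-dimensional subspace on which the form is positive semidefinite does not exist.\<close>

lemma nonneg_orthogonal_collinear:
  assumes "u \<noteq> 0" "l u u \<ge> 0" "l v v \<ge> 0" "l u v = 0"
  obtains r where "v = r *\<^sub>R u"
proof -
  obtain e where e: "l e e = 1" "\<And>v. l v e = 0 \<Longrightarrow> v \<noteq> 0 \<Longrightarrow> l v v < 0"
    using negative_on_perp by blast
  have ue: "l u e \<noteq> 0" using e(2)[of u] assms by force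
  \<comment> \<open>The combination of \<open>u\<close> and \<open>v\<close> orthogonal to
    \<open>e\<close>; its square is nonnegative, so it has to vanish.\<close>
  define x where "x = l v e *\<^sub>R u - l u e *\<^sub>R v"
  have "l x e = 0" by (simp add: x_def form_linear)
  moreover have "l x x = (l v e)\<^sup>2 * l u u + (l u e)\<^sup>2 * l v v"
    using assms(4) form_commute[of v u] by (simp add: x_def form_linear power2_eq_square)
  then have "l x x \<ge> 0" using assms by simp
  ultimately have "x = 0" using e(2) by force
  then have "v = (l v e / l u e) *\<^sub>R u"
    using ue by (simp add: x_def eq_vector_fraction_iff field_simps)
  then show ?thesis using that by blast
qed

lemma negative_on_timelike_perp:
  assumes "l u u > 0" "l u v = 0" "v \<noteq> 0"
  shows "l v v < 0"
proof (rule ccontr)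
  assume "\<not> ?thesis"
  then obtain r where r: "v = r *\<^sub>R u"
    using nonneg_orthogonal_collinear[of u v] assms by (force simp: form_linear)
  then show False using assms by (auto simp: form_linear)
qed

lemma timelike_in_cone:
  obtains e where "e \<in> C" "l e e = 1"
proof -
  obtain e where e: "l e e = 1" using negative_on_perp by blast
  then have "e \<in> C \<or> - e \<in> C" using cone_cases[of e] by simp
  moreover have "l (- e) (- e) = 1" using e by (simp add: form_linear)
  ultimately show ?thesis using e that by blast
qed

text \<open>If \<open>l u v\<close> were negative, adding a positive multiple of \<open>v\<close> to
  \<open>u\<close> would give a cone vector orthogonal to the timelike \<open>v\<close>, hence zero;
  then \<open>- u\<close> would lie in \<open>C\<close>, against pointedness.\<close>

lemma cone_form_timelike:
  assumes "u \<in> C" "v \<in> C" "l v v > 0"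
  shows "l u v \<ge> 0"
proof (rule ccontr)
  assume neg: "\<not> ?thesis"
  define w where "w = u + (- l u v / l v v) *\<^sub>R v"
  have "(- l u v / l v v) *\<^sub>R v \<in> C" using assms neg by (intro cone_scale) (simp_all add: divide_le_0_iff)
  then have "w \<in> C" using assms unfolding w_def by (intro cone_add) auto
  moreover have "l v w = 0" using assms form_commute[of v u] by (simp add: w_def form_linear)
  ultimately have "w = 0" using negative_on_timelike_perp[of v w] assms cone_form_nonneg by force
  then have "- u = (- l u v / l v v) *\<^sub>R v" by (simp add: w_def add_eq_0_iff)
  then have "- u \<in> C" using \<open>(- l u v / l v v) *\<^sub>R v \<in> C\<close> by simp
  then have "u = 0" using assms cone_pointed by blast
  then show False using neg by (simp add: form_linear)
qed

lemma cone_form_cone: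
  assumes "u \<in> C" "v \<in> C"
  shows "l u v \<ge> 0"
proof (cases "l v v > 0")
  case True
  then show ?thesis using cone_form_timelike assms by blast
next
  case False
  then have v: "l v v = 0" using cone_form_nonneg assms by force
  show ?thesis
  proof (rule ccontr)
    assume neg: "\<not> ?thesis"
    \<comment> \<open>For null \<open>v\<close> the square of \<open>u + s v\<close> is affine in
      \<open>s\<close>; this \<open>s\<close> makes it -1, impossible inside the cone.\<close>
    define s where "s = (l u u + 1) / (- 2 * l u v)"
    have u: "l u u \<ge> 0" using cone_form_nonneg assms by blast
    then have "s \<ge> 0" using neg by (simp add: s_def divide_le_0_iff)
    then have "u + s *\<^sub>R v \<in> C" using assms by (intro cone_add cone_scale)
    then have "0 \<le> l (u + s *\<^sub>R v) (u + s *\<^sub>R v)" by (rule cone_form_nonneg)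
    also have "\<dots> = l u u + 2 * s * l u v"
      using v form_commute[of v u] by (simp add: form_linear)
    also have "\<dots> = - 1" using neg by (simp add: s_def field_simps)
    finally show False by simp
  qed
qed

lemma in_coneI:
  assumes "l v v \<ge> 0" "c \<in> C" "l v c > 0"
  shows "v \<in> C"
proof -
  have "- v \<in> C \<Longrightarrow> False" using cone_form_cone[of "- v" c] assms by (simp add: form_linear)
  then show ?thesis using cone_cases assms by blast
qed

lemma cone_orthogonal_collinear:
  assumes "u \<in> C" "u \<noteq> 0" "l v v \<ge> 0" "l u v = 0"
  obtains r where "v = r *\<^sub>R u"
  using nonneg_orthogonal_collinear[of u v] assms cone_form_nonneg by metis

lemma interior_cone: "interior C = {v \<in> C. l v v > 0}"
proof (intro set_eqI iffI)
  fix v assume v: "v \<in> interior C"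
  then have vC: "v \<in> C" using interior_subset by blast
  obtain d where d: "d > 0" "ball v d \<subseteq> C" using v mem_interior by blast
  obtain e where e: "e \<in> C" "l e e = 1" using timelike_in_cone by blast
  have "e \<noteq> 0" using e by (auto simp: form_linear)
  define s where "s = d / (2 * norm e)"
  have s: "s > 0" using d \<open>e \<noteq> 0\<close> by (simp add: s_def)
  have "norm (s *\<^sub>R e) = d / 2" using d \<open>e \<noteq> 0\<close> by (simp add: s_def)
  \<comment> \<open>An interior vector can be moved back along the timelike \<open>e\<close>;
    pairing the result with \<open>v\<close> bounds \<open>l v v\<close> below by
    \<open>s * l e v\<close>.\<close>
  then have "v - s *\<^sub>R e \<in> C" using d by (intro subsetD[OF d(2)]) (simp add: dist_norm)
  then have "l (v - s *\<^sub>R e) v \<ge> 0" using vC by (intro cone_form_cone)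
  then have ge: "l v v \<ge> s * l e v" by (simp add: form_linear)
  have "l e v > 0"
  proof (rule ccontr)
    assume "\<not> ?thesis"
    then have z: "l e v = 0" using cone_form_cone[OF e(1) vC] by simp
    then have "v = 0" using negative_on_timelike_perp[of e v] e cone_form_nonneg[OF vC] by force
    then have "- (s *\<^sub>R e) \<in> C" using \<open>v - s *\<^sub>R e \<in> C\<close> by simp
    moreover have "s *\<^sub>R e \<in> C" using e s by (simp add: cone_scale)
    ultimately have "s *\<^sub>R e = 0" using cone_pointed by blast
    then show False using s \<open>e \<noteq> 0\<close> by simp
  qed
  then show "v \<in> {v \<in> C. l v v > 0}" using ge s vC
    using less_le_trans[OF mult_pos_pos[of s "l e v"]] by simp
next
  fix v assume v: "v \<in> {v \<in> C. l v v > 0}"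
  then have "v \<noteq> 0" by (auto simp: form_linear)
  then have nv: "- v \<notin> C" using cone_pointed v by blast
  have "open ({w. l w w > 0} \<inter> {w. l w v > 0})"
    by (intro open_Int open_Collect_less continuous_intros)
  moreover have "{w. l w w > 0} \<inter> {w. l w v > 0} \<subseteq> C" using in_coneI[of _ v] v by auto
  ultimately show "v \<in> interior C" using v by (intro interiorI) auto
qed

lemma frontier_cone: "frontier C = {v \<in> C. l v v = 0}"
  using cone_form_nonneg by (force simp: frontier_def interior_cone cone_closed closure_closed)

lemma null_partner:
  assumes "v0 \<in> frontier C" "v0 \<noteq> 0"
  obtains v1 where "v1 \<in> frontier C" "l v0 v1 = 1"
proof -
  have v0: "v0 \<in> C" "l v0 v0 = 0" using assms by (auto simp: frontier_cone)
  obtain e where e: "e \<in> C" "l e e = 1" using timelike_in_cone by blast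
  have pos: "l v0 e > 0"
    using cone_form_cone[OF v0(1) e(1)] negative_on_timelike_perp[of e v0] e v0 assms(2)
      form_commute[of e v0] by force
  \<comment> \<open>Subtracting the multiple of \<open>v0\<close> makes \<open>e\<close> null, and
    the factor in front normalises the pairing with \<open>v0\<close> to 1.\<close>
  define v1 where "v1 = (1 / l v0 e) *\<^sub>R (e - (1 / (2 * l v0 e)) *\<^sub>R v0)"
  have 1: "l v0 v1 = 1" using pos v0 by (simp add: v1_def form_linear)
  have "l v1 v1 = 0" using pos v0 e form_commute[of e v0] by (simp add: v1_def form_linear)
  moreover have "v1 \<in> C"
    using in_coneI[of v1 v0] v0 1 calculation form_commute[of v1 v0] by simp
  ultimately show ?thesis using that 1 by (auto simp: frontier_cone)
qed

lemma linear_nu: "linear (nu l v0 y)"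
  by (rule linearI) (simp_all add: nu_def form_linear algebra_simps)

lemma nu_zero [simp]: "nu l v0 0 v = v"
  by (simp add: nu_def form_linear)

context
  fixes v0 assumes null: "l v0 v0 = 0"
begin

lemma nu_fixes: "l y v0 = 0 \<Longrightarrow> nu l v0 y v0 = v0"
  using form_commute[of v0 y] by (simp add: nu_def null)

lemma nu_height: "l y v0 = 0 \<Longrightarrow> l (nu l v0 y v) v0 = l v v0"
  by (simp add: nu_def form_linear null)

text \<open>So \<open>nu\<close> depends only on \<open>y\<close> modulo \<open>v0\<close>, which
  allows changing the complement \<open>N\<close> without changing the linear parts.\<close>

lemma nu_shift: "l y v0 = 0 \<Longrightarrow> nu l v0 (y + r *\<^sub>R v0) v = nu l v0 y v"
  using form_commute[of v0 y] by (simp add: nu_def form_linear null algebra_simps)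

lemma nu_isometry:
  assumes "l y v0 = 0"
  shows "l (nu l v0 y v) (nu l v0 y w) = l v w"
  using assms form_commute[of v0 y] form_commute[of y w] form_commute[of y v]
    form_commute[of v0 w] form_commute[of v0 v]
  by (simp add: nu_def form_linear null) (simp add: algebra_simps)

lemma nu_add:
  assumes "l y v0 = 0" "l x v0 = 0"
  shows "nu l v0 x (nu l v0 y v) = nu l v0 (x + y) v"
  using assms form_commute[of v0 y] form_commute[of v0 x] form_commute[of y x]
  by (simp add: nu_def form_linear null) (simp add: algebra_simps flip: scaleR_add_left)

text \<open>\<open>nu\<close> preserves squares and the pairing with \<open>v0\<close>. A positive
  pairing picks the right half cone; a cone vector with pairing zero is a multiple of
  \<open>v0\<close>, which is fixed.\<close>

lemma nu_in_cone:
  assumes "v0 \<in> C" "l y v0 = 0" "v \<in> C"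
  shows "nu l v0 y v \<in> C"
proof (cases "l v v0 = 0")
  case False
  then have "l (nu l v0 y v) v0 > 0"
    using cone_form_cone[OF assms(3,1)] assms(2) by (simp add: nu_height)
  then show ?thesis
    using assms in_coneI[of "nu l v0 y v" v0] nu_isometry cone_form_nonneg by simp
next
  case True
  show ?thesis
  proof (cases "v0 = 0")
    case False
    obtain r where "v = r *\<^sub>R v0"
      using cone_orthogonal_collinear[of v0 v] True False assms cone_form_nonneg
        form_commute[of v v0] by metis
    then have "nu l v0 y v = v"
      using nu_fixes[OF assms(2)] linear_nu[of v0 y] by (simp add: linear_cmul)
    then show ?thesis using assms by simp
  next
    case True
    then show ?thesis using assms by (simp add: nu_def form_linear)
  qed
qed

lemma nu_cone:
  assumes "v0 \<in> C" "l y v0 = 0"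
  shows "nu l v0 y ` C = C"
proof
  show "nu l v0 y ` C \<subseteq> C" using nu_in_cone assms by auto
  show "C \<subseteq> nu l v0 y ` C"
  proof
    fix v assume v: "v \<in> C"
    have m: "l (- y) v0 = 0" using assms by (simp add: form_linear)
    have "nu l v0 (- y) v \<in> C" using nu_in_cone[OF assms(1) m v] .
    moreover have "nu l v0 y (nu l v0 (- y) v) = v" using nu_add[OF m assms(2)] by simp
    ultimately show "v \<in> nu l v0 y ` C" by (metis imageI)
  qed
qed

end

end

section \<open>Causality in terms of the group\<close>

text \<open>The cone is an intersection of half-spaces, so the mean value theorem applies to it.\<close>

lemma difference_in_cone:
  fixes c :: "real \<Rightarrow> 'a::euclidean_space"
  assumes C: "closed C" "convex C" "cone C" "0 \<in> C" and ab: "a \<le> b"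
    and c: "\<And>s. s \<in> {a..b} \<Longrightarrow> \<exists>u\<in>C. (c has_vector_derivative u) (at s within {a..b})"
  shows "c b - c a \<in> C"
proof (rule ccontr)
  assume "c b - c a \<notin> C"
  then obtain h \<beta> where h: "h \<bullet> (c b - c a) < \<beta>" "\<And>x. x \<in> C \<Longrightarrow> h \<bullet> x > \<beta>"
    using separating_hyperplane_closed_point[of C "c b - c a"] C by blast
  have "\<beta> < 0" using h(2)[OF C(4)] by simp
  have pos: "h \<bullet> u \<ge> 0" if "u \<in> C" for u
  proof (rule ccontr)
    assume neg: "\<not> ?thesis"
    \<comment> \<open>A negative value could be scaled to exactly \<open>\<beta>\<close>, but the
      separation is strict; so \<open>h\<close> is nonnegative on the cone and monotone along the
      curve.\<close>
    then have "(\<beta> / (h \<bullet> u)) *\<^sub>R u \<in> C"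
      using C(3) that \<open>\<beta> < 0\<close> unfolding cone_def by (simp add: divide_nonpos_neg)
    from h(2)[OF this] show False using neg by simp
  qed
  obtain u where u: "\<And>s. s \<in> {a..b} \<Longrightarrow> u s \<in> C"
    "\<And>s. s \<in> {a..b} \<Longrightarrow> (c has_vector_derivative u s) (at s within {a..b})"
    using c by metis
  have "h \<bullet> c a \<le> h \<bullet> c b"
  proof (rule DERIV_nonneg_imp_increasing_open[OF ab])
    show "\<exists>y. ((\<lambda>s. h \<bullet> c s) has_real_derivative y) (at s) \<and> 0 \<le> y" if s: "a < s" "s < b" for s
    proof -
      have "(c has_vector_derivative u s) (at s)"
        using u(2)[of s] s at_within_Icc_at[of a s b] by simp
      then have "((\<lambda>s. h \<bullet> c s) has_derivative (\<lambda>x. h \<bullet> (x *\<^sub>R u s))) (at s)"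
        unfolding has_vector_derivative_def by (rule has_derivative_inner_right)
      then have "((\<lambda>s. h \<bullet> c s) has_real_derivative (h \<bullet> u s)) (at s)"
        by (simp add: has_field_derivative_def mult_commute_abs)
      then show ?thesis using pos[OF u(1)[of s]] s by auto
    qed
    have "continuous_on {a..b} c"
      using u(2) by (meson continuous_on_eq_continuous_within has_vector_derivative_continuous)
    then show "continuous_on {a..b} (\<lambda>s. h \<bullet> c s)" by (intro continuous_intros)
  qed
  then show False using h(1) \<open>\<beta> < 0\<close> by (simp add: inner_diff_right)
qed

locale flat_group = lorentz_cone l C
  for l :: "'a::euclidean_space \<Rightarrow> 'a \<Rightarrow> real" and C +
  fixes \<Gamma> :: "('a \<Rightarrow> 'a) set"
  assumes flat: "flat_lorentz_group l C \<Gamma>"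
begin

lemma id_mem: "id \<in> \<Gamma>"
  and comp_mem: "g \<in> \<Gamma> \<Longrightarrow> h \<in> \<Gamma> \<Longrightarrow> g \<circ> h \<in> \<Gamma>"
  and inv_mem: "g \<in> \<Gamma> \<Longrightarrow> inv g \<in> \<Gamma>"
  and affine: "g \<in> \<Gamma> \<Longrightarrow> lorentz_affine l C g"
  and free: "g \<in> \<Gamma> \<Longrightarrow> g v = v \<Longrightarrow> g = id"
  and proper: "compact K \<Longrightarrow> finite {g \<in> \<Gamma>. g ` K \<inter> K \<noteq> {}}"
  using flat unfolding flat_lorentz_group_def by blast+

lemma bij: "g \<in> \<Gamma> \<Longrightarrow> bij g"
  and linear_linear_part: "g \<in> \<Gamma> \<Longrightarrow> linear (linear_part g)"
  and linear_part_isometry: "g \<in> \<Gamma> \<Longrightarrow> l (linear_part g v) (linear_part g w) = l v w"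
  and linear_part_cone: "g \<in> \<Gamma> \<Longrightarrow> linear_part g ` C = C"
  using affine[of g] by (simp_all add: lorentz_affine_def)

lemma inv_apply: "g \<in> \<Gamma> \<Longrightarrow> inv g (g v) = v" "g \<in> \<Gamma> \<Longrightarrow> g (inv g v) = v"
  using bij[of g] by (simp_all add: bij_is_inj bij_is_surj surj_f_inv_f)

lemma group_diff: "g \<in> \<Gamma> \<Longrightarrow> g v - g w = linear_part g (v - w)"
  using linear_linear_part[of g] by (simp add: linear_diff) (simp add: linear_part_def)

lemma group_mono: "g \<in> \<Gamma> \<Longrightarrow> v - w \<in> C \<Longrightarrow> g v - g w \<in> C"
  using linear_part_cone[of g] by (auto simp: group_diff)

lemma group_mono_iff: "g \<in> \<Gamma> \<Longrightarrow> g v - g w \<in> C \<longleftrightarrow> v - w \<in> C"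
  using group_mono[of g v w] group_mono[of "inv g" "g v" "g w"] by (auto simp: inv_apply inv_mem)

lemma group_continuous: "g \<in> \<Gamma> \<Longrightarrow> continuous_on S g"
proof -
  assume g: "g \<in> \<Gamma>"
  have "continuous_on S (\<lambda>v. linear_part g v + g 0)"
    using linear_linear_part[OF g] linear_continuous_on linear_conv_bounded_linear
    by (intro continuous_on_add continuous_on_const) blast
  then show ?thesis by (simp add: linear_part_def)
qed

lemma orbit_eq_iff: "orbit \<Gamma> v = orbit \<Gamma> w \<longleftrightarrow> (\<exists>g\<in>\<Gamma>. w = g v)"
proof
  assume "orbit \<Gamma> v = orbit \<Gamma> w"
  moreover have "w \<in> orbit \<Gamma> w"
    unfolding orbit_def by (rule image_eqI[OF _ id_mem]) simp
  ultimately show "\<exists>g\<in>\<Gamma>. w = g v" by (auto simp: orbit_def)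
next
  assume "\<exists>g\<in>\<Gamma>. w = g v"
  then obtain g where g: "g \<in> \<Gamma>" "w = g v" by blast
  have "h v \<in> orbit \<Gamma> w" if "h \<in> \<Gamma>" for h
    unfolding orbit_def using that g
    by (intro image_eqI[OF _ comp_mem[OF that inv_mem[OF g(1)]]]) (simp add: inv_apply)
  moreover have "h w \<in> orbit \<Gamma> v" if "h \<in> \<Gamma>" for h
    unfolding orbit_def using that g by (intro image_eqI[OF _ comp_mem[OF that g(1)]]) simp
  ultimately show "orbit \<Gamma> v = orbit \<Gamma> w" unfolding orbit_def by blast
qed

definition invariant :: "'a set \<Rightarrow> bool" where
  "invariant A \<longleftrightarrow> (\<forall>g\<in>\<Gamma>. \<forall>v\<in>A. g v \<in> A)"

lemma orbit_mem_image_iff: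
  assumes "invariant A"
  shows "orbit \<Gamma> x \<in> orbit \<Gamma> ` A \<longleftrightarrow> x \<in> A"
proof
  assume "orbit \<Gamma> x \<in> orbit \<Gamma> ` A"
  then obtain v where v: "v \<in> A" "orbit \<Gamma> v = orbit \<Gamma> x" by auto
  then obtain g where "g \<in> \<Gamma>" "x = g v" using orbit_eq_iff[of v x] by auto
  then show "x \<in> A" using assms v by (simp add: invariant_def)
qed auto

definition orbit_le :: "'a set \<Rightarrow> 'a set \<Rightarrow> bool" where
  "orbit_le p q \<longleftrightarrow> (\<exists>v u. p = orbit \<Gamma> v \<and> q = orbit \<Gamma> u \<and> u - v \<in> C)"

text \<open>The representatives of \<open>q\<close> in the two hypotheses differ by a group element.
  The group preserves the cone, so the first pair can be moved to match the second.\<close>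

lemma orbit_le_trans:
  assumes "orbit_le p q" "orbit_le q r"
  shows "orbit_le p r"
proof -
  obtain v u where v: "p = orbit \<Gamma> v" "q = orbit \<Gamma> u" "u - v \<in> C"
    using assms(1) by (auto simp: orbit_le_def)
  obtain u' w where w: "q = orbit \<Gamma> u'" "r = orbit \<Gamma> w" "w - u' \<in> C"
    using assms(2) by (auto simp: orbit_le_def)
  obtain g where g: "g \<in> \<Gamma>" "u' = g u" using v w orbit_eq_iff[of u u'] by auto
  have "u' - g v \<in> C" using g v group_mono by blast
  then have "w - g v \<in> C" using cone_add[OF w(3)] by fastforce
  moreover have "p = orbit \<Gamma> (g v)" using v g orbit_eq_iff[of v "g v"] by auto
  ultimately show ?thesis using w(2) unfolding orbit_le_def by blast
qed

text \<open>The lifts \<open>c\<close> exist only locally. Bisection of the interval and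
  transitivity of \<open>orbit_le\<close> replace a lift of the whole segment.\<close>

lemma timelike_segment_orbit_le:
  assumes "timelike_segment C \<Gamma> \<eta> a b" "a \<le> s" "s \<le> t" "t \<le> b"
  shows "orbit_le (\<eta> s) (\<eta> t)"
proof -
  define P where "P s t \<longleftrightarrow> (a \<le> s \<longrightarrow> t \<le> b \<longrightarrow> orbit_le (\<eta> s) (\<eta> t))" for s t
  have "P s t"
  proof (rule Bolzano[OF \<open>s \<le> t\<close>])
    fix x y z assume "P x y" "P y z" "x \<le> y" "y \<le> z"
    then show "P x z" unfolding P_def using orbit_le_trans by (meson order_trans)
  next
    fix x assume "s \<le> x" "x \<le> t"
    then have x: "x \<in> {a..b}" using assms by auto
    obtain \<epsilon> c where \<epsilon>: "\<epsilon> > 0"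
      and c: "\<And>s. s \<in> {a..b} \<inter> {x-\<epsilon>..x+\<epsilon>} \<Longrightarrow> \<eta> s = orbit \<Gamma> (c s) \<and>
        (\<exists>u\<in>C. (c has_vector_derivative u) (at s within {a..b} \<inter> {x-\<epsilon>..x+\<epsilon>}))"
      using assms(1) x unfolding timelike_segment_def Let_def by blast
    have "P y z" if yz: "y \<le> x" "x \<le> z" "z - y < \<epsilon>" for y z
      unfolding P_def
    proof (intro impI)
      assume "a \<le> y" "z \<le> b"
      then have sub: "{y..z} \<subseteq> {a..b} \<inter> {x-\<epsilon>..x+\<epsilon>}" using yz by auto
      have "c z - c y \<in> C"
      proof (rule difference_in_cone)
        show "\<exists>u\<in>C. (c has_vector_derivative u) (at s within {y..z})" if "s \<in> {y..z}" for s
          using c[of s] sub that has_vector_derivative_within_subset[OF _ sub] by blast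
      qed (use cone_closed cone_convex cone_cone yz in auto)
      then show "orbit_le (\<eta> y) (\<eta> z)"
        using c[of y] c[of z] sub yz unfolding orbit_le_def by force
    qed
    then show "\<exists>d>0. \<forall>a b. a \<le> x \<and> x \<le> b \<and> b - a < d \<longrightarrow> P a b" using \<epsilon> by blast
  qed
  then show ?thesis using assms by (simp add: P_def)
qed

lemma timelike_path_orbit_le:
  assumes "timelike_path C \<Gamma> \<eta> a b" "a < b" "s \<in> {a..b}"
  shows "orbit_le (\<eta> a) (\<eta> s) \<and> orbit_le (\<eta> s) (\<eta> b)"
proof -
  obtain m t where t: "t 0 = a" "t m = b"
    "\<And>i. i < m \<Longrightarrow> t i < t (Suc i) \<and> timelike_segment C \<Gamma> \<eta> (t i) (t (Suc i))"
    using assms(1) unfolding timelike_path_def by blast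
  \<comment> \<open>The claim starts at \<open>k = 1\<close>: reflexivity at \<open>a\<close>
    requires \<open>\<eta> a\<close> to be an orbit, which is known only from a segment.\<close>
  have main: "a \<le> t k \<and> (\<forall>x y. a \<le> x \<longrightarrow> x \<le> y \<longrightarrow> y \<le> t k \<longrightarrow> orbit_le (\<eta> x) (\<eta> y))"
    if "0 < k" "k \<le> m" for k
    using that
  proof (induction k)
    case (Suc k)
    have step: "t k < t (Suc k)" "timelike_segment C \<Gamma> \<eta> (t k) (t (Suc k))"
      using t(3)[of k] Suc by auto
    note seg = timelike_segment_orbit_le[OF step(2)]
    show ?case
    proof (cases "k = 0")
      case True
      then show ?thesis using seg step t(1) by auto
    next
      case False
      then have IH: "a \<le> t k" "\<And>x y. a \<le> x \<Longrightarrow> x \<le> y \<Longrightarrow> y \<le> t k \<Longrightarrow> orbit_le (\<eta> x) (\<eta> y)"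
        using Suc by auto
      have "orbit_le (\<eta> x) (\<eta> y)" if xy: "a \<le> x" "x \<le> y" "y \<le> t (Suc k)" for x y
      proof -
        consider "y \<le> t k" | "x \<le> t k" "t k \<le> y" | "t k \<le> x" by linarith
        then show ?thesis
        proof cases
          case 2
          then show ?thesis using orbit_le_trans[OF IH(2)[of x "t k"] seg[of "t k" y]] xy by simp
        qed (use IH seg xy in auto)
      qed
      then show ?thesis using IH step by auto
    qed
  qed simp
  have "m > 0" using t(1,2) assms(2) by (cases m) auto
  then show ?thesis using main[of m] t assms(3) by auto
qed

text \<open>If \<open>g v - v\<close> lies in \<open>C\<close>, the straight segment from
  \<open>v\<close> to \<open>g v\<close> projects to a closed timelike path; were it constant,
  infinitely many points of a compact set would lie in one orbit, against properness. Conversely, a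
  closed path through a second point puts \<open>v\<close>, \<open>u\<close> and \<open>h v\<close>
  in causal order; \<open>h = id\<close> and pointedness force \<open>u = v\<close>.\<close>

lemma causal_iff: "causal C \<Gamma> \<longleftrightarrow> (\<forall>g\<in>\<Gamma>. \<forall>v. g v - v \<in> C \<longrightarrow> g = id)"
proof
  assume causal: "causal C \<Gamma>"
  show "\<forall>g\<in>\<Gamma>. \<forall>v. g v - v \<in> C \<longrightarrow> g = id"
  proof (intro ballI allI impI, rule ccontr)
    fix g v assume g: "g \<in> \<Gamma>" "g v - v \<in> C" "g \<noteq> id"
    define w where "w = g v - v"
    have "w \<noteq> 0" using free[of g v] g by (auto simp: w_def)
    define c where "c s = v + s *\<^sub>R w" for s :: real
    define \<eta> where "\<eta> s = orbit \<Gamma> (c s)" for s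
    have deriv: "(c has_vector_derivative w) (at s within S)" for s S
      unfolding c_def by (auto intro!: derivative_eq_intros)
    define D where "D k = (if k = 0 then c else if k = 1 then (\<lambda>_. w) else (\<lambda>_. 0))" for k :: nat
    have "(D k has_vector_derivative D (Suc k) s) (at s within S)" for k s S
      using deriv by (auto simp: D_def)
    then have smooth: "smooth_curve_on c S" for S
      unfolding smooth_curve_on_def by (intro exI[of _ D]) (auto simp: D_def)
    have "timelike_segment C \<Gamma> \<eta> 0 1"
      unfolding timelike_segment_def Let_def
    proof (intro ballI exI[of _ 1] exI[of _ c] conjI)
      fix t s :: real
      show "\<exists>u\<in>C. (c has_vector_derivative u) (at s within {0..1} \<inter> {t - 1..t + 1})"
        using deriv g(2) w_def by auto
    qed (use smooth \<eta>_def in auto)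
    then have "timelike_path C \<Gamma> \<eta> 0 1"
      unfolding timelike_path_def by (intro exI[of _ 1] exI[of _ real]) simp
    moreover have "\<eta> 0 = \<eta> 1"
      using g(1) unfolding \<eta>_def c_def w_def orbit_eq_iff by auto
    ultimately have const: "\<eta> t = \<eta> 0" if "t \<in> {0..1}" for t
      using causal that unfolding causal_def by (metis zero_less_one)
    define K where "K = c ` {0..1}"
    define F where "F = {g \<in> \<Gamma>. g ` K \<inter> K \<noteq> {}}"
    have "compact K" unfolding K_def c_def by (intro compact_continuous_image continuous_intros) auto
    then have "finite F" unfolding F_def by (rule proper)
    moreover have "K \<subseteq> (\<lambda>h. h v) ` F"
    proof
      fix x assume x: "x \<in> K"
      then obtain t where "t \<in> {0..1}" "x = c t" by (auto simp: K_def)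
      then have "orbit \<Gamma> v = orbit \<Gamma> x" using const[of t] by (simp add: \<eta>_def c_def)
      then obtain h where h: "h \<in> \<Gamma>" "x = h v" using orbit_eq_iff[of v x] by auto
      moreover have "v \<in> K" unfolding K_def c_def by (rule image_eqI[of _ _ 0]) auto
      ultimately show "x \<in> (\<lambda>h. h v) ` F" using x by (auto simp: F_def)
    qed
    ultimately have "finite K" using finite_surj by blast
    moreover have "inj_on c {0..1}" using \<open>w \<noteq> 0\<close> by (auto simp: inj_on_def c_def)
    ultimately have "finite {0..1::real}" unfolding K_def by (simp add: finite_image_iff)
    then show False using infinite_Icc[of 0 "1::real"] by simp
  qed
next
  assume *: "\<forall>g\<in>\<Gamma>. \<forall>v. g v - v \<in> C \<longrightarrow> g = id"
  show "causal C \<Gamma>" unfolding causal_def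
  proof (intro notI, elim exE conjE bexE)
    fix \<eta> a b t
    assume \<eta>: "a < b" "timelike_path C \<Gamma> \<eta> a b" "\<eta> a = \<eta> b" "t \<in> {a..b}" "\<eta> t \<noteq> \<eta> a"
    have le: "orbit_le (\<eta> a) (\<eta> t)" "orbit_le (\<eta> t) (\<eta> b)"
      using timelike_path_orbit_le[OF \<eta>(2,1,4)] by auto
    obtain v u where v: "\<eta> a = orbit \<Gamma> v" "\<eta> t = orbit \<Gamma> u" "u - v \<in> C"
      using le(1) by (auto simp: orbit_le_def)
    obtain u' w where w: "\<eta> t = orbit \<Gamma> u'" "\<eta> b = orbit \<Gamma> w" "w - u' \<in> C"
      using le(2) by (auto simp: orbit_le_def)
    obtain g where g: "g \<in> \<Gamma>" "u = g u'" using v w orbit_eq_iff[of u' u] by auto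
    obtain k where k: "k \<in> \<Gamma>" "w = k v" using v(1) w(2) \<eta>(3) orbit_eq_iff[of v w] by auto
    define h where "h = g \<circ> k"
    have h: "h \<in> \<Gamma>" "g w = h v" using comp_mem g k by (simp_all add: h_def)
    have up: "h v - u \<in> C" using group_mono[OF g(1) w(3)] g h by simp
    then have "h v - v \<in> C" using cone_add[OF up v(3)] by simp
    then have "h = id" using * h(1) by blast
    then have "- (u - v) \<in> C" using up by simp
    then have "u = v" using cone_pointed[OF v(3)] by simp
    then show False using v \<eta> by simp
  qed
qed

section \<open>Strict causality as a condition on closures in V\<close>

definition orbit_future :: "'a \<Rightarrow> 'a set" where
  "orbit_future v = {u. \<exists>g\<in>\<Gamma>. u - g v \<in> C}"

definition orbit_past :: "'a \<Rightarrow> 'a set" where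
  "orbit_past v = {u. \<exists>g\<in>\<Gamma>. g v - u \<in> C}"

lemma orbit_future_invariant: "invariant (orbit_future v)"
  unfolding invariant_def
proof (intro ballI)
  fix g u assume g: "g \<in> \<Gamma>" "u \<in> orbit_future v"
  obtain h where "h \<in> \<Gamma>" "u - h v \<in> C" using g(2) by (auto simp: orbit_future_def)
  then show "g u \<in> orbit_future v"
    unfolding orbit_future_def using comp_mem[OF g(1), of h]
      group_mono[OF g(1), of u "h v"] by (auto intro!: bexI[of _ "g \<circ> h"])
qed

lemma orbit_past_invariant: "invariant (orbit_past v)"
  unfolding invariant_def
proof (intro ballI)
  fix g u assume g: "g \<in> \<Gamma>" "u \<in> orbit_past v"
  obtain h where "h \<in> \<Gamma>" "h v - u \<in> C" using g(2) by (auto simp: orbit_past_def)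
  then show "g u \<in> orbit_past v"
    unfolding orbit_past_def using comp_mem[OF g(1), of h]
      group_mono[OF g(1), of "h v" u] by (auto intro!: bexI[of _ "g \<circ> h"])
qed

lemma closure_invariant:
  assumes "invariant A"
  shows "invariant (closure A)"
proof -
  have "g ` closure A \<subseteq> closure A" if "g \<in> \<Gamma>" for g
    using assms closure_subset that
    by (intro image_closure_subset group_continuous) (auto simp: invariant_def)
  then show ?thesis by (auto simp: invariant_def)
qed

lemma future_eq: "future C \<Gamma> v = orbit \<Gamma> ` orbit_future v"
proof -
  have "orbit \<Gamma> u \<in> future C \<Gamma> v" if "g \<in> \<Gamma>" "u - g v \<in> C" for g u
  proof -
    have "inv g u - v \<in> C"
      using group_mono_iff[OF that(1), of "inv g u" v] that by (simp add: inv_apply)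
    then have "inv g u \<in> {v + c | c. c \<in> C}" by (auto intro!: exI[of _ "inv g u - v"])
    moreover have "orbit \<Gamma> (inv g u) = orbit \<Gamma> u"
      using orbit_eq_iff[of "inv g u" u] that inv_apply(2)[of g u] by force
    ultimately show ?thesis unfolding future_def by (intro image_eqI[of _ _ "inv g u"]) simp_all
  qed
  moreover have "v + c \<in> orbit_future v" if "c \<in> C" for c
    unfolding orbit_future_def using id_mem that by (auto intro!: bexI[of _ id])
  ultimately show ?thesis unfolding future_def orbit_future_def by auto
qed

lemma past_eq: "past C \<Gamma> v = orbit \<Gamma> ` orbit_past v"
proof -
  have "orbit \<Gamma> u \<in> past C \<Gamma> v" if "g \<in> \<Gamma>" "g v - u \<in> C" for g u
  proof -
    have "v - inv g u \<in> C"
      using group_mono_iff[OF that(1), of v "inv g u"] that by (simp add: inv_apply)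
    then have "inv g u \<in> {v - c | c. c \<in> C}" by (auto intro!: exI[of _ "v - inv g u"])
    moreover have "orbit \<Gamma> (inv g u) = orbit \<Gamma> u"
      using orbit_eq_iff[of "inv g u" u] that inv_apply(2)[of g u] by force
    ultimately show ?thesis unfolding past_def by (intro image_eqI[of _ _ "inv g u"]) simp_all
  qed
  moreover have "v - c \<in> orbit_past v" if "c \<in> C" for c
    unfolding orbit_past_def using id_mem that by (auto intro!: bexI[of _ id])
  ultimately show ?thesis unfolding past_def orbit_past_def by auto
qed

lemma open_saturation:
  assumes "open W"
  shows "openin (quotient_manifold \<Gamma>) (orbit \<Gamma> ` W)"
proof -
  have "open (g ` W)" if g: "g \<in> \<Gamma>" for g
  proof -
    have "g ` W = inv g -` W"
      using bij_vimage_eq_inv_image[OF bij_imp_bij_inv[OF bij[OF g]]] bij[OF g]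
      by (simp add: inv_inv_eq)
    then show ?thesis
      using assms group_continuous[OF inv_mem[OF g], of UNIV] open_vimage by auto
  qed
  moreover have "{x. orbit \<Gamma> x \<in> orbit \<Gamma> ` W} = (\<Union>g\<in>\<Gamma>. g ` W)"
  proof (intro set_eqI iffI)
    fix x assume "x \<in> {x. orbit \<Gamma> x \<in> orbit \<Gamma> ` W}"
    then obtain w where "w \<in> W" "orbit \<Gamma> w = orbit \<Gamma> x" by auto
    then show "x \<in> (\<Union>g\<in>\<Gamma>. g ` W)" using orbit_eq_iff[of w x] by auto
  next
    fix x assume "x \<in> (\<Union>g\<in>\<Gamma>. g ` W)"
    then obtain g w where "g \<in> \<Gamma>" "w \<in> W" "x = g w" by auto
    then show "x \<in> {x. orbit \<Gamma> x \<in> orbit \<Gamma> ` W}" using orbit_eq_iff[of w x] by auto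
  qed
  ultimately show ?thesis by (auto simp: openin_orbit_space)
qed

lemma closedin_saturated:
  assumes "closed A" "invariant A"
  shows "closedin (quotient_manifold \<Gamma>) (orbit \<Gamma> ` A)"
proof -
  have "{x. orbit \<Gamma> x \<in> orbit \<Gamma> ` A} = A" using orbit_mem_image_iff[OF assms(2)] by simp
  moreover have "\<forall>U\<subseteq>topspace (quotient_manifold \<Gamma>).
      closedin euclidean {x \<in> topspace euclidean. orbit \<Gamma> x \<in> U} = closedin (quotient_manifold \<Gamma>) U"
    using quotient_map_orbit_space[of euclidean \<Gamma>] unfolding quotient_map_closedin by blast
  from this[rule_format, of "orbit \<Gamma> ` A"]
  have "closed {x. orbit \<Gamma> x \<in> orbit \<Gamma> ` A} = closedin (quotient_manifold \<Gamma>) (orbit \<Gamma> ` A)"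
    by (simp add: topspace_orbit_space image_mono)
  ultimately show ?thesis using assms(1) by simp
qed

lemma closed_near_imp:
  assumes "invariant A"
    and "closedin (subtopology (quotient_manifold \<Gamma>) U) (U \<inter> orbit \<Gamma> ` A)"
    and "open W" "orbit \<Gamma> ` W \<subseteq> U"
  shows "W \<inter> closure A \<subseteq> A"
proof
  fix u assume u: "u \<in> W \<inter> closure A"
  obtain D where D: "closedin (quotient_manifold \<Gamma>) D" "U \<inter> orbit \<Gamma> ` A = D \<inter> U"
    using assms(2) unfolding closedin_subtopology by blast
  have "closed {x. orbit \<Gamma> x \<in> D}"
    using quotient_map_orbit_space[of euclidean \<Gamma>] D(1) closedin_subset[OF D(1)]
    unfolding quotient_map_closedin by (auto simp: topspace_orbit_space)
  moreover have "W \<inter> A \<subseteq> {x. orbit \<Gamma> x \<in> D}" using D(2) assms(4) by blast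
  moreover have "u \<in> closure (W \<inter> A)" using open_Int_closure_subset[OF assms(3)] u by blast
  ultimately have "orbit \<Gamma> u \<in> D" using closure_minimal by blast
  then have "orbit \<Gamma> u \<in> orbit \<Gamma> ` A" using D(2) u assms(4) by blast
  then show "u \<in> A" using orbit_mem_image_iff[OF assms(1)] by blast
qed

lemma closed_nearI:
  assumes inv: "invariant A" and sub: "W \<inter> closure A \<subseteq> A"
  shows "closedin (subtopology (quotient_manifold \<Gamma>) (orbit \<Gamma> ` W)) (orbit \<Gamma> ` W \<inter> orbit \<Gamma> ` A)"
proof -
  have "orbit \<Gamma> ` W \<inter> orbit \<Gamma> ` A = orbit \<Gamma> ` closure A \<inter> orbit \<Gamma> ` W"
  proof
    show "orbit \<Gamma> ` W \<inter> orbit \<Gamma> ` A \<subseteq> orbit \<Gamma> ` closure A \<inter> orbit \<Gamma> ` W"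
      using image_mono[OF closure_subset, of "orbit \<Gamma>" A] by auto
    show "orbit \<Gamma> ` closure A \<inter> orbit \<Gamma> ` W \<subseteq> orbit \<Gamma> ` W \<inter> orbit \<Gamma> ` A"
    proof
      fix p assume p: "p \<in> orbit \<Gamma> ` closure A \<inter> orbit \<Gamma> ` W"
      then obtain u where u: "u \<in> W" "p = orbit \<Gamma> u" by auto
      then have "u \<in> closure A" using p orbit_mem_image_iff[OF closure_invariant[OF inv], of u] by simp
      then show "p \<in> orbit \<Gamma> ` W \<inter> orbit \<Gamma> ` A" using u sub by auto
    qed
  qed
  moreover have "closedin (quotient_manifold \<Gamma>) (orbit \<Gamma> ` closure A)"
    using closedin_saturated[OF closed_closure closure_invariant[OF inv]] .
  ultimately show ?thesis unfolding closedin_subtopology by blast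
qed

text \<open>The quotient map is open and continuous, so neighbourhoods correspond: the preimage of
  the interior of \<open>U\<close> serves as \<open>W\<close>, the image of \<open>W\<close> as
  \<open>U\<close>. Relative closedness becomes a statement on closures of invariant sets.\<close>

lemma strictly_causal_iff:
  "strictly_causal C \<Gamma> \<longleftrightarrow> (\<forall>g\<in>\<Gamma>. \<forall>v. g v - v \<in> C \<longrightarrow> g = id) \<and>
    (\<forall>v. \<exists>W. open W \<and> v \<in> W \<and> W \<inter> closure (orbit_future v) \<subseteq> orbit_future v \<and>
      W \<inter> closure (orbit_past v) \<subseteq> orbit_past v)"
proof -
  have "(\<exists>U. U \<subseteq> topspace (quotient_manifold \<Gamma>) \<and>
        orbit \<Gamma> v \<in> (quotient_manifold \<Gamma>) interior_of U \<and>
        closedin (subtopology (quotient_manifold \<Gamma>) U) (U \<inter> future C \<Gamma> v) \<and>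
        closedin (subtopology (quotient_manifold \<Gamma>) U) (U \<inter> past C \<Gamma> v)) \<longleftrightarrow>
      (\<exists>W. open W \<and> v \<in> W \<and> W \<inter> closure (orbit_future v) \<subseteq> orbit_future v \<and>
      W \<inter> closure (orbit_past v) \<subseteq> orbit_past v)" (is "?L \<longleftrightarrow> ?R") for v
  proof
    assume ?L
    then obtain U where U: "orbit \<Gamma> v \<in> (quotient_manifold \<Gamma>) interior_of U"
        "closedin (subtopology (quotient_manifold \<Gamma>) U) (U \<inter> orbit \<Gamma> ` orbit_future v)"
        "closedin (subtopology (quotient_manifold \<Gamma>) U) (U \<inter> orbit \<Gamma> ` orbit_past v)"
      unfolding future_eq past_eq by blast
    define W where "W = {x. orbit \<Gamma> x \<in> (quotient_manifold \<Gamma>) interior_of U}"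
    have W: "open W"
      using openin_interior_of[of "quotient_manifold \<Gamma>" U]
      unfolding W_def openin_orbit_space by simp
    have sub: "orbit \<Gamma> ` W \<subseteq> U"
      unfolding W_def using interior_of_subset[of "quotient_manifold \<Gamma>" U] by auto
    have "v \<in> W" using U(1) by (simp add: W_def)
    then show ?R
      using W closed_near_imp[OF orbit_future_invariant U(2) W sub]
        closed_near_imp[OF orbit_past_invariant U(3) W sub] by (intro exI[of _ W] conjI)
  next
    assume ?R
    then obtain W where W: "open W" "v \<in> W" "W \<inter> closure (orbit_future v) \<subseteq> orbit_future v"
      "W \<inter> closure (orbit_past v) \<subseteq> orbit_past v" by blast
    have "orbit \<Gamma> v \<in> (quotient_manifold \<Gamma>) interior_of (orbit \<Gamma> ` W)"
      using open_saturation[OF W(1)] W(2) by (simp add: interior_of_openin)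
    moreover have "orbit \<Gamma> ` W \<subseteq> topspace (quotient_manifold \<Gamma>)"
      by (auto simp: topspace_orbit_space)
    ultimately show ?L
      unfolding future_eq past_eq
      using closed_nearI[OF orbit_future_invariant W(3)] closed_nearI[OF orbit_past_invariant W(4)]
      by (intro exI[of _ "orbit \<Gamma> ` W"] conjI)
  qed
  then show ?thesis unfolding strictly_causal_def causal_iff by simp
qed

text \<open>If \<open>g v\<close> came arbitrarily close to \<open>v + \<real>c\<close> far away from \<open>v\<close>, the closure of the orbit of
  \<open>v + C\<close> or of \<open>v - C\<close> would contain a segment of this line on the wrong side of \<open>v\<close>.\<close>

lemma strictly_causal_no_escape:
  assumes sc: "strictly_causal C \<Gamma>" and c: "c \<in> C" "c \<noteq> 0" and "\<rho> > 0"
  obtains \<delta> where "\<delta> > 0"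
    "\<And>g e r. g \<in> \<Gamma> \<Longrightarrow> g v = v + e + r *\<^sub>R c \<Longrightarrow> norm e < \<delta> \<Longrightarrow> \<bar>r\<bar> \<le> \<rho>"
proof -
  have causal: "\<And>g v. g \<in> \<Gamma> \<Longrightarrow> g v - v \<in> C \<Longrightarrow> g = id" using sc strictly_causal_iff by blast
  obtain W where W: "open W" "v \<in> W" "W \<inter> closure (orbit_future v) \<subseteq> orbit_future v"
      "W \<inter> closure (orbit_past v) \<subseteq> orbit_past v" using sc strictly_causal_iff by meson
  obtain \<epsilon> where \<epsilon>: "\<epsilon> > 0" "ball v \<epsilon> \<subseteq> W" using W openE by blast
  \<comment> \<open>The points \<open>v - \<eta> c\<close> and \<open>v + \<eta> c\<close> stay
    inside \<open>W\<close>, and \<open>\<eta> \<le> \<rho>\<close> leaves a nonnegative multiple of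
    \<open>c\<close> between them and whatever has escaped further than
    \<open>\<rho>\<close>.\<close>
  define \<eta> where "\<eta> = min \<rho> (\<epsilon> / (2 * norm c))"
  have \<eta>: "\<eta> > 0" "\<eta> \<le> \<rho>" "norm (\<eta> *\<^sub>R c) < \<epsilon>"
  proof -
    show "\<eta> > 0" "\<eta> \<le> \<rho>" using \<epsilon> c \<open>\<rho> > 0\<close> by (auto simp: \<eta>_def)
    have "\<eta> * norm c \<le> \<epsilon> / (2 * norm c) * norm c" unfolding \<eta>_def by (rule mult_right_mono) auto
    then show "norm (\<eta> *\<^sub>R c) < \<epsilon>" using \<epsilon> c \<open>\<eta> > 0\<close> by simp
  qed
  obtain e0 where e0: "e0 \<in> C" "l e0 e0 = 1" using timelike_in_cone by blast
  \<comment> \<open>A ball inside the cone around an arbitrarily short \<open>w\<close>: adding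
    \<open>w\<close> absorbs the error \<open>e\<close>.\<close>
  have shrink: "\<exists>w \<delta>. \<delta> > 0 \<and> ball w \<delta> \<subseteq> C \<and> norm w < \<kappa>" if "\<kappa> > 0" for \<kappa>
  proof -
    define \<mu> where "\<mu> = \<kappa> / (2 * norm e0)"
    have "e0 \<noteq> 0" using e0 by (auto simp: form_linear)
    then have "\<mu> > 0" "norm (\<mu> *\<^sub>R e0) < \<kappa>" using that by (simp_all add: \<mu>_def)
    moreover from this have "\<mu> *\<^sub>R e0 \<in> interior C"
      using e0 by (simp add: interior_cone cone_scale form_linear)
    ultimately show ?thesis unfolding mem_interior by blast
  qed
  have small: "\<exists>\<delta>>0. \<forall>g e r. g \<in> \<Gamma> \<longrightarrow> g v = v + e + r *\<^sub>R c \<longrightarrow> norm e < \<delta> \<longrightarrow> - \<rho> \<le> r"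
  proof (rule ccontr)
    assume neg: "\<not> ?thesis"
    have "v - \<eta> *\<^sub>R c \<in> closure (orbit_future v)"
      unfolding closure_approachable
    proof (intro allI impI)
      fix \<kappa> :: real assume "\<kappa> > 0"
      obtain w \<delta> where \<delta>: "\<delta> > 0" "ball w \<delta> \<subseteq> C" "norm w < \<kappa>"
        using shrink[OF \<open>\<kappa> > 0\<close>] by blast
      obtain g e r where g: "g \<in> \<Gamma>" "g v = v + e + r *\<^sub>R c" "norm e < \<delta>" "r < - \<rho>"
        using neg \<delta>(1) by (meson not_le)
      have "w - e \<in> C" using \<delta> g by (auto simp: dist_norm subset_eq)
      moreover have "(- \<eta> - r) *\<^sub>R c \<in> C" using \<eta> g c by (intro cone_scale) auto
      ultimately have "(w - e) + (- \<eta> - r) *\<^sub>R c \<in> C" by (rule cone_add)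
      then have "v - \<eta> *\<^sub>R c + w - g v \<in> C" using g(2) by (simp add: algebra_simps)
      then have "v - \<eta> *\<^sub>R c + w \<in> orbit_future v" using g(1) by (auto simp: orbit_future_def)
      moreover have "dist (v - \<eta> *\<^sub>R c + w) (v - \<eta> *\<^sub>R c) < \<kappa>"
        using \<delta>(3) by (simp add: dist_norm)
      ultimately show "\<exists>y\<in>orbit_future v. dist y (v - \<eta> *\<^sub>R c) < \<kappa>" by blast
    qed
    moreover have "v - \<eta> *\<^sub>R c \<in> W" using \<epsilon> \<eta> by (auto simp: dist_norm subset_eq)
    \<comment> \<open>Since \<open>v - \<eta> c\<close> precedes \<open>v\<close>, some
      \<open>g v\<close> would causally precede \<open>v\<close>; causality leaves
      \<open>g = id\<close>, and then \<open>- \<eta> c\<close> would be in the cone.\<close>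
    ultimately have "v - \<eta> *\<^sub>R c \<in> orbit_future v" using W by blast
    then obtain g where g: "g \<in> \<Gamma>" "v - \<eta> *\<^sub>R c - g v \<in> C" by (auto simp: orbit_future_def)
    have "v - g v \<in> C" using cone_add[OF g(2) cone_scale[OF c(1), of \<eta>]] \<eta> by simp
    then have "inv g (g v) - g v \<in> C" using g by (simp add: inv_apply)
    then have "inv g = id" using causal g inv_mem by blast
    then have "g v = v" using inv_apply(2)[OF g(1), of v] inv_apply(1)[OF g(1), of v] by simp
    then have "- (\<eta> *\<^sub>R c) \<in> C" using g by simp
    then have "\<eta> *\<^sub>R c = 0" using cone_pointed[OF cone_scale[OF c(1), of \<eta>]] \<eta>(1) by simp
    then show False using c \<eta> by simp
  qed
  have large: "\<exists>\<delta>>0. \<forall>g e r. g \<in> \<Gamma> \<longrightarrow> g v = v + e + r *\<^sub>R c \<longrightarrow> norm e < \<delta> \<longrightarrow> r \<le> \<rho>"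
  proof (rule ccontr)
    assume neg: "\<not> ?thesis"
    have "v + \<eta> *\<^sub>R c \<in> closure (orbit_past v)"
      unfolding closure_approachable
    proof (intro allI impI)
      fix \<kappa> :: real assume "\<kappa> > 0"
      obtain w \<delta> where \<delta>: "\<delta> > 0" "ball w \<delta> \<subseteq> C" "norm w < \<kappa>"
        using shrink[OF \<open>\<kappa> > 0\<close>] by blast
      obtain g e r where g: "g \<in> \<Gamma>" "g v = v + e + r *\<^sub>R c" "norm e < \<delta>" "r > \<rho>"
        using neg \<delta>(1) by (meson not_le)
      have "w + e \<in> C" using \<delta> g by (auto simp: dist_norm subset_eq)
      moreover have "(r - \<eta>) *\<^sub>R c \<in> C" using \<eta> g c by (intro cone_scale) auto
      ultimately have "(w + e) + (r - \<eta>) *\<^sub>R c \<in> C" by (rule cone_add)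
      then have "g v - (v + \<eta> *\<^sub>R c - w) \<in> C" using g(2) by (simp add: algebra_simps)
      then have "v + \<eta> *\<^sub>R c - w \<in> orbit_past v" using g(1) by (auto simp: orbit_past_def)
      moreover have "dist (v + \<eta> *\<^sub>R c - w) (v + \<eta> *\<^sub>R c) < \<kappa>"
        using \<delta>(3) by (simp add: dist_norm)
      ultimately show "\<exists>y\<in>orbit_past v. dist y (v + \<eta> *\<^sub>R c) < \<kappa>" by blast
    qed
    moreover have "v + \<eta> *\<^sub>R c \<in> W" using \<epsilon> \<eta> by (auto simp: dist_norm subset_eq)
    ultimately have "v + \<eta> *\<^sub>R c \<in> orbit_past v" using W by blast
    then obtain g where g: "g \<in> \<Gamma>" "g v - (v + \<eta> *\<^sub>R c) \<in> C" by (auto simp: orbit_past_def)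
    have "g v - v \<in> C" using cone_add[OF g(2) cone_scale[OF c(1), of \<eta>]] \<eta> by simp
    then have "g = id" using causal g by blast
    then have "- (\<eta> *\<^sub>R c) \<in> C" using g by simp
    then have "\<eta> *\<^sub>R c = 0" using cone_pointed[OF cone_scale[OF c(1), of \<eta>]] \<eta>(1) by simp
    then show False using c \<eta> by simp
  qed
  obtain \<delta>1 where 1: "\<delta>1 > 0" "\<And>g e r. g \<in> \<Gamma> \<Longrightarrow> g v = v + e + r *\<^sub>R c \<Longrightarrow> norm e < \<delta>1 \<Longrightarrow> - \<rho> \<le> r"
    using small by blast
  obtain \<delta>2 where 2: "\<delta>2 > 0" "\<And>g e r. g \<in> \<Gamma> \<Longrightarrow> g v = v + e + r *\<^sub>R c \<Longrightarrow> norm e < \<delta>2 \<Longrightarrow> r \<le> \<rho>"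
    using large by blast
  have "\<bar>r\<bar> \<le> \<rho>" if "g \<in> \<Gamma>" "g v = v + e + r *\<^sub>R c" "norm e < min \<delta>1 \<delta>2" for g e r
    using 1(2)[OF that(1,2)] 2(2)[OF that(1,2)] that(3) by simp
  then show ?thesis using that 1 2 by (metis min_less_iff_conj)
qed

end

section \<open>Discrete subgroups\<close>

definition additive_subgroup :: "'a::real_vector set \<Rightarrow> bool" where
  "additive_subgroup \<Lambda> \<longleftrightarrow> 0 \<in> \<Lambda> \<and> (\<forall>x\<in>\<Lambda>. \<forall>y\<in>\<Lambda>. x - y \<in> \<Lambda>)"

lemma additive_subgroup_closed:
  assumes "additive_subgroup \<Lambda>"
  shows additive_subgroup_zero: "0 \<in> \<Lambda>"
    and additive_subgroup_diff: "x \<in> \<Lambda> \<Longrightarrow> y \<in> \<Lambda> \<Longrightarrow> x - y \<in> \<Lambda>"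
    and additive_subgroup_minus: "x \<in> \<Lambda> \<Longrightarrow> - x \<in> \<Lambda>"
    and additive_subgroup_add: "x \<in> \<Lambda> \<Longrightarrow> y \<in> \<Lambda> \<Longrightarrow> x + y \<in> \<Lambda>"
proof -
  show z: "0 \<in> \<Lambda>" and d: "\<And>x y. x \<in> \<Lambda> \<Longrightarrow> y \<in> \<Lambda> \<Longrightarrow> x - y \<in> \<Lambda>"
    using assms by (auto simp: additive_subgroup_def)
  show m: "\<And>x. x \<in> \<Lambda> \<Longrightarrow> - x \<in> \<Lambda>" using d[OF z] by simp
  show "x \<in> \<Lambda> \<Longrightarrow> y \<in> \<Lambda> \<Longrightarrow> x + y \<in> \<Lambda>" using d[OF _ m, of x y] by simp
qed

lemma additive_subgroup_of_int:
  assumes "additive_subgroup \<Lambda>" "x \<in> \<Lambda>"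
  shows "of_int k *\<^sub>R x \<in> \<Lambda>"
proof -
  have nat: "real n *\<^sub>R x \<in> \<Lambda>" for n
  proof (induction n)
    case (Suc n)
    then show ?case
      using additive_subgroup_add[OF assms(1) Suc assms(2)] by (simp add: algebra_simps)
  qed (use additive_subgroup_zero[OF assms(1)] in simp)
  show ?thesis
    using nat[of "nat k"] additive_subgroup_minus[OF assms(1) nat[of "nat (- k)"]]
    by (cases "k \<ge> 0") auto
qed

lemma additive_subgroup_sum:
  assumes "additive_subgroup \<Lambda>" "\<And>i. i \<in> I \<Longrightarrow> f i \<in> \<Lambda>"
  shows "sum f I \<in> \<Lambda>"
  using assms(2)
proof (induction I rule: infinite_finite_induct)
  case (insert i I)
  then show ?case using additive_subgroup_add[OF assms(1)] by simp
qed (use additive_subgroup_zero[OF assms(1)] in simp_all)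

text \<open>Recurrence on a torus: the fractional parts of the coordinates of \<open>k x\<close>
  give a bounded sequence, so two terms of a convergent subsequence nearly agree, and the difference
  of their indices is the required multiple.\<close>

lemma real_multiple_approx:
  fixes x :: "'a::euclidean_space"
  assumes "additive_subgroup \<Lambda>" "x \<in> span \<Lambda>" "\<epsilon> > 0"
  obtains k y where "k \<ge> K" "y \<in> \<Lambda>" "norm (real k *\<^sub>R x - y) < \<epsilon>"
proof -
  obtain B u where B: "finite B" "B \<subseteq> \<Lambda>" "x = (\<Sum>b\<in>B. u b *\<^sub>R b)"
    using assms(2) unfolding span_explicit by auto
  define f where "f k = (\<Sum>b\<in>B. frac (real k * u b) *\<^sub>R b)" for k :: nat
  define y where "y k = (\<Sum>b\<in>B. of_int \<lfloor>real k * u b\<rfloor> *\<^sub>R b)" for k :: nat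
  have y: "y k \<in> \<Lambda>" for k
    unfolding y_def using B(2)
    by (intro additive_subgroup_sum additive_subgroup_of_int assms(1)) auto
  have f: "f k = real k *\<^sub>R x - y k" for k
    by (simp add: f_def y_def B(3) frac_def scaleR_sum_right sum_subtractf algebra_simps)
  have "norm (f k) \<le> (\<Sum>b\<in>B. norm b)" for k
    unfolding f_def
  proof (rule sum_norm_le)
    fix b
    have "\<bar>frac (real k * u b)\<bar> * norm b \<le> 1 * norm b"
      using frac_ge_0[of "real k * u b"] frac_lt_1[of "real k * u b"] by (intro mult_right_mono) auto
    then show "norm (frac (real k * u b) *\<^sub>R b) \<le> norm b" by simp
  qed
  then have "bounded (range f)" by (auto simp: bounded_iff)
  then obtain r L where r: "strict_mono (r :: nat \<Rightarrow> nat)" "(f \<circ> r) \<longlonglongrightarrow> L"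
    using bounded_imp_convergent_subsequence by blast
  then have "Cauchy (f \<circ> r)" using LIMSEQ_imp_Cauchy by blast
  then obtain n where n: "\<And>i j. i \<ge> n \<Longrightarrow> j \<ge> n \<Longrightarrow> norm (f (r i) - f (r j)) < \<epsilon>"
    using assms(3) unfolding Cauchy_iff by (metis comp_apply)
  \<comment> \<open>Going \<open>K\<close> terms further in a strictly increasing index sequence
    makes the multiple at least \<open>K\<close>.\<close>
  have grow: "r (n + i) \<ge> r n + i" for i
  proof (induction i)
    case (Suc i)
    have "r (n + i) < r (n + Suc i)" using r(1) by (simp add: strict_mono_Suc_iff)
    then show ?case using Suc by simp
  qed simp
  define k where "k = r (n + K) - r n"
  have "k \<ge> K" using grow[of K] by (simp add: k_def)
  moreover have "y (r (n + K)) - y (r n) \<in> \<Lambda>" using y assms(1) by (intro additive_subgroup_diff)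
  moreover have "real k *\<^sub>R x - (y (r (n + K)) - y (r n)) = f (r (n + K)) - f (r n)"
    using grow[of K] by (simp add: f k_def of_nat_diff algebra_simps)
  then have "norm (real k *\<^sub>R x - (y (r (n + K)) - y (r n))) < \<epsilon>" using n by simp
  ultimately show ?thesis using that by blast
qed

definition separated :: "'a::real_normed_vector set \<Rightarrow> bool" where
  "separated \<Lambda> \<longleftrightarrow> (\<exists>\<epsilon>>0. \<forall>x\<in>\<Lambda>. norm x < \<epsilon> \<longrightarrow> x = 0)"

lemma discrete_iff_separated:
  fixes \<Lambda> :: "'a::euclidean_space set"
  assumes "additive_subgroup \<Lambda>"
  shows "discrete \<Lambda> \<longleftrightarrow> separated \<Lambda>" "separated \<Lambda> \<longleftrightarrow> uniform_discrete \<Lambda>"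
proof -
  have z: "0 \<in> \<Lambda>" using assms by (rule additive_subgroup_zero)
  have 1: "separated \<Lambda>" if d: "discrete \<Lambda>"
  proof -
    obtain e where "e > 0" "\<forall>y\<in>\<Lambda>. dist 0 y < e \<longrightarrow> y = 0"
      using discreteD[OF d z] unfolding isolated_in_dist_Ex_iff by (metis dist_commute)
    then show ?thesis unfolding separated_def by auto
  qed
  have 2: "uniform_discrete \<Lambda>" if s: "separated \<Lambda>"
  proof -
    obtain e where e: "e > 0" "\<And>x. x \<in> \<Lambda> \<Longrightarrow> norm x < e \<Longrightarrow> x = 0"
      using s unfolding separated_def by auto
    have "x = y" if "x \<in> \<Lambda>" "y \<in> \<Lambda>" "dist x y < e" for x y
      using e(2)[OF additive_subgroup_diff[OF assms that(1,2)]] that(3) by (simp add: dist_norm)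
    then show ?thesis unfolding uniform_discrete_def using e(1) by auto
  qed
  show "discrete \<Lambda> \<longleftrightarrow> separated \<Lambda>" "separated \<Lambda> \<longleftrightarrow> uniform_discrete \<Lambda>"
    using 1 2 uniform_discrete_imp_discrete by auto
qed

lemma finite_discrete_bounded:
  fixes \<Lambda> :: "'a::euclidean_space set"
  assumes "additive_subgroup \<Lambda>" "discrete \<Lambda>"
  shows "finite {x\<in>\<Lambda>. norm x \<le> R}"
proof -
  have "uniform_discrete {x\<in>\<Lambda>. norm x \<le> R}"
    by (rule uniform_discrete_subset[of \<Lambda>]) (use assms discrete_iff_separated in auto)
  moreover have "bounded {x\<in>\<Lambda>. norm x \<le> R}" by (auto simp: bounded_iff)
  ultimately show ?thesis using uniform_discrete_finite_iff by auto
qed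

text \<open>Some positive multiple of \<open>x \<in> \<Lambda>\<close> lies within \<open>\<epsilon>\<close> of, hence in, the subgroup of \<open>\<Lambda>\<close> where
  the linear extension agrees with \<open>h\<close>.\<close>

lemma additive_extends_linear:
  fixes h :: "'a::euclidean_space \<Rightarrow> 'b::real_vector"
  assumes \<Lambda>: "additive_subgroup \<Lambda>" "separated \<Lambda>"
    and h: "\<And>x y. x \<in> \<Lambda> \<Longrightarrow> y \<in> \<Lambda> \<Longrightarrow> h (x + y) = h x + h y"
  obtains F where "linear F" "\<And>x. x \<in> \<Lambda> \<Longrightarrow> F x = h x"
proof -
  obtain B where B: "B \<subseteq> \<Lambda>" "independent B" "\<Lambda> \<subseteq> span B"
    using maximal_independent_subset[of \<Lambda>] by auto
  obtain F where F: "linear F" "\<And>x. x \<in> B \<Longrightarrow> F x = h x"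
    using linear_independent_extend[OF B(2), of h] by auto
  have F_add: "F (x + y) = F x + F y" for x y using F(1) by (rule linear_add)
  have h0: "h 0 = 0" using h[of 0 0] additive_subgroup_zero[OF \<Lambda>(1)] by simp
  have h_diff: "h (x - y) = h x - h y" if "x \<in> \<Lambda>" "y \<in> \<Lambda>" for x y
    using h[OF additive_subgroup_diff[OF \<Lambda>(1) that] that(2)] by simp
  define \<Lambda>' where "\<Lambda>' = {x \<in> \<Lambda>. F x = h x}"
  have sub: "additive_subgroup \<Lambda>'"
    unfolding additive_subgroup_def \<Lambda>'_def
    using \<Lambda>(1) h_diff h0 linear_0[OF F(1)] linear_diff[OF F(1)]
    by (auto simp: additive_subgroup_zero additive_subgroup_diff)
  have "B \<subseteq> \<Lambda>'" using B F by (auto simp: \<Lambda>'_def)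
  then have span: "\<Lambda> \<subseteq> span \<Lambda>'" using B(3) span_mono by blast
  obtain \<epsilon> where \<epsilon>: "\<epsilon> > 0" "\<And>x. x \<in> \<Lambda> \<Longrightarrow> norm x < \<epsilon> \<Longrightarrow> x = 0"
    using \<Lambda>(2) by (auto simp: separated_def)
  have "F x = h x" if x: "x \<in> \<Lambda>" for x
  proof -
    obtain k y where k: "k \<ge> (1::nat)" "y \<in> \<Lambda>'" "norm (real k *\<^sub>R x - y) < \<epsilon>"
      using real_multiple_approx[OF sub _ \<epsilon>(1), of x 1] span x by blast
    have nx: "real n *\<^sub>R x \<in> \<Lambda>" for n using additive_subgroup_of_int[OF \<Lambda>(1) x, of "int n"] by simp
    have hn: "h (real n *\<^sub>R x) = real n *\<^sub>R h x" for n
    proof (induction n)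
      case (Suc n)
      have "h (real (Suc n) *\<^sub>R x) = h (real n *\<^sub>R x + x)" by (simp add: algebra_simps)
      also have "\<dots> = h (real n *\<^sub>R x) + h x" using h[OF nx x] .
      finally show ?case using Suc by (simp add: algebra_simps)
    qed (simp add: h0)
    have "y \<in> \<Lambda>" using k(2) by (simp add: \<Lambda>'_def)
    then have "real k *\<^sub>R x - y \<in> \<Lambda>" using additive_subgroup_diff[OF \<Lambda>(1) nx] by blast
    then have "real k *\<^sub>R x = y" using \<epsilon>(2) k(3) by force
    then have "F (real k *\<^sub>R x) = h (real k *\<^sub>R x)" using k(2) by (simp add: \<Lambda>'_def)
    then have "real k *\<^sub>R F x = real k *\<^sub>R h x" by (simp only: hn linear_scale[OF F(1)])
    then show ?thesis using k(1) by simp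
  qed
  then show ?thesis using that F(1) by blast
qed

lemma orbit_translation: "orbit (translation_group \<Lambda>) v = (\<lambda>x. x + v) ` \<Lambda>"
  by (auto simp: orbit_def translation_group_def)

lemma orbit_translation_eq_iff:
  assumes "additive_subgroup \<Lambda>"
  shows "orbit (translation_group \<Lambda>) v = orbit (translation_group \<Lambda>) w \<longleftrightarrow> v - w \<in> \<Lambda>"
proof
  assume eq: "orbit (translation_group \<Lambda>) v = orbit (translation_group \<Lambda>) w"
  have "v \<in> (\<lambda>x. x + v) ` \<Lambda>" using additive_subgroup_zero[OF assms] by force
  then have "v \<in> (\<lambda>x. x + w) ` \<Lambda>" using eq by (simp add: orbit_translation)
  then show "v - w \<in> \<Lambda>" by auto
next
  assume vw: "v - w \<in> \<Lambda>"
  have "x + v \<in> (\<lambda>x. x + w) ` \<Lambda>" if "x \<in> \<Lambda>" for x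
    using additive_subgroup_add[OF assms that vw] by (intro image_eqI[of _ _ "x + (v - w)"]) auto
  moreover have "x + w \<in> (\<lambda>x. x + v) ` \<Lambda>" if "x \<in> \<Lambda>" for x
    using additive_subgroup_diff[OF assms that vw] by (intro image_eqI[of _ _ "x - (v - w)"]) auto
  ultimately show "orbit (translation_group \<Lambda>) v = orbit (translation_group \<Lambda>) w"
    unfolding orbit_translation by blast
qed

text \<open>Modulo the lattice every point of the span lies in the parallelepiped of a basis chosen
  inside \<open>\<Lambda>\<close>, which fits into a ball with radius the sum of the norms; so the
  quotient is the image of a compact set.\<close>

lemma uniform_lattice_span:
  fixes \<Lambda> :: "'a::euclidean_space set"
  assumes \<Lambda>: "additive_subgroup \<Lambda>" "discrete \<Lambda>"
  shows "uniform_lattice (span \<Lambda>) \<Lambda>"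
proof -
  let ?T = "span \<Lambda>" and ?o = "orbit (translation_group \<Lambda>)"
  let ?Q = "orbit_space (top_of_set ?T) (translation_group \<Lambda>)"
  obtain B where B: "B \<subseteq> \<Lambda>" "independent B" "\<Lambda> \<subseteq> span B"
    using maximal_independent_subset[of \<Lambda>] by auto
  have fin: "finite B" using independent_imp_finite[OF B(2)] by simp
  define K where "K = ?T \<inter> cball 0 (\<Sum>b\<in>B. norm b)"
  have "compact K" unfolding K_def by (simp add: closed_Int_compact closed_span)
  then have "compactin (top_of_set ?T) K" by (simp add: compactin_subtopology K_def)
  then have comp: "compactin ?Q (?o ` K)"
    using image_compactin quotient_imp_continuous_map[OF quotient_map_orbit_space] by blast
  have "?o x \<in> ?o ` K" if x: "x \<in> ?T" for x
  proof -
    have "x \<in> span B" using x B span_minimal[OF B(3)] by auto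
    then obtain u where u: "x = (\<Sum>b\<in>B. u b *\<^sub>R b)" using span_finite[OF fin] by auto
    define y where "y = (\<Sum>b\<in>B. of_int \<lfloor>u b\<rfloor> *\<^sub>R b)"
    have y: "y \<in> \<Lambda>"
      unfolding y_def using B(1) by (intro additive_subgroup_sum additive_subgroup_of_int \<Lambda>(1)) auto
    have eq: "x - y = (\<Sum>b\<in>B. frac (u b) *\<^sub>R b)"
      by (simp add: u y_def frac_def sum_subtractf algebra_simps)
    have "norm (x - y) \<le> (\<Sum>b\<in>B. norm b)"
      unfolding eq
    proof (rule sum_norm_le)
      fix b
      have "\<bar>frac (u b)\<bar> * norm b \<le> 1 * norm b"
        using frac_ge_0[of "u b"] frac_lt_1[of "u b"] by (intro mult_right_mono) auto
      then show "norm (frac (u b) *\<^sub>R b) \<le> norm b" by simp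
    qed
    moreover have "x - y \<in> ?T" using x y by (simp add: span_base span_diff)
    ultimately have "x - y \<in> K" by (simp add: K_def)
    moreover have "?o x = ?o (x - y)" using orbit_translation_eq_iff[OF \<Lambda>(1)] y by simp
    ultimately show ?thesis by blast
  qed
  then have "?o ` K = topspace ?Q" by (auto simp: topspace_orbit_space K_def)
  then have "compact_space ?Q" using comp by (simp add: compact_space_def)
  then show ?thesis
    using \<Lambda> unfolding uniform_lattice_def additive_subgroup_def by (auto simp: span_base)
qed

lemma uniform_lattice_subgroup:
  "uniform_lattice T \<Lambda> \<Longrightarrow> additive_subgroup \<Lambda>"
  by (simp add: uniform_lattice_def additive_subgroup_def)

section \<open>Unipotent isometries\<close>

context lorentz_cone
begin

lemma null_perp_nonpos:
  assumes "v0 \<in> C" "v0 \<noteq> 0" "l v0 v0 = 0" "l x v0 = 0"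
  shows "l x x \<le> 0"
proof (rule ccontr)
  assume pos: "\<not> ?thesis"
  then obtain r where "x = r *\<^sub>R v0"
    using cone_orthogonal_collinear[of v0 x] assms form_commute[of x v0] by force
  then show False using pos assms by (simp add: form_linear)
qed

lemma null_pair_perp_negative:
  assumes "v0 \<in> C" "l v0 v0 = 0" "l v0 v1 = 1" "l x v0 = 0" "l x v1 = 0" "x \<noteq> 0"
  shows "l x x < 0"
proof (rule ccontr)
  assume "\<not> ?thesis"
  moreover have "v0 \<noteq> 0" using assms(3) by (auto simp: form_linear)
  ultimately obtain r where r: "x = r *\<^sub>R v0"
    using cone_orthogonal_collinear[of v0 x] assms form_commute[of x v0] by force
  then have "r = 0" using assms by (simp add: form_linear)
  then show False using r assms by simp
qed

text \<open>The form is negative definite orthogonally to the pair; the inequality is read off from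
  the square of \<open>l y y *\<^sub>R x - l x y *\<^sub>R y\<close>.\<close>

lemma null_pair_cauchy_schwarz:
  assumes "v0 \<in> C" "l v0 v0 = 0" "l v0 v1 = 1" "l x v0 = 0" "l x v1 = 0" "l y v0 = 0" "l y v1 = 0"
  shows "(l x y)\<^sup>2 \<le> l x x * l y y"
proof (cases "y = 0")
  case False
  have y: "l y y < 0" using null_pair_perp_negative[of v0 v1 y] assms False by simp
  have "l (l y y *\<^sub>R x - l x y *\<^sub>R y) (l y y *\<^sub>R x - l x y *\<^sub>R y) \<le> 0"
    using assms by (intro null_perp_nonpos[of v0]) (auto simp: form_linear)
  also have "l (l y y *\<^sub>R x - l x y *\<^sub>R y) (l y y *\<^sub>R x - l x y *\<^sub>R y)
      = - (l y y * ((l x y)\<^sup>2 - l x x * l y y))"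
    using form_commute[of y x] by (simp add: form_linear power2_eq_square algebra_simps)
  finally show ?thesis using y by (simp add: mult_le_0_iff zero_le_mult_iff)
qed (simp add: form_linear)

context
  fixes A :: "'a \<Rightarrow> 'a"
  assumes A: "linear A" "\<And>v w. l (A v) (A w) = l v w" "unipotent A"
begin

text \<open>The image of the displacement \<open>A - 1\<close> is orthogonal to its kernel, so its last nonzero power
  has isotropic values.\<close>

lemma unipotent_isometry_null_fixed:
  assumes "A v \<noteq> v"
  obtains v0 where "v0 \<in> C" "v0 \<noteq> 0" "l v0 v0 = 0" "A v0 = v0"
proof -
  let ?D = "\<lambda>u. A u - u"
  define m where "m = (LEAST k. \<forall>v. (?D ^^ k) v = 0)"
  have m: "\<And>v. (?D ^^ m) v = 0"
    using A(3) unfolding unipotent_def m_def by (rule LeastI2_ex) blast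
  have less: "\<exists>v. (?D ^^ k) v \<noteq> 0" if "k < m" for k
    using not_less_Least[of k "\<lambda>k. \<forall>v. (?D ^^ k) v = 0"] that by (simp add: m_def)
  have "m \<noteq> 0"
  proof
    assume "m = 0"
    then have "A v = 0" "v = 0" using m[of "A v"] m[of v] by auto
    then show False using assms by simp
  qed
  moreover have "m \<noteq> 1" using m[of v] assms by auto
  \<comment> \<open>Index at least 2 makes \<open>z\<close> below at once a fixed vector and a value
    of the displacement; these are orthogonal, so \<open>z\<close> is null.\<close>
  ultimately obtain j where j: "m = Suc (Suc j)" by (metis One_nat_def not0_implies_Suc)
  obtain w where w: "(?D ^^ Suc j) w \<noteq> 0" using less[of "Suc j"] j by auto
  define z where "z = (?D ^^ Suc j) w"
  have fixed: "A z = z" using m[of w] by (simp add: j z_def)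
  have z: "z = ?D ((?D ^^ j) w)" by (simp add: z_def)
  have "l z z = l z (A ((?D ^^ j) w)) - l z ((?D ^^ j) w)"
    by (subst (2) z) (simp only: form_linear)
  also have "\<dots> = 0" using A(2)[of z "(?D ^^ j) w"] fixed by simp
  finally have null: "l z z = 0" .
  show ?thesis
  proof (cases "z \<in> C")
    case True
    then show ?thesis using that[of z] w null fixed by (simp add: z_def)
  next
    case False
    then have "- z \<in> C" using cone_cases[of z] null by simp
    moreover have "A (- z) = - z" using fixed linear_neg[OF A(1)] by simp
    ultimately show ?thesis using that[of "- z"] w null by (simp add: z_def form_linear)
  qed
qed

text \<open>Modulo \<open>v0\<close> the form is definite on the hyperplane orthogonal to
  \<open>v0\<close>, and a unipotent isometry of a definite form is the identity.\<close>

lemma unipotent_isometry_perp: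
  assumes v0: "v0 \<in> C" "v0 \<noteq> 0" "l v0 v0 = 0" "A v0 = v0" and w: "l w v0 = 0"
  obtains r where "A w = w + r *\<^sub>R v0"
proof -
  let ?D = "\<lambda>u. A u - u"
  define W where "W = {w. l w v0 = 0}"
  define P where "P u \<longleftrightarrow> (\<exists>r. u = r *\<^sub>R v0)" for u
  define m where "m = (LEAST k. \<forall>v\<in>W. P ((?D ^^ k) v))"
  have "\<exists>k. \<forall>v\<in>W. P ((?D ^^ k) v)"
    using A(3) unfolding unipotent_def P_def by (metis scaleR_zero_left)
  then have m: "\<forall>v\<in>W. P ((?D ^^ m) v)" unfolding m_def by (rule LeastI_ex)
  have DW: "?D u \<in> W" if "u \<in> W" for u
    using that A(2)[of u v0] v0 by (simp add: W_def form_linear)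
  have DkW: "(?D ^^ k) u \<in> W" if "u \<in> W" for k u
    using DW that by (induction k) auto
  have "m \<le> 1"
  proof (rule ccontr)
    assume "\<not> m \<le> 1"
    \<comment> \<open>One step before the displacement falls into the line of \<open>v0\<close>:
      there \<open>x\<close> is a displacement that is fixed modulo \<open>v0\<close>, hence null,
      hence already on that line.\<close>
    then obtain i where i: "m = Suc (Suc i)" by (metis One_nat_def le_SucI not0_implies_Suc order_refl zero_le)
    then obtain u where u: "u \<in> W" "\<not> P ((?D ^^ Suc i) u)"
      using not_less_Least[of "Suc i" "\<lambda>k. \<forall>v\<in>W. P ((?D ^^ k) v)"] by (auto simp: m_def)
    define z where "z = (?D ^^ i) u"
    define x where "x = ?D z"
    have zW: "z \<in> W" and xW: "x \<in> W" using DkW[OF u(1)] DW by (simp_all add: z_def x_def)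
    have nx: "\<not> P x" using u(2) by (simp add: x_def z_def)
    obtain r where r: "?D x = r *\<^sub>R v0"
      using m u(1) unfolding P_def i x_def z_def by auto
    have Ax: "A x = x + r *\<^sub>R v0" using r by (simp add: algebra_simps)
    have "l z v0 = 0" "l x v0 = 0" "l (A z) v0 = 0"
      using zW xW A(2)[of z v0] v0 by (simp_all add: W_def)
    then have "l z x = l (A z) x" using A(2)[of z x] by (simp add: Ax form_linear)
    then have "l x x = 0" unfolding x_def by (simp add: form_linear)
    then obtain q where "x = q *\<^sub>R v0"
      using cone_orthogonal_collinear[of v0 x] v0 xW form_commute[of x v0] by (force simp: W_def)
    then show False using nx by (auto simp: P_def)
  qed
  have wW: "w \<in> W" using w by (simp add: W_def)
  have "P (?D w)"
  proof (cases "m = 0")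
    case True
    then show ?thesis using m DW[OF wW] by simp
  next
    case False
    then have "m = 1" using \<open>m \<le> 1\<close> by simp
    then show ?thesis using m wW by simp
  qed
  then obtain r where "?D w = r *\<^sub>R v0" by (auto simp: P_def)
  then have "A w = w + r *\<^sub>R v0" by (simp add: algebra_simps)
  then show ?thesis using that by blast
qed

text \<open>Being trivial modulo \<open>v0\<close> on the hyperplane orthogonal to it,
  \<open>A\<close> is determined by \<open>A v1\<close>. The component \<open>y\<close> of
  \<open>A v1\<close> is free; invariance of \<open>l v1 v1\<close> and of \<open>l w v1\<close>
  forces the coefficients of \<open>v0\<close>.\<close>

lemma unipotent_isometry_nu:
  assumes v0: "v0 \<in> C" "l v0 v0 = 0" "A v0 = v0" and v1: "l v0 v1 = 1" "l v1 v1 = 0"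
  obtains y where "l y v0 = 0" "l y v1 = 0" "A = nu l v0 y"
proof -
  have "v0 \<noteq> 0" using v1 by (auto simp: form_linear)
  have v10: "l v1 v0 = 1" using v1 form_commute[of v1 v0] by simp
  define s where "s = l (A v1) v1"
  define y where "y = A v1 - v1 - s *\<^sub>R v0"
  have y0: "l y v0 = 0" using A(2)[of v1 v0] v0 v10 by (simp add: y_def form_linear)
  have y1: "l y v1 = 0" using v1 by (simp add: y_def form_linear s_def)
  have Av1: "A v1 = v1 + y + s *\<^sub>R v0" by (simp add: y_def)
  have y0': "l v0 y = 0" and y1': "l v1 y = 0" using y0 y1 form_commute[of y] by simp_all
  have "l (A v1) (A v1) = 0" using A(2) v1 by simp
  then have s: "s = - (1/2 * l y y)"
    unfolding Av1 using y0 y1 y0' y1' v0 v1 v10 by (simp add: form_linear)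
  have "A v = nu l v0 y v" for v
  proof -
    define t where "t = l v v0"
    define w where "w = v - t *\<^sub>R v1"
    have w0: "l w v0 = 0" using v10 by (simp add: w_def form_linear t_def)
    obtain r where r: "A w = w + r *\<^sub>R v0"
      using unipotent_isometry_perp[OF v0(1) \<open>v0 \<noteq> 0\<close> v0(2,3) w0] by blast
    have "l (A w) (A v1) = l w v1" by (rule A(2))
    then have "r = - l w y"
      unfolding r Av1 using w0 v0 v1 y0' by (simp add: form_linear)
    then have "r = - l v y" using y1' by (simp add: w_def form_linear)
    have "v = w + t *\<^sub>R v1" by (simp add: w_def)
    then have "A v = A w + t *\<^sub>R A v1" using linear_add[OF A(1)] linear_scale[OF A(1)] by simp
    also have "\<dots> = nu l v0 y v"
      unfolding r Av1 \<open>r = - l v y\<close> s by (simp add: nu_def w_def t_def algebra_simps)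
    finally show ?thesis .
  qed
  then show ?thesis using that y0 y1 by blast
qed

end

lemma nu_pow:
  assumes "l v0 v0 = 0" "l y v0 = 0"
  shows "(nu l v0 y ^^ j) v = nu l v0 (real j *\<^sub>R y) v"
proof (induction j)
  case (Suc j)
  then show ?case
    using nu_add[OF assms(1), of "real j *\<^sub>R y" y v] assms by (simp add: form_linear algebra_simps)
qed simp

text \<open>If the fixed lines of \<open>A\<close> and \<open>B\<close> differed, a null vector fixed by \<open>A\<^sup>j B\<close> would bound
  \<open>j\<close> by Cauchy-Schwarz.\<close>

lemma unipotent_isometries_common_null:
  assumes A: "linear A" "\<And>v w. l (A v) (A w) = l v w" "unipotent A"
    and B: "linear B" "\<And>v w. l (B v) (B w) = l v w" "unipotent B"
    and AB: "\<And>j. unipotent ((A ^^ j) \<circ> B)"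
    and v0: "v0 \<in> C" "v0 \<noteq> 0" "l v0 v0 = 0" "A v0 = v0"
    and u0: "u0 \<in> C" "u0 \<noteq> 0" "l u0 u0 = 0" "B u0 = u0"
    and nontrivial: "A \<noteq> id" "B \<noteq> id"
  obtains r where "u0 = r *\<^sub>R v0"
proof (cases "l v0 u0 = 0")
  case True
  then show ?thesis using cone_orthogonal_collinear[of v0 u0] v0 u0 that by (metis order_refl)
next
  case False
  define v1 where "v1 = (1 / l v0 u0) *\<^sub>R u0"
  have pos: "l v0 u0 > 0" using cone_form_cone[OF v0(1) u0(1)] False by simp
  have v1: "v1 \<in> C" "l v1 v1 = 0" "B v1 = v1" "l v0 v1 = 1"
    using u0 pos linear_scale[OF B(1)] by (simp_all add: v1_def form_linear cone_scale)
  have v10: "l v1 v0 = 1" using v1 form_commute[of v1 v0] by simp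
  obtain y where y: "l y v0 = 0" "l y v1 = 0" "A = nu l v0 y"
    using unipotent_isometry_nu[OF A v0(1,3,4) v1(4,2)] by blast
  obtain y' where y': "l y' v1 = 0" "l y' v0 = 0" "B = nu l v1 y'"
    using unipotent_isometry_nu[OF B v1(1,2,3) v10 v0(3)] by blast
  have "y \<noteq> 0" "y' \<noteq> 0" using nontrivial y(3) y'(3) by (auto simp: fun_eq_iff)
  then have neg: "l y y < 0" "l y' y' < 0"
    using null_pair_perp_negative[OF v0(1,3) v1(4)] y y' by auto
  \<comment> \<open>The estimates \<open>d1\<close> and \<open>d2\<close> below carry a factor 8
    each; their product would bound \<open>j\<close> times the product of the squares by 64.\<close>
  obtain j :: nat where j: "real j * (l y y * l y' y') > 64"
    using neg ex_less_of_nat_mult[of "l y y * l y' y'" 64] by (auto simp: mult_neg_neg)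
  have "j > 0" using j by (cases j) auto
  define G where "G = (A ^^ j) \<circ> B"
  have Aj: "linear (A ^^ j)" "l ((A ^^ j) v) ((A ^^ j) w) = l v w" for v w
  proof -
    have "(A ^^ j) = nu l v0 (real j *\<^sub>R y)" using nu_pow[OF v0(3) y(1)] y(3) by auto
    then show "linear (A ^^ j)" "l ((A ^^ j) v) ((A ^^ j) w) = l v w"
      using linear_nu nu_isometry[OF v0(3), of "real j *\<^sub>R y"] y(1) by (simp_all add: form_linear)
  qed
  have G: "linear G" "\<And>v w. l (G v) (G w) = l v w" "unipotent G"
    using Aj B AB by (auto simp: G_def intro: linear_compose)
  obtain z where z: "z \<in> C" "z \<noteq> 0" "l z z = 0" "G z = z"
  proof (cases "G v0 = v0")
    case True
    then show ?thesis using that[of v0] v0 by simp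
  next
    case False
    then show ?thesis using unipotent_isometry_null_fixed[OF G False] that by blast
  qed
  define \<alpha> \<beta> where "\<alpha> = l z v0" and "\<beta> = l z v1"
  have nn: "\<alpha> \<ge> 0" "\<beta> \<ge> 0" using cone_form_cone z v0 v1 by (auto simp: \<alpha>_def \<beta>_def)
  have "nu l v0 (- real j *\<^sub>R y) (nu l v0 (real j *\<^sub>R y) (B z)) = B z"
    using nu_add[OF v0(3), of "real j *\<^sub>R y" "- real j *\<^sub>R y" "B z"] y(1) by (simp add: form_linear)
  moreover have "nu l v0 (real j *\<^sub>R y) (B z) = z"
    using z(4) nu_pow[OF v0(3) y(1), of j "B z"] y(3) by (simp add: G_def)
  \<comment> \<open>The fixed point equation is rewritten with \<open>B\<close> on one side and the
    inverse of \<open>A ^^ j\<close> on the other; pairing with \<open>v0\<close> isolates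
    \<open>l z y'\<close>, pairing with \<open>v1\<close> isolates \<open>l z y\<close>.\<close>
  ultimately have eq: "nu l v1 y' z = nu l v0 (- real j *\<^sub>R y) z" using y'(3) by simp
  have "l (nu l v1 y' z) v0 = l (nu l v0 (- real j *\<^sub>R y) z) v0" using eq by simp
  then have zy': "l z y' = - (1/2 * \<beta> * l y' y')"
    using y y' v10 v0 by (simp add: nu_def form_linear \<beta>_def)
  have "l (nu l v1 y' z) v1 = l (nu l v0 (- real j *\<^sub>R y) z) v1" using eq by simp
  then have "real j * l z y = real j * (1/2 * real j * \<alpha> * l y y)"
    using y y' v1 by (simp add: nu_def form_linear mult_ac flip: \<alpha>_def)
  then have zy: "l z y = 1/2 * real j * \<alpha> * l y y" using \<open>j > 0\<close> by simp
  \<comment> \<open>The part of \<open>z\<close> orthogonal to both null vectors. As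
    \<open>z\<close> is null, its square is determined by \<open>\<alpha>\<close> and
    \<open>\<beta>\<close>, and Cauchy-Schwarz against \<open>y\<close> and \<open>y'\<close>
    relates these two.\<close>
  define w where "w = z - \<alpha> *\<^sub>R v1 - \<beta> *\<^sub>R v0"
  have w: "l w v0 = 0" "l w v1 = 0"
    using v10 v1 v0 by (simp_all add: w_def form_linear \<alpha>_def \<beta>_def)
  have ww: "l w w = - (2 * \<alpha> * \<beta>)"
    using v10 v1 v0 z form_commute[of v0 z] form_commute[of v1 z]
    by (simp add: w_def form_linear flip: \<alpha>_def \<beta>_def)
  have wy: "l w y = l z y" "l w y' = l z y'"
    using y y' form_commute[of v0] form_commute[of v1] by (simp_all add: w_def form_linear)
  have cs: "(l w y)\<^sup>2 \<le> l w w * l y y" "(l w y')\<^sup>2 \<le> l w w * l y' y'"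
    using null_pair_cauchy_schwarz[OF v0(1,3) v1(4) w] y y' by auto
  define a b where "a = - l y y" and "b = - l y' y'"
  have ab: "a > 0" "b > 0" using neg by (auto simp: a_def b_def)
  have "a * (real j ^ 2 * \<alpha>\<^sup>2 * a) \<le> a * (8 * \<alpha> * \<beta>)"
    using cs(1) unfolding wy zy ww by (simp add: a_def power2_eq_square algebra_simps)
  then have c1: "real j ^ 2 * \<alpha>\<^sup>2 * a \<le> 8 * \<alpha> * \<beta>" using ab by simp
  have "b * (\<beta>\<^sup>2 * b) \<le> b * (8 * \<alpha> * \<beta>)"
    using cs(2) unfolding wy zy' ww by (simp add: b_def power2_eq_square algebra_simps)
  then have c2: "\<beta>\<^sup>2 * b \<le> 8 * \<alpha> * \<beta>" using ab by simp
  have "\<alpha> = 0"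
  proof (rule ccontr)
    assume "\<alpha> \<noteq> 0"
    then have \<alpha>: "\<alpha> > 0" using nn by simp
    have "\<alpha> * (real j ^ 2 * \<alpha> * a) \<le> \<alpha> * (8 * \<beta>)"
      using c1 by (simp add: power2_eq_square algebra_simps)
    then have d1: "real j ^ 2 * \<alpha> * a \<le> 8 * \<beta>" using \<alpha> by simp
    have "real j ^ 2 * \<alpha> * a > 0" using \<alpha> ab \<open>j > 0\<close> by simp
    then have \<beta>: "\<beta> > 0" using d1 by simp
    have "\<beta> * (\<beta> * b) \<le> \<beta> * (8 * \<alpha>)" using c2 by (simp add: power2_eq_square algebra_simps)
    then have d2: "\<beta> * b \<le> 8 * \<alpha>" using \<beta> by simp
    have "(real j ^ 2 * a * b) * \<alpha> = (real j ^ 2 * \<alpha> * a) * b" by simp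
    also have "\<dots> \<le> (8 * \<beta>) * b" using d1 ab by (intro mult_right_mono) auto
    also have "\<dots> \<le> 64 * \<alpha>" using d2 by simp
    finally have "real j ^ 2 * a * b \<le> 64" using \<alpha> by simp
    moreover have "real j * (a * b) \<le> real j ^ 2 * (a * b)"
      using ab \<open>j > 0\<close> by (intro mult_right_mono) (auto simp: power2_eq_square)
    ultimately show False using j by (simp add: a_def b_def algebra_simps)
  qed
  then have "\<beta> = 0" using c2 ab by (simp add: mult_le_0_iff)
  obtain r where "z = r *\<^sub>R v0"
    using cone_orthogonal_collinear[OF v0(1,2), of z] z \<open>\<alpha> = 0\<close> form_commute[of v0 z]
    by (auto simp: \<alpha>_def)
  then have "z = 0" using \<open>\<beta> = 0\<close> v1(4) by (simp add: \<beta>_def form_linear)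
  then show ?thesis using z by simp
qed

end

context flat_group
begin

lemma linear_part_comp:
  assumes "g \<in> \<Gamma>"
  shows "linear_part (g \<circ> h) = linear_part g \<circ> linear_part h"
  using group_diff[OF assms] by (auto simp: linear_part_def fun_eq_iff)

lemma pow_mem: "g \<in> \<Gamma> \<Longrightarrow> g ^^ j \<in> \<Gamma>"
  by (induction j) (auto simp: comp_mem id_mem[unfolded id_def] id_mem)

lemma linear_part_pow: "g \<in> \<Gamma> \<Longrightarrow> linear_part (g ^^ j) = linear_part g ^^ j"
proof (induction j)
  case 0
  then show ?case by (auto simp: linear_part_def)
next
  case (Suc j)
  then show ?case using linear_part_comp[of g "g ^^ j"] by (simp del: comp_apply add: comp_def[symmetric])
qed

text \<open>One nontrivial \<open>h\<close> provides \<open>v0\<close>. Every \<open>g\<close> with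
  nontrivial linear part is compared with \<open>h\<close> through the products
  \<open>(h ^^ j) \<circ> g\<close>, which stay in the group and so have unipotent linear parts
  too.\<close>

lemma unipotent_group_parabolic:
  assumes unip: "unipotent_group \<Gamma>" and nontrivial: "h \<in> \<Gamma>" "linear_part h \<noteq> id"
  obtains v0 where "v0 \<in> C" "v0 \<noteq> 0" "l v0 v0 = 0"
    "\<And>g v1. g \<in> \<Gamma> \<Longrightarrow> l v0 v1 = 1 \<Longrightarrow> l v1 v1 = 0 \<Longrightarrow>
      \<exists>y. l y v0 = 0 \<and> l y v1 = 0 \<and> linear_part g = nu l v0 y"
proof -
  note iso = linear_linear_part linear_part_isometry
  have u: "unipotent (linear_part g)" if "g \<in> \<Gamma>" for g
    using unip that by (simp add: unipotent_group_def)
  obtain v where "linear_part h v \<noteq> v" using nontrivial(2) by (auto simp: fun_eq_iff)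
  then obtain v0 where v0: "v0 \<in> C" "v0 \<noteq> 0" "l v0 v0 = 0" "linear_part h v0 = v0"
    using unipotent_isometry_null_fixed[OF iso u] nontrivial(1) by metis
  have fixed: "linear_part g v0 = v0" if g: "g \<in> \<Gamma>" for g
  proof (cases "linear_part g = id")
    case False
    then obtain v where "linear_part g v \<noteq> v" by (auto simp: fun_eq_iff)
    then obtain u0 where u0: "u0 \<in> C" "u0 \<noteq> 0" "l u0 u0 = 0" "linear_part g u0 = u0"
      using unipotent_isometry_null_fixed[OF iso u] g by metis
    have "unipotent ((linear_part h ^^ j) \<circ> linear_part g)" for j
      using u[OF comp_mem[OF pow_mem[OF nontrivial(1)] g]] nontrivial(1)
      by (simp add: linear_part_comp pow_mem linear_part_pow)
    then obtain r where r: "u0 = r *\<^sub>R v0"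
      using unipotent_isometries_common_null[of "linear_part h" "linear_part g" v0 u0]
        iso u nontrivial g v0 u0 False by metis
    then have "r \<noteq> 0" using u0(2) by auto
    then show ?thesis using u0(4) linear_scale[OF iso(1)[OF g]] r by simp
  qed simp
  show ?thesis
  proof (rule that[OF v0(1-3)])
    fix g v1 assume g: "g \<in> \<Gamma>" and v1: "l v0 v1 = 1" "l v1 v1 = 0"
    show "\<exists>y. l y v0 = 0 \<and> l y v1 = 0 \<and> linear_part g = nu l v0 y"
      using unipotent_isometry_nu[OF iso(1)[OF g] iso(2)[OF g] u[OF g] v0(1,3) fixed[OF g] v1]
      by blast
  qed
qed

end

section \<open>Strictly causal unipotent groups\<close>

context lorentz_cone
begin

text \<open>Sending \<open>z\<close> to its pairings with a basis of \<open>T\<close> is injective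
  on \<open>T\<close>, since a vector of the kernel has square zero; by dimension it is
  onto.\<close>

lemma definite_riesz:
  assumes T: "subspace T" "\<And>x. x \<in> T \<Longrightarrow> x \<noteq> 0 \<Longrightarrow> l x x \<noteq> 0" and f: "linear f"
  obtains z where "z \<in> T" "\<And>x. x \<in> T \<Longrightarrow> l x z = f x"
proof -
  obtain B where B: "B \<subseteq> T" "independent B" "span B = T"
    using basis_exists[of T] span_subspace[OF _ _ T(1)] by metis
  have fin: "finite B" using independent_imp_finite[OF B(2)] by simp
  define \<phi> where "\<phi> z = (\<Sum>b\<in>B. l b z *\<^sub>R b)" for z
  have lin: "linear \<phi>"
    by (rule linearI)
      (simp_all add: \<phi>_def form_linear scaleR_add_left sum.distrib scaleR_sum_right)
  have coeff: "l b z = u b" if "\<phi> z = (\<Sum>b\<in>B. u b *\<^sub>R b)" "b \<in> B" for b z u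
  proof -
    have "(\<Sum>b\<in>B. (l b z - u b) *\<^sub>R b) = 0"
      using that(1) by (simp add: \<phi>_def scaleR_diff_left sum_subtractf)
    then show ?thesis using B(2) fin that(2) unfolding independent_explicit by fastforce
  qed
  have ext: "l x z = f' x" if "linear f'" "\<And>b. b \<in> B \<Longrightarrow> l b z = f' b" "x \<in> T" for x z f'
  proof (rule linear_eq_on[OF linear_form_left that(1)])
    show "x \<in> span B" using that B by simp
  qed (use that in auto)
  have "inj_on \<phi> T"
  proof (rule linear_injective_on_subspace_0[OF lin T(1), THEN iffD2], intro ballI impI)
    fix z assume z: "z \<in> T" "\<phi> z = 0"
    have "l b z = 0" if "b \<in> B" for b using coeff[of z "\<lambda>_. 0" b] z that by simp
    then have "l z z = 0" using ext[of "\<lambda>_. 0" z z] z by (simp add: linear_zero)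
    then show "z = 0" using T(2) z by blast
  qed
  moreover have sub: "\<phi> ` T \<subseteq> T"
    unfolding \<phi>_def using B(1) T(1) by (auto intro!: subspace_sum subspace_scale)
  moreover have "dim (\<phi> ` T) = dim T"
    using dim_image_eq[OF lin, of T, unfolded span_eq_iff[THEN iffD2, OF T(1)]] calculation(1) by blast
  ultimately have "\<phi> ` T = T"
    using lin T(1) by (intro subspace_dim_equal linear_subspace_image) simp_all
  moreover have "(\<Sum>b\<in>B. f b *\<^sub>R b) \<in> T"
    using B(1) T(1) by (auto intro!: subspace_sum subspace_scale)
  ultimately obtain z where z: "z \<in> T" "\<phi> z = (\<Sum>b\<in>B. f b *\<^sub>R b)" by (metis imageE)
  then show ?thesis using that[of z] ext[OF f, of z] coeff by blast
qed

lemma spacelike_negative: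
  assumes "spacelike C T" "x \<in> T" "x \<noteq> 0"
  shows "l x x < 0"
proof (rule ccontr)
  have T: "subspace T" "T \<inter> C = {0}" using assms(1) by (auto simp: spacelike_def)
  assume "\<not> ?thesis"
  then have "x \<in> C \<or> - x \<in> C" using cone_cases[of x] by simp
  then have "x \<in> T \<inter> C \<or> - x \<in> T \<inter> C" using assms(2) subspace_neg[OF T(1)] by auto
  then show False using T assms(3) by auto
qed

text \<open>\<open>p\<close> is the orthogonal projection of \<open>v\<close> to \<open>T\<close>,
  obtained as the Riesz vector of pairing with \<open>v\<close>.\<close>

lemma spacelike_split:
  assumes "spacelike C T"
  obtains p where "p \<in> T" "\<And>x. x \<in> T \<Longrightarrow> l x (v - p) = 0"
proof -
  obtain p where p: "p \<in> T" "\<And>x. x \<in> T \<Longrightarrow> l x p = l x v"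
  proof (rule definite_riesz[of T "\<lambda>x. l x v"])
    show "subspace T" using assms by (simp add: spacelike_def)
    show "l x x \<noteq> 0" if "x \<in> T" "x \<noteq> 0" for x using spacelike_negative[OF assms that] by simp
  qed (use linear_form_left in auto)
  then show ?thesis using that[of p] by (simp add: form_linear)
qed

lemma mem_perp_span: "x \<in> perp l (span {v}) \<longleftrightarrow> l x v = 0"
  by (auto simp: perp_def span_singleton form_linear)

lemma mem_perp_singleton: "x \<in> perp l {v} \<longleftrightarrow> l x v = 0"
  by (auto simp: perp_def)

text \<open>The orthogonal complement of \<open>T\<close> is a timelike line or contains a pair of independent null
  vectors.\<close>

lemma spacelike_lattice_type:
  assumes T: "spacelike C T" and \<Lambda>: "uniform_lattice T \<Lambda>"
  shows "(\<exists>L. type_i l C T L \<Lambda>) \<or> (\<exists>v0 v1. type_ii l C v0 v1 T (\<lambda>_. 0) \<Lambda>)"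
proof -
  have sub: "subspace T" using T by (simp add: spacelike_def)
  obtain e where e: "e \<in> C" "l e e = 1" using timelike_in_cone by blast
  obtain p where p: "p \<in> T" "\<And>x. x \<in> T \<Longrightarrow> l x (e - p) = 0" using spacelike_split[OF T] by metis
  \<comment> \<open>The component in \<open>T\<close> has nonpositive square, so the component
    orthogonal to \<open>T\<close> is timelike again.\<close>
  define w where "w = e - p"
  have "l w p = 0" using p form_commute[of w p] by (simp add: w_def)
  then have "l e e = l w w + l p p"
    using form_commute[of w p] by (simp add: w_def form_linear)
  moreover have "l p p \<le> 0" using spacelike_negative[OF T p(1)] by (cases "p = 0") (auto simp: form_linear)
  ultimately have ww: "l w w > 0" using e by simp
  obtain u where u: "u \<in> C" "l u u > 0" "\<And>x. x \<in> T \<Longrightarrow> l x u = 0"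
  proof (cases "w \<in> C")
    case True
    then show ?thesis using that[of w] ww p by (simp add: w_def)
  next
    case False
    then have "- w \<in> C" using cone_cases[of w] ww by simp
    then show ?thesis using that[of "- w"] ww p by (simp add: w_def form_linear)
  qed
  have u0: "u \<noteq> 0" using u(2) by (auto simp: form_linear)
  show ?thesis
  proof (cases "\<forall>w. (\<forall>x\<in>T. l x w = 0) \<longrightarrow> w \<in> span {u}")
    case True
    have ex: "\<exists>x y. v = x + y \<and> x \<in> T \<and> y \<in> span {u}" for v
    proof -
      obtain q where "q \<in> T" "\<And>x. x \<in> T \<Longrightarrow> l x (v - q) = 0" using spacelike_split[OF T] by metis
      then show ?thesis using True by (intro exI[of _ q] exI[of _ "v - q"]) auto
    qed
    have "x = 0" if x: "x \<in> T" "x \<in> span {u}" for x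
    proof -
      obtain k where "x = k *\<^sub>R u" using x(2) by (auto simp: span_singleton)
      then show ?thesis using u(2) u(3)[OF x(1)] by (simp add: form_linear)
    qed
    then have "T \<inter> span {u} = {0}" using subspace_0[OF sub] span_zero by blast
    moreover have "{x + y | x y. x \<in> T \<and> y \<in> span {u}} = UNIV" using ex by (simp add: set_eq_iff)
    moreover have "l x y = 0" if x: "x \<in> T" "y \<in> span {u}" for x y
    proof -
      obtain k where "y = k *\<^sub>R u" using x(2) by (auto simp: span_singleton)
      then show ?thesis using u(3)[OF x(1)] by (simp add: form_linear)
    qed
    moreover have "dim (span {u}) = 1" using u0 by (simp add: dim_singleton)
    moreover have "u \<in> span {u} \<inter> interior C" using u by (simp add: interior_cone span_base)
    then have "span {u} \<inter> interior C \<noteq> {}" by blast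
    ultimately have "type_i l C T (span {u}) \<Lambda>"
      unfolding type_i_def using sub T \<Lambda> by simp
    then show ?thesis by blast
  next
    case False
    then obtain w0 where w0: "\<And>x. x \<in> T \<Longrightarrow> l x w0 = 0" "w0 \<notin> span {u}" by blast
    define w where "w = w0 - (l u w0 / l u u) *\<^sub>R u"
    have "w \<noteq> 0" using w0(2) by (auto simp: w_def span_singleton)
    moreover have uw: "l u w = 0" using u(2) by (simp add: w_def form_linear)
    ultimately have ww: "l w w < 0" using negative_on_timelike_perp u(2) by blast
    \<comment> \<open>Normalised to squares 1/2 and -1/2, so that sum and difference are null and
      pair to 1.\<close>
    define u' where "u' = (1 / sqrt (2 * l u u)) *\<^sub>R u"
    define w' where "w' = (1 / sqrt (- 2 * l w w)) *\<^sub>R w"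
    have uu': "l u' u' = 1/2" using u(2) by (simp add: u'_def form_linear real_sqrt_mult_self flip: power2_eq_square)
    have ww': "l w' w' = - 1/2" using ww by (simp add: w'_def form_linear real_sqrt_mult_self flip: power2_eq_square)
    have uw': "l u' w' = 0" "l w' u' = 0" using uw form_commute[of w u] by (simp_all add: u'_def w'_def form_linear)
    have u'C: "u' \<in> C" using u by (simp add: u'_def cone_scale)
    define v0 v1 where "v0 = u' + w'" and "v1 = u' - w'"
    have null: "l v0 v0 = 0" "l v1 v1 = 0" "l v0 v1 = 1" "l v0 u' > 0" "l v1 u' > 0"
      using uu' ww' uw' by (simp_all add: v0_def v1_def form_linear)
    then have "v0 \<in> frontier C" "v1 \<in> frontier C"
      using in_coneI[OF _ u'C] by (simp_all add: frontier_cone)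
    moreover have "l x v0 = 0 \<and> l x v1 = 0" if "x \<in> T" for x
      using that u(3) w0(1) by (simp add: v0_def v1_def u'_def w'_def w_def form_linear)
    ultimately have "type_ii l C v0 v1 T (\<lambda>_. 0) \<Lambda>"
      unfolding type_ii_def Let_def using null sub \<Lambda>
      by (auto simp: mem_perp_span mem_perp_singleton form_linear)
    then show ?thesis by blast
  qed
qed

lemma type_ii_action_zero: "type_ii_action l v0 (\<lambda>_. 0) = (\<lambda>x v. x + v)"
  by (intro ext) (simp add: type_ii_action_def form_linear)

lemma trivial_kernels_zero: "subspace T \<Longrightarrow> trivial_kernels T (\<lambda>_. 0)"
  by (auto simp: trivial_kernels_def subspace_0)

lemma finite_lorentz_covering_refl: "finite_lorentz_covering l C \<Gamma> \<Gamma> (\<lambda>x. x)"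
proof -
  let ?X = "quotient_manifold \<Gamma>"
  have "finite_covering_map ?X ?X (\<lambda>x. x)"
    unfolding finite_covering_map_def
  proof (intro conjI ballI)
    fix y assume y: "y \<in> topspace ?X"
    have "homeomorphic_map (subtopology ?X (topspace ?X)) (subtopology ?X (topspace ?X)) (\<lambda>x. x)"
      using homeomorphic_map_id[of ?X ?X] by (simp add: id_def)
    then show "\<exists>U. y \<in> U \<and> openin ?X U \<and> (\<exists>\<V>. \<Union>\<V> = {x \<in> topspace ?X. x \<in> U} \<and>
        (\<forall>S\<in>\<V>. openin ?X S) \<and> pairwise disjnt \<V> \<and>
        (\<forall>S\<in>\<V>. homeomorphic_map (subtopology ?X S) (subtopology ?X U) (\<lambda>x. x)))"
      using y by (intro exI[of _ "topspace ?X"] conjI exI[of _ "{topspace ?X}"]) auto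
  qed auto
  moreover have "lorentz_affine l C (\<lambda>x. x)"
    by (simp add: lorentz_affine_def linear_part_def[abs_def] linear_ident bij_id[unfolded id_def])
  ultimately show ?thesis
    unfolding finite_lorentz_covering_def by (auto intro!: exI[of _ UNIV] exI[of _ "\<lambda>x. x"])
qed

end

section \<open>Strictly causal groups of translations\<close>

locale strictly_causal_group = flat_group +
  assumes strictly_causal: "strictly_causal C \<Gamma>"
begin

lemma causal_id: "g \<in> \<Gamma> \<Longrightarrow> g v - v \<in> C \<Longrightarrow> g = id"
  using strictly_causal strictly_causal_iff by blast

lemma causal_form:
  assumes "g \<in> \<Gamma>" "l (g v - v) (g v - v) \<ge> 0"
  shows "g = id"
proof -
  consider "g v - v \<in> C" | "- (g v - v) \<in> C" using cone_cases[of "g v - v"] assms(2) by blast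
  then show ?thesis
  proof cases
    case 1
    then show ?thesis using causal_id assms by blast
  next
    case 2
    then have "inv g (g v) - g v \<in> C" using assms by (simp add: inv_apply)
    then have "inv g = id" using causal_id inv_mem assms(1) by blast
    then have "g v = v" using inv_apply(1)[OF assms(1), of v] by simp
    then show ?thesis using free assms(1) by blast
  qed
qed

text \<open>Properness makes the translation vectors discrete. A nonzero cone vector
  \<open>c\<close> in their span has multiples \<open>k c\<close>, \<open>k \<ge> 1\<close>,
  arbitrarily close to the lattice, so the group moves 0 far along \<open>c\<close>, which strict
  causality forbids; hence the span is spacelike.\<close>

lemma translations_type:
  assumes lin: "\<And>g. g \<in> \<Gamma> \<Longrightarrow> linear_part g = id"
  obtains T \<Lambda> where "\<Gamma> = translation_group \<Lambda>"
    "(\<exists>L. type_i l C T L \<Lambda>) \<or> (\<exists>v0 v1. type_ii l C v0 v1 T (\<lambda>_. 0) \<Lambda>)" "subspace T"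
proof -
  define \<Lambda> where "\<Lambda> = (\<lambda>g. g 0) ` \<Gamma>"
  have act: "g v = g 0 + v" if "g \<in> \<Gamma>" for g v
    using fun_cong[OF lin[OF that], of v] by (simp add: linear_part_def algebra_simps)
  have "g \<in> translation_group \<Lambda>" if "g \<in> \<Gamma>" for g
  proof -
    have "g = (+) (g 0)" using act[OF that] by (intro ext)
    then show ?thesis unfolding translation_group_def \<Lambda>_def using that by blast
  qed
  moreover have "(+) (g 0) \<in> \<Gamma>" if "g \<in> \<Gamma>" for g
  proof -
    have "(+) (g 0) = g" by (intro ext) (simp only: act[OF that, symmetric])
    then show ?thesis using that by simp
  qed
  ultimately have \<Gamma>: "\<Gamma> = translation_group \<Lambda>" by (auto simp: translation_group_def \<Lambda>_def)
  have sub: "additive_subgroup \<Lambda>"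
    unfolding additive_subgroup_def
  proof (intro conjI ballI)
    show "0 \<in> \<Lambda>" unfolding \<Lambda>_def by (rule image_eqI[OF _ id_mem]) simp
    fix x y assume "x \<in> \<Lambda>" "y \<in> \<Lambda>"
    then obtain g h where gh: "g \<in> \<Gamma>" "h \<in> \<Gamma>" "x = g 0" "y = h 0" by (auto simp: \<Lambda>_def)
    have "(g \<circ> inv h) 0 = x - y"
      using act[OF gh(1), of "inv h 0"] act[OF gh(2), of "inv h 0"] gh inv_apply(2)[OF gh(2), of 0]
      by (simp add: algebra_simps eq_neg_iff_add_eq_0)
    then show "x - y \<in> \<Lambda>"
      unfolding \<Lambda>_def by (intro image_eqI[OF _ comp_mem[OF gh(1) inv_mem[OF gh(2)]]]) simp
  qed
  have "finite {g \<in> \<Gamma>. g ` cball 0 1 \<inter> cball 0 1 \<noteq> {}}" by (rule proper) simp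
  moreover have "{x \<in> \<Lambda>. norm x \<le> 1} \<subseteq> (\<lambda>g. g 0) ` {g \<in> \<Gamma>. g ` cball 0 1 \<inter> cball 0 1 \<noteq> {}}"
  proof
    fix x assume "x \<in> {x \<in> \<Lambda>. norm x \<le> 1}"
    then obtain g where g: "g \<in> \<Gamma>" "x = g 0" "norm (g 0) \<le> 1" by (auto simp: \<Lambda>_def)
    then have "g 0 \<in> g ` cball 0 1 \<inter> cball 0 1" by simp
    then show "x \<in> (\<lambda>g. g 0) ` {g \<in> \<Gamma>. g ` cball 0 1 \<inter> cball 0 1 \<noteq> {}}" using g(1,2) by blast
  qed
  ultimately have "finite {x \<in> \<Lambda>. norm x \<le> 1}" by (meson finite_imageI finite_subset)
  then obtain d where d: "d > 0" "\<And>x. x \<in> \<Lambda> \<Longrightarrow> norm x \<le> 1 \<Longrightarrow> x \<noteq> 0 \<Longrightarrow> d \<le> dist 0 x"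
    using finite_set_avoid[of "{x \<in> \<Lambda>. norm x \<le> 1}" 0] by blast
  have "separated \<Lambda>"
    unfolding separated_def
  proof (intro exI[of _ "min d 1"] conjI ballI impI, goal_cases)
    case (2 x)
    then show ?case using d(2)[of x] by (cases "x = 0") auto
  qed (use d in simp)
  then have disc: "discrete \<Lambda>" using discrete_iff_separated[OF sub] by blast
  have "c = 0" if c: "c \<in> span \<Lambda>" "c \<in> C" for c
  proof (rule ccontr)
    assume "c \<noteq> 0"
    then obtain \<delta> where \<delta>: "\<delta> > 0"
      "\<And>g e r. g \<in> \<Gamma> \<Longrightarrow> g 0 = 0 + e + r *\<^sub>R c \<Longrightarrow> norm e < \<delta> \<Longrightarrow> \<bar>r\<bar> \<le> 1/2"
      using strictly_causal_no_escape[OF strictly_causal c(2), of "1/2" 0] by (metis half_gt_zero zero_less_one)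
    obtain k y where k: "k \<ge> (1::nat)" "y \<in> \<Lambda>" "norm (real k *\<^sub>R c - y) < \<delta>"
      using real_multiple_approx[OF sub c(1) \<delta>(1), of 1] by blast
    obtain g where g: "g \<in> \<Gamma>" "y = g 0" using k(2) by (auto simp: \<Lambda>_def)
    have "\<bar>real k\<bar> \<le> 1/2"
      by (rule \<delta>(2)[OF g(1), of "y - real k *\<^sub>R c"]) (use g k in \<open>auto simp: norm_minus_commute\<close>)
    then show False using k(1) by simp
  qed
  then have "spacelike C (span \<Lambda>)"
    unfolding spacelike_def using span_zero[of \<Lambda>] by auto
  then show ?thesis
    using that[OF \<Gamma> spacelike_lattice_type[OF _ uniform_lattice_span[OF sub disc]]] by simp
qed

end

context lorentz_cone
begin

lemma bilinear_eq_on_span: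
  assumes f: "linear f" "linear g" and eq: "\<And>x y. x \<in> S \<Longrightarrow> y \<in> S \<Longrightarrow> l (f x) y = l x (g y)"
    and "x \<in> span S" "y \<in> span S"
  shows "l (f x) y = l x (g y)"
proof -
  have lin1: "linear (\<lambda>x. l (f x) y)" "linear (\<lambda>x. l x (g y))" for y
    using linear_compose[OF f(1) linear_form_left, of y] linear_form_left by (auto simp: o_def)
  have lin2: "linear (\<lambda>y. l (f x) y)" "linear (\<lambda>y. l x (g y))" for x
    using linear_compose[OF f(2) linear_form_right, of x] linear_form_right by (auto simp: o_def)
  have "l (f x) y = l x (g y)" if "x \<in> S" for x
    using linear_eq_on[OF lin2 assms(5), of x x] eq[OF that] by blast
  then show ?thesis using linear_eq_on[OF lin1 assms(4), of y y] by blast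
qed

end

section \<open>Groups with parabolic linear parts\<close>

locale parabolic_group = strictly_causal_group +
  fixes v0 v1
  assumes v0: "v0 \<in> C" "l v0 v0 = 0" and v1: "v1 \<in> C" "l v1 v1 = 0" "l v0 v1 = 1"
    and parabolic: "g \<in> \<Gamma> \<Longrightarrow> \<exists>y. l y v0 = 0 \<and> l y v1 = 0 \<and> linear_part g = nu l v0 y"
    and nontrivial: "\<exists>h\<in>\<Gamma>. linear_part h \<noteq> id"
begin

lemma v10: "l v1 v0 = 1"
  using v1(3) form_commute[of v1 v0] by simp

lemma v0_nonzero: "v0 \<noteq> 0"
  using v1(3) by (auto simp: form_linear)

definition slope :: "('a \<Rightarrow> 'a) \<Rightarrow> 'a" where
  "slope g = (SOME y. l y v0 = 0 \<and> l y v1 = 0 \<and> linear_part g = nu l v0 y)"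

text \<open>Intended as the \<open>N\<close>-component of the translation part; membership in
  \<open>N\<close> is known only after \<open>shift_v0\<close>.\<close>

definition hshift :: "('a \<Rightarrow> 'a) \<Rightarrow> 'a" where
  "hshift g = g 0 - l (g 0) v1 *\<^sub>R v0"

definition vshift :: "('a \<Rightarrow> 'a) \<Rightarrow> real" where
  "vshift g = l (g 0) v1"

lemma slope:
  assumes "g \<in> \<Gamma>"
  shows slope_v0: "l (slope g) v0 = 0" and slope_v1: "l (slope g) v1 = 0"
    and linear_part_slope: "linear_part g = nu l v0 (slope g)"
  using someI_ex[OF parabolic[OF assms]] unfolding slope_def by auto

lemma slope_v0': "g \<in> \<Gamma> \<Longrightarrow> l v0 (slope g) = 0" and slope_v1': "g \<in> \<Gamma> \<Longrightarrow> l v1 (slope g) = 0"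
  using slope form_commute[of _ "slope g"] by auto

lemma apply_slope: "g \<in> \<Gamma> \<Longrightarrow> g v = nu l v0 (slope g) v + g 0"
  using fun_cong[OF linear_part_slope, of g v] by (simp add: linear_part_def diff_eq_eq)

lemma slope_unique:
  assumes "g \<in> \<Gamma>" "l y v0 = 0" "l y v1 = 0" "\<And>v. linear_part g v = nu l v0 y v"
  shows "slope g = y"
proof -
  have y1: "l v1 y = 0" using assms(3) form_commute[of v1 y] by simp
  have "nu l v0 (slope g) v1 = nu l v0 y v1" using assms(4)[of v1] linear_part_slope[OF assms(1)] by simp
  then have "slope g - y = (1/2 * l (slope g) (slope g) - 1/2 * l y y) *\<^sub>R v0"
    using y1 slope_v1'[OF assms(1)] by (simp add: nu_def v10 algebra_simps)
  then obtain r where r: "slope g - y = r *\<^sub>R v0" by blast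
  have "l (slope g - y) v1 = 0" using slope_v1[OF assms(1)] assms(3) by (simp add: form_linear)
  then have "r = 0" using r v1(3) by (simp add: form_linear)
  then show ?thesis using r by simp
qed

lemma slope_comp:
  assumes "g \<in> \<Gamma>" "h \<in> \<Gamma>"
  shows "slope (g \<circ> h) = slope g + slope h"
proof (rule slope_unique[OF comp_mem[OF assms]])
  show "linear_part (g \<circ> h) v = nu l v0 (slope g + slope h) v" for v
    using nu_add[OF v0(2) slope_v0[OF assms(2)] slope_v0[OF assms(1)]]
    by (simp add: linear_part_comp[OF assms(1)] linear_part_slope assms)
qed (simp_all add: form_linear slope assms)

lemma apply_formula:
  assumes "g \<in> \<Gamma>"
  shows "g v = v + hshift g + l v v0 *\<^sub>R slope g +
    (vshift g - l v (slope g) - 1/2 * l v v0 * l (slope g) (slope g)) *\<^sub>R v0"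
  using apply_slope[OF assms, of v]
  by (simp add: nu_def hshift_def vshift_def algebra_simps)

text \<open>For nonzero slope, moving the base point along the slope changes the displacement by
  multiples of \<open>v0\<close>. If the translation part had nonzero pairing with
  \<open>v0\<close>, the square of the displacement could thus be brought to zero, against
  causality. An element of slope zero is composed with one of nonzero slope.\<close>

lemma shift_v0: "g \<in> \<Gamma> \<Longrightarrow> l (g 0) v0 = 0"
proof -
  have main: "l (g 0) v0 = 0" if g: "g \<in> \<Gamma>" and ne: "slope g \<noteq> 0" for g
  proof (rule ccontr)
    assume c: "l (g 0) v0 \<noteq> 0"
    have q: "l (slope g) (slope g) < 0"
      using null_pair_perp_negative[OF v0 v1(3) slope_v0[OF g] slope_v1[OF g] ne] .
    define k where "k = l (g 0) (g 0) / (2 * l (slope g) (slope g) * l (g 0) v0)"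
    define v where "v = k *\<^sub>R slope g"
    have "l v v0 = 0" using slope_v0[OF g] by (simp add: v_def form_linear)
    then have "g v - v = g 0 - (k * l (slope g) (slope g)) *\<^sub>R v0"
      using apply_slope[OF g, of v] slope_v0[OF g] by (simp add: nu_def v_def form_linear)
    then have "l (g v - v) (g v - v) = l (g 0) (g 0) - 2 * k * l (slope g) (slope g) * l (g 0) v0"
      using v0(2) form_commute[of v0 "g 0"] by (simp add: form_linear)
    also have "\<dots> = 0" using c q by (simp add: k_def)
    finally have "g = id" using causal_form[OF g, of v] by simp
    then show False using c by (simp add: form_linear)
  qed
  assume g: "g \<in> \<Gamma>"
  obtain h where h: "h \<in> \<Gamma>" "linear_part h \<noteq> id" using nontrivial by blast
  have nh: "slope h \<noteq> 0" using linear_part_slope[OF h(1)] h(2) by (auto simp: fun_eq_iff)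
  show ?thesis
  proof (cases "slope g = 0")
    case True
    then have "slope (h \<circ> g) \<noteq> 0" using slope_comp[OF h(1) g] nh by simp
    then have "l (h (g 0)) v0 = 0" using main[OF comp_mem[OF h(1) g]] by simp
    then show ?thesis
      using apply_slope[OF h(1), of "g 0"] main[OF h(1) nh] nu_height[OF v0(2) slope_v0[OF h(1)], of "g 0"]
      by (simp add: form_linear)
  qed (use main g in blast)
qed

lemma hshift_v0: "g \<in> \<Gamma> \<Longrightarrow> l (hshift g) v0 = 0"
  using shift_v0 v0 by (simp add: hshift_def form_linear)

lemma hshift_v1: "l (hshift g) v1 = 0"
  using v1 by (simp add: hshift_def form_linear)

text \<open>Composition is additive up to a correction along \<open>v0\<close>:
  \<open>hshift\<close> is a homomorphism, \<open>vshift\<close> one up to a bilinear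
  cocycle.\<close>

lemma shift_comp:
  assumes "g \<in> \<Gamma>" "h \<in> \<Gamma>"
  shows hshift_comp: "hshift (g \<circ> h) = hshift g + hshift h"
    and vshift_comp: "vshift (g \<circ> h) = vshift g + vshift h - l (hshift h) (slope g)"
proof -
  have eq: "l (h 0) (slope g) = l (hshift h) (slope g)"
    using slope_v0'[OF assms(1)] by (simp add: hshift_def form_linear)
  have "(g \<circ> h) 0 = h 0 + g 0 - l (h 0) (slope g) *\<^sub>R v0"
    using apply_slope[OF assms(1), of "h 0"] shift_v0[OF assms(2)] by (simp add: nu_def)
  then have gh: "(g \<circ> h) 0 = h 0 + g 0 - l (hshift h) (slope g) *\<^sub>R v0" by (simp only: eq)
  show v: "vshift (g \<circ> h) = vshift g + vshift h - l (hshift h) (slope g)"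
    using v1(3) by (simp add: vshift_def gh[unfolded comp_apply] form_linear)
  have "hshift (g \<circ> h) = (g \<circ> h) 0 - vshift (g \<circ> h) *\<^sub>R v0"
    by (simp only: hshift_def vshift_def)
  also have "\<dots> = (g 0 - vshift g *\<^sub>R v0) + (h 0 - vshift h *\<^sub>R v0)"
    unfolding v gh by (simp add: algebra_simps)
  finally show "hshift (g \<circ> h) = hshift g + hshift h" by (simp only: hshift_def vshift_def)
qed

text \<open>The point \<open>t v1\<close> represents the slice \<open>l0 = t\<close>; only its
  displacement modulo \<open>v0\<close> matters for causality there.\<close>

lemma apply_slice:
  assumes "g \<in> \<Gamma>"
  obtains r where "g (t *\<^sub>R v1) = t *\<^sub>R v1 + (hshift g + t *\<^sub>R slope g) + r *\<^sub>R v0"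
proof -
  have "l (t *\<^sub>R v1) v0 = t" using v10 by (simp add: form_linear)
  then show ?thesis
    using that apply_formula[OF assms, of "t *\<^sub>R v1"] by (simp only: add.assoc[symmetric])
qed

lemma kernel_trivial:
  assumes "g \<in> \<Gamma>" "hshift g + t *\<^sub>R slope g = 0"
  shows "g = id"
proof -
  obtain r where "g (t *\<^sub>R v1) = t *\<^sub>R v1 + (hshift g + t *\<^sub>R slope g) + r *\<^sub>R v0"
    using apply_slice[OF assms(1)] by blast
  then have "l (g (t *\<^sub>R v1) - t *\<^sub>R v1) (g (t *\<^sub>R v1) - t *\<^sub>R v1) = 0"
    using assms(2) v0(2) by (simp add: form_linear)
  then show ?thesis using causal_form[OF assms(1), of "t *\<^sub>R v1"] by simp
qed

text \<open>The commutator moves a point along \<open>v0\<close> and is therefore trivial, so the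
  cocycle of \<open>vshift\<close> is symmetric. This becomes the symmetry of
  \<open>a\<close>.\<close>

lemma hshift_symmetric:
  assumes g: "g \<in> \<Gamma>" and h: "h \<in> \<Gamma>"
  shows "l (hshift h) (slope g) = l (hshift g) (slope h)"
proof -
  define k where "k = g \<circ> h \<circ> inv (h \<circ> g)"
  have hg: "h \<circ> g \<in> \<Gamma>" and gh: "g \<circ> h \<in> \<Gamma>" and k: "k \<in> \<Gamma>"
    unfolding k_def using g h by (auto intro!: comp_mem inv_mem)
  have "hshift (g \<circ> h) = hshift (h \<circ> g)" using hshift_comp g h by simp
  then have "g (h 0) = h (g 0) + (vshift (g \<circ> h) - vshift (h \<circ> g)) *\<^sub>R v0"
    by (simp add: hshift_def vshift_def algebra_simps)
  moreover have "k ((h \<circ> g) 0) = g (h 0)" using inv_apply(1)[OF hg, of 0] by (simp add: k_def)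
  ultimately have *: "k (h (g 0)) - h (g 0) = (vshift (g \<circ> h) - vshift (h \<circ> g)) *\<^sub>R v0" by simp
  then have "k = id" using causal_form[OF k, of "h (g 0)"] v0(2) by (simp add: form_linear)
  then have "vshift (g \<circ> h) = vshift (h \<circ> g)" using * v0_nonzero by simp
  then show ?thesis using vshift_comp g h by simp
qed

lemma shift_id: "hshift id = 0" "vshift id = 0" "slope id = 0"
proof -
  show "hshift id = 0" "vshift id = 0" by (simp_all add: hshift_def vshift_def form_linear)
  show "slope id = 0" using slope_comp[OF id_mem id_mem] by simp
qed

lemma inj_hshift: "inj_on hshift \<Gamma>"
proof (rule inj_onI)
  fix g h assume gh: "g \<in> \<Gamma>" "h \<in> \<Gamma>" "hshift g = hshift h"
  have "h \<circ> inv h = id" using inv_apply(2)[OF gh(2)] by auto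
  then have "hshift h + hshift (inv h) = 0"
    using hshift_comp[OF gh(2) inv_mem[OF gh(2)]] shift_id by simp
  then have "hshift (g \<circ> inv h) + 0 *\<^sub>R slope (g \<circ> inv h) = 0"
    using hshift_comp[OF gh(1) inv_mem[OF gh(2)]] gh(3) by simp
  then have "g \<circ> inv h = id" by (rule kernel_trivial[OF comp_mem[OF gh(1) inv_mem[OF gh(2)]]])
  then show "g = h"
    using inv_apply(1)[OF gh(2)] by (metis comp_apply ext id_apply)
qed

text \<open>The escape bound along \<open>v0\<close> turns a small displacement modulo
  \<open>v0\<close> into a bounded displacement of \<open>t v1\<close>; properness does the
  rest.\<close>

lemma finite_small_displacement:
  obtains \<delta> where "\<delta> > 0" "finite {g \<in> \<Gamma>. norm (hshift g + t *\<^sub>R slope g) < \<delta>}"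
proof -
  obtain \<delta> where \<delta>: "\<delta> > 0"
    "\<And>g e r. g \<in> \<Gamma> \<Longrightarrow> g (t *\<^sub>R v1) = t *\<^sub>R v1 + e + r *\<^sub>R v0 \<Longrightarrow> norm e < \<delta> \<Longrightarrow> \<bar>r\<bar> \<le> 1"
    using strictly_causal_no_escape[OF strictly_causal v0(1) v0_nonzero, of 1 "t *\<^sub>R v1"]
    by (metis zero_less_one)
  define K where "K = cball (t *\<^sub>R v1) (\<delta> + norm v0)"
  have "finite {g \<in> \<Gamma>. g ` K \<inter> K \<noteq> {}}" unfolding K_def by (rule proper) simp
  moreover have "{g \<in> \<Gamma>. norm (hshift g + t *\<^sub>R slope g) < \<delta>} \<subseteq> {g \<in> \<Gamma>. g ` K \<inter> K \<noteq> {}}"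
  proof clarify
    fix g assume g: "g \<in> \<Gamma>" "norm (hshift g + t *\<^sub>R slope g) < \<delta>" "g ` K \<inter> K = {}"
    obtain r where r: "g (t *\<^sub>R v1) = t *\<^sub>R v1 + (hshift g + t *\<^sub>R slope g) + r *\<^sub>R v0"
      using apply_slice[OF g(1)] by blast
    have "\<bar>r\<bar> \<le> 1" using \<delta>(2)[OF g(1) r g(2)] .
    then have "norm (r *\<^sub>R v0) \<le> norm v0" by (simp add: mult_left_le_one_le)
    then have "norm ((hshift g + t *\<^sub>R slope g) + r *\<^sub>R v0) \<le> \<delta> + norm v0"
      using norm_triangle_ineq[of "hshift g + t *\<^sub>R slope g" "r *\<^sub>R v0"] g(2) by linarith
    then have "dist (g (t *\<^sub>R v1)) (t *\<^sub>R v1) \<le> \<delta> + norm v0"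
      by (simp add: r dist_norm add.assoc)
    then have "g (t *\<^sub>R v1) \<in> K" by (simp add: K_def dist_commute)
    moreover have "t *\<^sub>R v1 \<in> K" using \<delta>(1) by (simp add: K_def)
    ultimately show False using g(3) by blast
  qed
  ultimately show ?thesis using that \<delta>(1) by (meson finite_subset)
qed

lemma hshift_lattice: "additive_subgroup (hshift ` \<Gamma>)" "separated (hshift ` \<Gamma>)"
proof -
  show "additive_subgroup (hshift ` \<Gamma>)"
    unfolding additive_subgroup_def
  proof (intro conjI ballI)
    show "0 \<in> hshift ` \<Gamma>" by (rule image_eqI[OF _ id_mem]) (simp add: shift_id)
    fix x y assume "x \<in> hshift ` \<Gamma>" "y \<in> hshift ` \<Gamma>"
    then obtain g h where gh: "g \<in> \<Gamma>" "h \<in> \<Gamma>" "x = hshift g" "y = hshift h" unfolding image_iff by blast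
    have "h \<circ> inv h = id" using inv_apply(2)[OF gh(2)] by auto
    then have "hshift h + hshift (inv h) = 0"
      using hshift_comp[OF gh(2) inv_mem[OF gh(2)]] shift_id by simp
    then have "x - y = hshift (g \<circ> inv h)"
      using hshift_comp[OF gh(1) inv_mem[OF gh(2)]] gh by (simp add: algebra_simps eq_neg_iff_add_eq_0)
    then show "x - y \<in> hshift ` \<Gamma>" using comp_mem[OF gh(1) inv_mem[OF gh(2)]] by (intro image_eqI)
  qed
  obtain \<delta> where \<delta>: "\<delta> > 0" "finite {g \<in> \<Gamma>. norm (hshift g + 0 *\<^sub>R slope g) < \<delta>}"
    using finite_small_displacement by blast
  let ?F = "{g \<in> \<Gamma>. norm (hshift g + 0 *\<^sub>R slope g) < \<delta>}"
  obtain d where d: "d > 0" "\<forall>x\<in>hshift ` ?F. x \<noteq> 0 \<longrightarrow> d \<le> dist 0 x"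
    using finite_set_avoid[of "hshift ` ?F" 0] \<delta>(2) by blast
  show "separated (hshift ` \<Gamma>)"
    unfolding separated_def
  proof (intro exI[of _ "min d \<delta>"] conjI ballI impI, goal_cases)
    case (2 x)
    then obtain g where "g \<in> ?F" "x = hshift g" unfolding image_iff by auto
    then show ?case using d(2) 2(2) by (cases "x = 0") auto
  qed (use d \<delta> in simp)
qed

text \<open>As \<open>hshift\<close> is injective, \<open>slope\<close> and \<open>vshift\<close>
  are functions on the lattice. The first is additive; the second becomes additive after adding half
  of the symmetric cocycle on the diagonal, which is where the coefficient 1/2 of the normal form
  originates.\<close>

lemma slope_vshift_linear:
  obtains a b where "linear a" "linear b" "\<And>g. g \<in> \<Gamma> \<Longrightarrow> slope g = a (hshift g)"
    "\<And>g. g \<in> \<Gamma> \<Longrightarrow> vshift g = b (hshift g) - 1/2 * l (slope g) (hshift g)"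
proof -
  define gam where "gam = inv_into \<Gamma> hshift"
  have gam: "gam (hshift g) = g" if "g \<in> \<Gamma>" for g
    unfolding gam_def using inj_hshift that by (rule inv_into_f_f)
  have gam_add: "gam (x + y) = gam x \<circ> gam y" "gam x \<in> \<Gamma>" if xy: "x \<in> hshift ` \<Gamma>" "y \<in> hshift ` \<Gamma>" for x y
  proof -
    obtain g h where gh: "g \<in> \<Gamma>" "h \<in> \<Gamma>" "x = hshift g" "y = hshift h" using xy unfolding image_iff by blast
    then show "gam (x + y) = gam x \<circ> gam y" "gam x \<in> \<Gamma>"
      using gam[OF comp_mem[OF gh(1,2)]] hshift_comp[OF gh(1,2)] gam by simp_all
  qed
  obtain a where a: "linear a" "\<And>x. x \<in> hshift ` \<Gamma> \<Longrightarrow> a x = slope (gam x)"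
    using additive_extends_linear[OF hshift_lattice, of "\<lambda>x. slope (gam x)"] gam_add slope_comp
    by (metis (no_types, lifting))
  define \<beta> where "\<beta> x = vshift (gam x) + 1/2 * l (slope (gam x)) x" for x
  have "\<beta> (x + y) = \<beta> x + \<beta> y" if xy: "x \<in> hshift ` \<Gamma>" "y \<in> hshift ` \<Gamma>" for x y
  proof -
    obtain g h where gh: "g \<in> \<Gamma>" "h \<in> \<Gamma>" "x = hshift g" "y = hshift h" using xy unfolding image_iff by blast
    have "gam x = g" "gam y = h" using gh gam by simp_all
    moreover have "gam (x + y) = g \<circ> h" using gam_add(1)[OF xy] calculation by simp
    moreover have "l (slope g) (hshift h) = l (hshift h) (slope g)" by (rule form_commute)
    moreover have "l (slope h) (hshift g) = l (hshift h) (slope g)"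
      using hshift_symmetric[OF gh(1,2)] form_commute[of "slope h"] by simp
    ultimately show ?thesis
      using gh by (simp add: \<beta>_def vshift_comp slope_comp form_linear algebra_simps)
  qed
  then obtain b where b: "linear b" "\<And>x. x \<in> hshift ` \<Gamma> \<Longrightarrow> b x = \<beta> x"
    using additive_extends_linear[OF hshift_lattice, of \<beta>] by blast
  show ?thesis
  proof (rule that[OF a(1) b(1)])
    fix g assume g: "g \<in> \<Gamma>"
    then show "slope g = a (hshift g)" using a(2)[of "hshift g"] gam by simp
    show "vshift g = b (hshift g) - 1/2 * l (slope g) (hshift g)"
      using b(2)[of "hshift g"] gam[OF g] g by (simp add: \<beta>_def)
  qed
qed

text \<open>The additive functional \<open>b\<close> that separates the group from the normal form is absorbed into a
  parabolic change \<open>nu z\<close> of the complement of \<open>v0\<close>.\<close>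

lemma parabolic_type_ii:
  obtains w1 T a \<Lambda> where "type_ii l C v0 w1 T a \<Lambda>" "\<Gamma> = type_ii_action l v0 a ` \<Lambda>"
    "trivial_kernels T a"
proof -
  obtain a b where a: "linear a" and b: "linear b" and sl: "\<And>g. g \<in> \<Gamma> \<Longrightarrow> slope g = a (hshift g)"
    and vs: "\<And>g. g \<in> \<Gamma> \<Longrightarrow> vshift g = b (hshift g) - 1/2 * l (slope g) (hshift g)"
    using slope_vshift_linear by blast
  define \<Lambda>0 where "\<Lambda>0 = hshift ` \<Gamma>"
  define T0 where "T0 = span \<Lambda>0"
  define N where "N = {x. l x v0 = 0 \<and> l x v1 = 0}"
  have N: "subspace N" by (auto simp: subspace_def N_def form_linear)
  have "\<Lambda>0 \<subseteq> N" using hshift_v0 hshift_v1 by (auto simp: \<Lambda>0_def N_def)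
  then have T0N: "T0 \<subseteq> N" unfolding T0_def using span_minimal N by blast
  have "a ` \<Lambda>0 \<subseteq> N" using slope_v0 slope_v1 sl by (auto simp: \<Lambda>0_def N_def)
  then have aN: "a ` T0 \<subseteq> N"
    unfolding T0_def linear_span_image[OF a, symmetric] using span_minimal N by blast
  have T0: "subspace T0" by (simp add: T0_def)
  have sym: "l (a x) y = l x (a y)" if "x \<in> T0" "y \<in> T0" for x y
  proof (rule bilinear_eq_on_span[OF a a])
    show "x \<in> span \<Lambda>0" "y \<in> span \<Lambda>0" using that by (simp_all add: T0_def)
    fix x y assume "x \<in> \<Lambda>0" "y \<in> \<Lambda>0"
    then obtain g h where gh: "g \<in> \<Gamma>" "h \<in> \<Gamma>" "x = hshift g" "y = hshift h" unfolding \<Lambda>0_def image_iff by blast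
    then show "l (a x) y = l x (a y)"
      using hshift_symmetric[OF gh(1,2)] form_commute[of "slope g"] sl by simp
  qed
  have neg: "l x x < 0" if "x \<in> N" "x \<noteq> 0" for x
    using null_pair_perp_negative[OF v0 v1(3)] that by (simp add: N_def)
  \<comment> \<open>With the Riesz vector of \<open>- b\<close>, the map \<open>f\<close> below adds
    exactly \<open>b x\<close> times \<open>v0\<close> to \<open>x\<close> in
    \<open>T0\<close>.\<close>
  obtain z where z: "z \<in> T0" "\<And>x. x \<in> T0 \<Longrightarrow> l x z = - b x"
  proof (rule definite_riesz[OF T0, of "\<lambda>x. - b x"])
    show "l x x \<noteq> 0" if "x \<in> T0" "x \<noteq> 0" for x using neg[of x] T0N that by force
    show "linear (\<lambda>x. - b x)" using b by (rule linear_compose_neg)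
  qed blast
  have zN: "z \<in> N" using z T0N by blast
  then have z0: "l z v0 = 0" by (simp add: N_def)
  define f where "f = nu l v0 z"
  have f: "linear f" by (simp add: f_def linear_nu)
  have f_form: "l (f x) (f y) = l x y" for x y using nu_isometry[OF v0(2) z0] by (simp add: f_def)
  have f_v0: "f v0 = v0" using nu_fixes[OF v0(2) z0] by (simp add: f_def)
  have fN: "f x = x - l x z *\<^sub>R v0" if "x \<in> N" for x using that by (simp add: f_def nu_def N_def)
  \<comment> \<open>Dropping the \<open>v0\<close>-component undoes \<open>f\<close> on
    \<open>N\<close>, and lets \<open>a'\<close> be defined linearly on the whole space.\<close>
  define p where "p w = w - l w v1 *\<^sub>R v0" for w
  have p: "linear p" by (rule linearI) (simp_all add: p_def form_linear algebra_simps)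
  have pf: "p (f x) = x" if "x \<in> N" for x
    using fN[OF that] that v1(3) by (simp add: p_def N_def form_linear)
  define w1 where "w1 = f v1"
  define T where "T = f ` T0"
  define \<Lambda> where "\<Lambda> = f ` \<Lambda>0"
  define a' where "a' w = f (a (p w))" for w
  have a': "linear a'" unfolding a'_def using linear_compose[OF linear_compose[OF p a] f] by (simp add: o_def)
  have a'f: "a' (f x) = f (a x)" if "x \<in> T0" for x using pf[of x] T0N that by (auto simp: a'_def)
  have \<Lambda>: "additive_subgroup \<Lambda>"
    unfolding additive_subgroup_def \<Lambda>_def
  proof (intro conjI ballI)
    show "0 \<in> f ` \<Lambda>0"
      using linear_0[OF f] additive_subgroup_zero[OF hshift_lattice(1)]
      unfolding \<Lambda>0_def by (intro image_eqI[of _ _ 0]) simp_all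
    fix x y assume "x \<in> f ` \<Lambda>0" "y \<in> f ` \<Lambda>0"
    then obtain x' y' where xy: "x' \<in> \<Lambda>0" "y' \<in> \<Lambda>0" "x = f x'" "y = f y'" unfolding image_iff by blast
    then have "x' - y' \<in> \<Lambda>0"
      using additive_subgroup_diff[OF hshift_lattice(1)] unfolding \<Lambda>0_def by blast
    then show "x - y \<in> f ` \<Lambda>0" using xy linear_diff[OF f] by (intro image_eqI[of _ _ "x' - y'"]) simp_all
  qed
  obtain M where M: "M > 0" "\<And>x. norm (p x) \<le> M * norm x"
    using linear_bounded_pos[OF p] by (metis mult.commute)
  obtain \<epsilon> where \<epsilon>: "\<epsilon> > 0" "\<And>x. x \<in> \<Lambda>0 \<Longrightarrow> norm x < \<epsilon> \<Longrightarrow> x = 0"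
    using hshift_lattice(2) unfolding separated_def \<Lambda>0_def by blast
  have "separated \<Lambda>"
    unfolding separated_def
  proof (intro exI[of _ "\<epsilon> / M"] conjI ballI impI)
    fix w assume w: "w \<in> \<Lambda>" "norm w < \<epsilon> / M"
    then obtain x where x: "x \<in> \<Lambda>0" "w = f x" by (auto simp: \<Lambda>_def)
    have "norm x \<le> M * norm w" using M(2)[of w] pf[of x] x \<open>\<Lambda>0 \<subseteq> N\<close> by auto
    also have "\<dots> < \<epsilon>" using w(2) M(1) by (simp add: field_simps)
    finally have "x = 0" using \<epsilon>(2) x(1) by blast
    then show "w = 0" using x linear_0[OF f] by simp
  qed (use \<epsilon> M in simp)
  then have "uniform_lattice (span \<Lambda>) \<Lambda>"
    using uniform_lattice_span[OF \<Lambda>] discrete_iff_separated[OF \<Lambda>] by blast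
  then have lattice: "uniform_lattice T \<Lambda>"
    by (simp add: \<Lambda>_def T_def T0_def linear_span_image[OF f])
  have f_perp: "l (f x) v0 = 0" "l (f x) w1 = 0" if "x \<in> N" for x
    using that f_form[of x v0] f_form[of x v1] f_v0 by (simp_all add: N_def w1_def)
  have "w1 \<in> C" unfolding w1_def f_def using nu_in_cone[OF v0(2,1) z0 v1(1)] .
  moreover have "l w1 w1 = 0" "l v0 w1 = 1"
    using f_form[of v1 v1] f_form[of v0 v1] v1 f_v0 by (simp_all add: w1_def)
  ultimately have "type_ii l C v0 w1 T a' \<Lambda>"
    unfolding type_ii_def Let_def
  proof (intro conjI ballI allI)
    show "v0 \<in> frontier C" using v0 by (simp add: frontier_cone)
    show "subspace T" unfolding T_def using linear_subspace_image[OF f T0] .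
    show "T \<subseteq> perp l (span {v0}) \<inter> perp l {w1}"
      using f_perp T0N by (auto simp: T_def mem_perp_span mem_perp_singleton)
    show "a' ` T \<subseteq> perp l (span {v0}) \<inter> perp l {w1}"
      using f_perp aN a'f by (auto simp: T_def mem_perp_span mem_perp_singleton)
    show "l (a' x) y = l x (a' y)" if "x \<in> T" "y \<in> T" for x y
      using that sym a'f by (auto simp: T_def f_form)
  qed (use lattice linear_add[OF a'] linear_scale[OF a'] in \<open>simp_all add: frontier_cone\<close>)
  moreover have "\<Gamma> = type_ii_action l v0 a' ` \<Lambda>"
  proof -
    have "type_ii_action l v0 a' (f (hshift g)) = g" if g: "g \<in> \<Gamma>" for g
    proof
      fix v
      have x: "hshift g \<in> T0" "hshift g \<in> N"
        using g T0N by (auto simp: T0_def \<Lambda>0_def span_base)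
      have s: "slope g \<in> N" using slope_v0[OF g] slope_v1[OF g] by (simp add: N_def)
      have fx: "f (hshift g) = hshift g + b (hshift g) *\<^sub>R v0"
        using fN[OF x(2)] z(2)[OF x(1)] by simp
      have "nu l v0 (f (slope g)) v = nu l v0 (slope g) v"
        using nu_shift[OF v0(2) slope_v0[OF g], of "- l (slope g) z" v] fN[OF s] by simp
      moreover have "a' (f (hshift g)) = f (slope g)" using a'f[OF x(1)] sl[OF g] by simp
      moreover have "l (f (slope g)) (f (hshift g)) = l (slope g) (hshift g)" by (rule f_form)
      ultimately have "type_ii_action l v0 a' (f (hshift g)) v =
          nu l v0 (slope g) v + (hshift g + vshift g *\<^sub>R v0)"
        using vs[OF g] by (simp add: type_ii_action_def) (simp add: fx algebra_simps)
      also have "\<dots> = g v" using apply_slope[OF g, of v] by (simp add: hshift_def vshift_def)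
      finally show "type_ii_action l v0 a' (f (hshift g)) v = g v" .
    qed
    then show ?thesis unfolding \<Lambda>_def \<Lambda>0_def image_image by simp
  qed
  moreover have "trivial_kernels T a'"
    unfolding trivial_kernels_def
  proof (intro allI equalityI subsetI)
    fix t w assume w: "w \<in> {w \<in> T. w + t *\<^sub>R a' w = 0}"
    then obtain u where u: "u \<in> T0" "w = f u" by (auto simp: T_def)
    define A where "A x = x + t *\<^sub>R a x" for x
    have A: "linear A" unfolding A_def using a by (intro linear_compose_add linear_ident linear_compose_scale_right)
    have "f (A u) = 0"
      using w u a'f[OF u(1)] by (simp add: A_def linear_add[OF f] linear_scale[OF f])
    moreover have "A u \<in> N" unfolding A_def using u(1) T0N aN N by (auto intro!: subspace_add subspace_scale)
    ultimately have Au: "A u = 0" using pf[of "A u"] linear_0[OF p] by simp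
    \<comment> \<open>Lattice points \<open>y\<close> near large multiples of \<open>u\<close> have
      small \<open>A y\<close>, since \<open>A u = 0\<close>, yet they are unbounded; but only
      finitely many displacements are that small.\<close>
    have "u = 0"
    proof (rule ccontr)
      assume "u \<noteq> 0"
      obtain M where M: "M > 0" "\<And>x. norm (A x) \<le> M * norm x"
        using linear_bounded_pos[OF A] by (metis mult.commute)
      obtain \<delta> where \<delta>: "\<delta> > 0" "finite {g \<in> \<Gamma>. norm (hshift g + t *\<^sub>R slope g) < \<delta>}"
        using finite_small_displacement by blast
      define F where "F = (\<lambda>g. norm (hshift g)) ` {g \<in> \<Gamma>. norm (hshift g + t *\<^sub>R slope g) < \<delta>}"
      have "finite F" using \<delta>(2) by (simp add: F_def)
      then obtain R where R: "\<And>r. r \<in> F \<Longrightarrow> r \<le> R" using bdd_above_finite[of F] unfolding bdd_above_def by blast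
      \<comment> \<open>\<open>R\<close> bounds the finitely many candidates; multiples of
        \<open>u\<close> from \<open>K\<close> on are too long to be approximated by any of
        them.\<close>
      obtain K :: nat where K: "real K > (R + \<delta> / M) / norm u" using reals_Archimedean2 by blast
      obtain k y where k: "k \<ge> K" "y \<in> \<Lambda>0" "norm (real k *\<^sub>R u - y) < \<delta> / M"
        using real_multiple_approx[of \<Lambda>0 u "\<delta> / M" K] hshift_lattice(1) u(1) \<delta>(1) M(1)
        unfolding \<Lambda>0_def T0_def by auto
      obtain g where g: "g \<in> \<Gamma>" "y = hshift g" using k(2) by (auto simp: \<Lambda>0_def)
      have "norm (A (real k *\<^sub>R u - y)) < \<delta>"
        using M(2)[of "real k *\<^sub>R u - y"] k(3) M(1) by (simp add: field_simps)
      moreover have "A (real k *\<^sub>R u - y) = - A y"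
        by (simp add: linear_diff[OF A] linear_scale[OF A] Au)
      ultimately have "norm (A y) < \<delta>" by (simp only: norm_minus_cancel)
      then have "norm (hshift g + t *\<^sub>R slope g) < \<delta>" using g sl by (simp add: A_def)
      then have "norm y \<in> F" using g by (auto simp: F_def)
      then have "norm y \<le> R" by (rule R)
      moreover have "norm (real k *\<^sub>R u) \<le> norm y + norm (real k *\<^sub>R u - y)"
        using norm_triangle_ineq[of y "real k *\<^sub>R u - y"] by simp
      ultimately have "real k * norm u < R + \<delta> / M" using k(3) by simp
      moreover have "real K * norm u > R + \<delta> / M" using K \<open>u \<noteq> 0\<close> by (simp add: field_simps)
      moreover have "real K * norm u \<le> real k * norm u" using k(1) by (simp add: mult_right_mono)
      ultimately show False by linarith
    qed
    then show "w \<in> {0}" using u linear_0[OF f] by simp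
  next
    fix t w assume "w \<in> {0::'a}"
    then show "w \<in> {w \<in> T. w + t *\<^sub>R a' w = 0}"
      using linear_0[OF a'] linear_0[OF f] subspace_0[OF T0] by (auto simp: T_def intro!: image_eqI[of _ _ 0])
  qed
  ultimately show ?thesis using that by blast
qed

end

context strictly_causal_group
begin

lemma unipotent_strictly_causal_type:
  assumes unip: "unipotent_group \<Gamma>"
  shows "(\<exists>T L \<Lambda>. type_i l C T L \<Lambda> \<and> \<Gamma> = translation_group \<Lambda>) \<or>
    (\<exists>v0 v1 T a \<Lambda>. type_ii l C v0 v1 T a \<Lambda> \<and> \<Gamma> = type_ii_action l v0 a ` \<Lambda> \<and> trivial_kernels T a)"
proof (cases "\<forall>g\<in>\<Gamma>. linear_part g = id")
  case True
  then have lin: "\<And>g. g \<in> \<Gamma> \<Longrightarrow> linear_part g = id" by simp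
  obtain T \<Lambda> where T: "\<Gamma> = translation_group \<Lambda>"
    "(\<exists>L. type_i l C T L \<Lambda>) \<or> (\<exists>v0 v1. type_ii l C v0 v1 T (\<lambda>_. 0) \<Lambda>)" "subspace T"
    by (rule translations_type[OF lin])
  have act: "\<Gamma> = type_ii_action l v0 (\<lambda>_. 0) ` \<Lambda>" for v0
    unfolding T(1) translation_group_def type_ii_action_zero ..
  from T(2) show ?thesis
  proof
    assume "\<exists>L. type_i l C T L \<Lambda>"
    then show ?thesis using T(1) by blast
  next
    assume "\<exists>v0 v1. type_ii l C v0 v1 T (\<lambda>_. 0) \<Lambda>"
    then obtain v0 v1 where "type_ii l C v0 v1 T (\<lambda>_. 0) \<Lambda>" by (elim exE)
    then show ?thesis
      using act[of v0] trivial_kernels_zero[OF T(3)] by (intro disjI2 exI conjI)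
  qed
next
  case False
  then obtain h where h: "h \<in> \<Gamma>" "linear_part h \<noteq> id" by blast
  obtain v0 where v0: "v0 \<in> C" "v0 \<noteq> 0" "l v0 v0 = 0"
    and par: "\<And>g v1. g \<in> \<Gamma> \<Longrightarrow> l v0 v1 = 1 \<Longrightarrow> l v1 v1 = 0 \<Longrightarrow>
      \<exists>y. l y v0 = 0 \<and> l y v1 = 0 \<and> linear_part g = nu l v0 y"
    using unipotent_group_parabolic[OF unip h] by blast
  obtain v1 where v1: "v1 \<in> frontier C" "l v0 v1 = 1"
    using null_partner[of v0] v0 by (auto simp: frontier_cone)
  interpret parabolic_group l C \<Gamma> v0 v1
    using v0 v1 par h by unfold_locales (auto simp: frontier_cone)
  obtain w1 T a \<Lambda> where "type_ii l C v0 w1 T a \<Lambda>" "\<Gamma> = type_ii_action l v0 a ` \<Lambda>"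
    "trivial_kernels T a"
    by (rule parabolic_type_ii)
  then show ?thesis by (intro disjI2 exI conjI)
qed

end

section \<open>Lattices conjugated to translations\<close>

lemma subspace_projection:
  fixes T :: "'a::euclidean_space set"
  assumes "subspace T"
  obtains P where "linear P" "\<And>v. P v \<in> T" "\<And>x. x \<in> T \<Longrightarrow> P x = x"
proof -
  have "\<exists>g. range g \<subseteq> T \<and> linear g \<and> (\<forall>v\<in>T. g (id v) = v)"
    using linear_exists_left_inverse_on[OF linear_id assms, unfolded inj_on_id] by auto
  then show ?thesis using that by (auto simp: image_subset_iff)
qed

lemma quotient_maps_same_fibres:
  assumes f: "quotient_map X Y f" and g: "quotient_map X Z g"
    and eq: "\<And>x y. x \<in> topspace X \<Longrightarrow> y \<in> topspace X \<Longrightarrow> f x = f y \<longleftrightarrow> g x = g y"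
  shows "Y homeomorphic_space Z"
proof -
  obtain h where h: "continuous_map Y Z h" "\<And>x. x \<in> topspace X \<Longrightarrow> h (f x) = g x"
    using quotient_map_lift_exists[OF f quotient_imp_continuous_map[OF g]] eq by metis
  obtain k where k: "continuous_map Z Y k" "\<And>x. x \<in> topspace X \<Longrightarrow> k (g x) = f x"
    using quotient_map_lift_exists[OF g quotient_imp_continuous_map[OF f]] eq by metis
  have "k (h y) = y" if "y \<in> topspace Y" for y
    using that h(2) k(2) unfolding quotient_imp_surjective_map[OF f, symmetric] by auto
  moreover have "h (k z) = z" if "z \<in> topspace Z" for z
    using that h(2) k(2) unfolding quotient_imp_surjective_map[OF g, symmetric] by auto
  ultimately show ?thesis
    unfolding homeomorphic_space_def homeomorphic_maps_def using h k by blast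
qed

lemma open_translation_orbits:
  fixes W :: "'a::euclidean_space set"
  assumes A: "additive_subgroup A" "A \<subseteq> X" "subspace X" and W: "open W"
  shows "openin (orbit_space (top_of_set X) (translation_group A))
    (orbit (translation_group A) ` (X \<inter> W))"
proof -
  let ?o = "orbit (translation_group A)"
  have "{x \<in> X. ?o x \<in> ?o ` (X \<inter> W)} = X \<inter> (\<Union>a\<in>A. (+) a ` W)"
  proof (intro equalityI subsetI)
    fix x assume x: "x \<in> {x \<in> X. ?o x \<in> ?o ` (X \<inter> W)}"
    then obtain w where w: "w \<in> W" "?o x = ?o w" by auto
    then have "x - w \<in> A" using orbit_translation_eq_iff[OF A(1)] by blast
    moreover have "x = (x - w) + w" by simp
    ultimately show "x \<in> X \<inter> (\<Union>a\<in>A. (+) a ` W)" using x w(1) by blast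
  next
    fix x assume "x \<in> X \<inter> (\<Union>a\<in>A. (+) a ` W)"
    then obtain a w where aw: "x \<in> X" "a \<in> A" "w \<in> W" "x = a + w" by auto
    then have "w \<in> X" using subspace_diff[OF A(3), of x a] A(2) by auto
    moreover have "?o x = ?o w" using orbit_translation_eq_iff[OF A(1), of x w] aw by simp
    ultimately show "x \<in> {x \<in> X. ?o x \<in> ?o ` (X \<inter> W)}" using aw by blast
  qed
  moreover have "open (\<Union>a\<in>A. (+) a ` W)" using W by (intro open_UN ballI open_translation)
  ultimately show ?thesis by (auto simp: openin_orbit_space)
qed

text \<open>The homeomorphism \<open>\<Psi>\<close> conjugates translations to the action, so
  freeness, properness and the topology of the quotient are inherited from the translations.\<close>

locale conjugated_lattice =
  fixes T \<Lambda> :: "'a::euclidean_space set" and \<Psi> \<Psi>' :: "'a \<Rightarrow> 'a" and \<gamma> :: "'a \<Rightarrow> 'a \<Rightarrow> 'a"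
  assumes T: "subspace T" and \<Lambda>: "additive_subgroup \<Lambda>" "\<Lambda> \<subseteq> T" "discrete \<Lambda>"
    and cont: "continuous_on UNIV \<Psi>" "continuous_on UNIV \<Psi>'"
    and inverse: "\<And>v. \<Psi>' (\<Psi> v) = v" "\<And>v. \<Psi> (\<Psi>' v) = v"
    and conj: "\<And>x v. x \<in> \<Lambda> \<Longrightarrow> \<gamma> x (\<Psi> v) = \<Psi> (x + v)"
begin

lemma action_eq: "x \<in> \<Lambda> \<Longrightarrow> \<gamma> x = (\<lambda>v. \<Psi> (x + \<Psi>' v))"
  using conj inverse by (metis ext)

lemma action_comp: "x \<in> \<Lambda> \<Longrightarrow> y \<in> \<Lambda> \<Longrightarrow> \<gamma> x \<circ> \<gamma> y = \<gamma> (x + y)"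
  using additive_subgroup_add[OF \<Lambda>(1)] by (auto simp: action_eq inverse add.assoc)

lemma action_zero: "\<gamma> 0 = id"
  using additive_subgroup_zero[OF \<Lambda>(1)] by (auto simp: action_eq inverse)

lemma action_inverse:
  assumes "x \<in> \<Lambda>"
  shows "bij (\<gamma> x)" "inv (\<gamma> x) = \<gamma> (- x)"
proof -
  have m: "- x \<in> \<Lambda>" using additive_subgroup_minus[OF \<Lambda>(1) assms] .
  have "\<gamma> x \<circ> \<gamma> (- x) = id" "\<gamma> (- x) \<circ> \<gamma> x = id"
    using action_comp[OF assms m] action_comp[OF m assms] action_zero by simp_all
  then show "bij (\<gamma> x)" "inv (\<gamma> x) = \<gamma> (- x)"
    using o_bij inv_unique_comp by blast+
qed

lemma flat_lorentz_groupI: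
  assumes "\<And>x. x \<in> \<Lambda> \<Longrightarrow> lorentz_affine l C (\<gamma> x)"
  shows "flat_lorentz_group l C (\<gamma> ` \<Lambda>)"
  unfolding flat_lorentz_group_def
proof (intro conjI ballI allI impI)
  show "id \<in> \<gamma> ` \<Lambda>" using action_zero additive_subgroup_zero[OF \<Lambda>(1)] by (metis imageI)
  show "g \<circ> h \<in> \<gamma> ` \<Lambda>" if "g \<in> \<gamma> ` \<Lambda>" "h \<in> \<gamma> ` \<Lambda>" for g h
    using that action_comp additive_subgroup_add[OF \<Lambda>(1)] by auto
  show "inv g \<in> \<gamma> ` \<Lambda>" if "g \<in> \<gamma> ` \<Lambda>" for g
    using that action_inverse additive_subgroup_minus[OF \<Lambda>(1)] by auto
  show "lorentz_affine l C g" if "g \<in> \<gamma> ` \<Lambda>" for g using that assms by auto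
  show "g = id" if g: "g \<in> \<gamma> ` \<Lambda>" "g v = v" for g v
  proof -
    obtain x where x: "x \<in> \<Lambda>" "g = \<gamma> x" using g(1) by auto
    have "\<Psi>' (\<gamma> x v) = x + \<Psi>' v" using x(1) by (simp add: action_eq inverse)
    then have "x = 0" using g(2) x(2) by simp
    then show ?thesis using x action_zero by simp
  qed
  fix K :: "'a set" assume "compact K"
  then have "compact (\<Psi>' ` K)"
    using cont(2) compact_continuous_image continuous_on_subset by blast
  then have "bounded (\<Psi>' ` K)" by (rule compact_imp_bounded)
  then obtain R where R: "\<And>v. v \<in> K \<Longrightarrow> norm (\<Psi>' v) \<le> R" by (auto simp: bounded_iff)
  have "{g \<in> \<gamma> ` \<Lambda>. g ` K \<inter> K \<noteq> {}} \<subseteq> \<gamma> ` {x \<in> \<Lambda>. norm x \<le> 2 * R}"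
  proof
    fix g assume g: "g \<in> {g \<in> \<gamma> ` \<Lambda>. g ` K \<inter> K \<noteq> {}}"
    then obtain x v where x: "x \<in> \<Lambda>" "g = \<gamma> x" "v \<in> K" "\<gamma> x v \<in> K" by auto
    have "\<Psi>' (\<gamma> x v) = x + \<Psi>' v" using x(1) by (simp add: action_eq inverse)
    then have "norm x \<le> 2 * R"
      using R[OF x(3)] R[OF x(4)] norm_triangle_ineq4[of "x + \<Psi>' v" "\<Psi>' v"] by simp
    then show "g \<in> \<gamma> ` {x \<in> \<Lambda>. norm x \<le> 2 * R}" using x by blast
  qed
  then show "finite {g \<in> \<gamma> ` \<Lambda>. g ` K \<inter> K \<noteq> {}}"
    using finite_discrete_bounded[OF \<Lambda>(1,3)] finite_surj by blast
qed

lemma orbit_eq_iff: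
  "orbit (\<gamma> ` \<Lambda>) (\<Psi> u) = orbit (\<gamma> ` \<Lambda>) (\<Psi> v) \<longleftrightarrow> u - v \<in> \<Lambda>"
proof -
  have "orbit (\<gamma> ` \<Lambda>) (\<Psi> w) = \<Psi> ` orbit (translation_group \<Lambda>) w" for w
    unfolding orbit_translation by (auto simp: orbit_def conj image_image)
  moreover have "inj \<Psi>" using inverse(1) by (rule inj_on_inverseI)
  ultimately show ?thesis
    by (simp add: inj_image_eq_iff orbit_translation_eq_iff[OF \<Lambda>(1)])
qed

text \<open>With a projection \<open>P\<close> to \<open>T\<close>, sending \<open>v\<close> to the
  classes of \<open>P v\<close> modulo \<open>\<Lambda>\<close> and of \<open>v\<close> modulo
  \<open>T\<close> is an open surjection whose fibres are the cosets of \<open>\<Lambda>\<close>,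
  the same as those of \<open>\<Psi>\<close> followed by the orbit map.\<close>

lemma splits: "splits_as_torus_times_vector_space (\<gamma> ` \<Lambda>) T \<Lambda>"
proof -
  obtain P where P: "linear P" "\<And>v. P v \<in> T" "\<And>x. x \<in> T \<Longrightarrow> P x = x"
    using subspace_projection[OF T] by blast
  have Tsub: "additive_subgroup T" using T by (simp add: additive_subgroup_def subspace_0 subspace_diff)
  let ?oL = "orbit (translation_group \<Lambda>)" and ?oT = "orbit (translation_group T)"
  let ?A = "orbit_space (top_of_set T) (translation_group \<Lambda>)"
  let ?B = "orbit_space euclidean (translation_group T)"
  define h where "h v = (?oL (P v), ?oT v)" for v
  have "continuous_map euclidean (top_of_set T) P"
    using P(2) linear_continuous_on[OF P(1)[unfolded linear_conv_bounded_linear], of UNIV]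
    by (auto simp: continuous_map_in_subtopology)
  then have "continuous_map euclidean ?A (\<lambda>v. ?oL (P v))"
    using continuous_map_compose[OF _ quotient_imp_continuous_map[OF quotient_map_orbit_space]]
    by (auto simp: o_def)
  then have h_cont: "continuous_map euclidean (prod_topology ?A ?B) h"
    unfolding h_def[abs_def]
    by (rule continuous_map_pairedI) (rule quotient_imp_continuous_map[OF quotient_map_orbit_space])
  define Q where "Q v = v - P v" for v
  have Q: "linear Q" unfolding Q_def using P(1) by (intro linear_compose_sub linear_ident)
  have h_comb: "h (p + Q w) = (?oL p, ?oT w)" if "p \<in> T" for p w
  proof -
    have "P (p + Q w) = p" using that P by (simp add: Q_def linear_add linear_diff)
    moreover have "?oT (p + Q w) = ?oT w"
      using orbit_translation_eq_iff[OF Tsub] subspace_diff[OF T that P(2)] by (simp add: Q_def)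
    ultimately show ?thesis by (simp add: h_def)
  qed
  have h_surj: "h ` topspace euclidean = topspace (prod_topology ?A ?B)"
  proof
    show "h ` topspace euclidean \<subseteq> topspace (prod_topology ?A ?B)"
      using P(2) by (auto simp: h_def topspace_orbit_space)
    show "topspace (prod_topology ?A ?B) \<subseteq> h ` topspace euclidean"
    proof
      fix q assume "q \<in> topspace (prod_topology ?A ?B)"
      then obtain p w where "p \<in> T" "q = (?oL p, ?oT w)" by (auto simp: topspace_orbit_space)
      then show "q \<in> h ` topspace euclidean" using h_comb[of p w] by (intro image_eqI[of _ _ "p + Q w"]) auto
    qed
  qed
  obtain M where M: "M > 0" "\<And>x. norm (Q x) \<le> M * norm x"
    using linear_bounded_pos[OF Q] by (metis mult.commute)
  have "open_map euclidean (prod_topology ?A ?B) h"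
    unfolding open_map_def openin_prod_topology_alt
  proof (intro allI impI)
    fix W q r assume W: "openin euclidean W" and "(q, r) \<in> h ` W"
    then obtain v where v: "v \<in> W" "q = ?oL (P v)" "r = ?oT v" by (auto simp: h_def)
    obtain \<epsilon> where \<epsilon>: "\<epsilon> > 0" "ball v \<epsilon> \<subseteq> W" using W v(1) by (auto elim: openE)
    \<comment> \<open>The radii split \<open>\<epsilon>\<close> evenly between the
      \<open>T\<close>-part and the complementary part, with \<open>M\<close> bounding the norm of
      \<open>Q\<close>.\<close>
    define X where "X = ?oL ` (T \<inter> ball (P v) (\<epsilon> / 2))"
    define Y where "Y = ?oT ` (UNIV \<inter> ball v (\<epsilon> / (2 * M)))"
    have "openin ?A X" unfolding X_def using T \<Lambda> by (intro open_translation_orbits) auto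
    moreover have "openin (orbit_space (top_of_set UNIV) (translation_group T)) Y"
      unfolding Y_def using Tsub by (intro open_translation_orbits) auto
    then have "openin ?B Y" by simp
    moreover have "q \<in> X" "r \<in> Y" unfolding X_def Y_def using v P(2) \<epsilon> M by auto
    moreover have "X \<times> Y \<subseteq> h ` W"
    proof clarify
      fix x y assume "x \<in> X" "y \<in> Y"
      then obtain p w where p: "p \<in> T" "norm (P v - p) < \<epsilon> / 2" "x = ?oL p"
        and w: "norm (v - w) < \<epsilon> / (2 * M)" "y = ?oT w"
        by (auto simp: X_def Y_def dist_norm)
      have "norm (Q (v - w)) < \<epsilon> / 2"
        using M(2)[of "v - w"] w(1) M(1) by (simp add: field_simps)
      moreover have eq: "v - (p + Q w) = (P v - p) + Q (v - w)"
        using linear_diff[OF Q, of v w] by (simp add: Q_def)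
      ultimately have "norm (v - (p + Q w)) < \<epsilon>"
        unfolding eq using norm_triangle_ineq[of "P v - p" "Q (v - w)"] p(2) by linarith
      then have "p + Q w \<in> W" using \<epsilon>(2) by (auto simp: dist_norm)
      then show "(x, y) \<in> h ` W" using h_comb[OF p(1), of w] p(3) w(2) by (intro image_eqI) simp_all
    qed
    ultimately show "\<exists>U V. openin ?A U \<and> openin ?B V \<and> q \<in> U \<and> r \<in> V \<and> U \<times> V \<subseteq> h ` W" by blast
  qed
  then have h_quot: "quotient_map euclidean (prod_topology ?A ?B) h"
    using h_cont h_surj by (intro continuous_open_imp_quotient_map)
  have "homeomorphic_map euclidean euclidean \<Psi>"
    unfolding homeomorphic_map_maps homeomorphic_maps_def using cont inverse by auto
  then have quot: "quotient_map euclidean (quotient_manifold (\<gamma> ` \<Lambda>)) (orbit (\<gamma> ` \<Lambda>) \<circ> \<Psi>)"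
    using quotient_map_compose quotient_map_orbit_space homeomorphic_map_def by blast
  have fibres: "(orbit (\<gamma> ` \<Lambda>) \<circ> \<Psi>) u = (orbit (\<gamma> ` \<Lambda>) \<circ> \<Psi>) v \<longleftrightarrow> h u = h v" for u v
  proof -
    have "P u - P v = u - v" if "u - v \<in> T"
      using P(3)[OF that] linear_diff[OF P(1)] by simp
    then show ?thesis
      using \<Lambda>(2) by (auto simp: orbit_eq_iff h_def orbit_translation_eq_iff[OF \<Lambda>(1)]
        orbit_translation_eq_iff[OF Tsub])
  qed
  show ?thesis
    unfolding splits_as_torus_times_vector_space_def
    by (rule quotient_maps_same_fibres[OF quot h_quot fibres])
qed

end

section \<open>Local finiteness and strict causality of the normal forms\<close>

context flat_group
begin

text \<open>If near \<open>u\<close> only finitely many cones with apex in the orbit of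
  \<open>v\<close> are met, then near \<open>u\<close> the future and the past of the orbit are
  finite unions of closed cones.\<close>

lemma strictly_causalI:
  assumes causal: "\<And>g v. g \<in> \<Gamma> \<Longrightarrow> l (g v - v) (g v - v) \<ge> 0 \<Longrightarrow> g = id"
    and fin: "\<And>v. \<exists>W. open W \<and> v \<in> W \<and> (\<forall>u\<in>W. \<exists>N F. open N \<and> u \<in> N \<and> finite F \<and>
      (\<forall>w\<in>N. \<forall>g\<in>\<Gamma>. l (w - g v) (w - g v) \<ge> 0 \<longrightarrow> g \<in> F))"
  shows "strictly_causal C \<Gamma>"
  unfolding strictly_causal_iff
proof (intro conjI ballI allI impI)
  show "g = id" if "g \<in> \<Gamma>" "g v - v \<in> C" for g v
    using causal cone_form_nonneg that by blast
  fix v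
  obtain W where W: "open W" "v \<in> W" "\<And>u. u \<in> W \<Longrightarrow> \<exists>N F. open N \<and> u \<in> N \<and> finite F \<and>
      (\<forall>w\<in>N. \<forall>g\<in>\<Gamma>. l (w - g v) (w - g v) \<ge> 0 \<longrightarrow> g \<in> F)"
    using fin[of v] by blast
  have "u \<in> orbit_future v \<or> u \<notin> closure (orbit_future v)"
    and "u \<in> orbit_past v \<or> u \<notin> closure (orbit_past v)" if u: "u \<in> W" for u
  proof -
    obtain N F where N: "open N" "u \<in> N" "finite F"
      "\<And>w g. w \<in> N \<Longrightarrow> g \<in> \<Gamma> \<Longrightarrow> l (w - g v) (w - g v) \<ge> 0 \<Longrightarrow> g \<in> F"
      using W(3)[OF u] by blast
    define F' where "F' = F \<inter> \<Gamma>"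
    have "finite F'" using N(3) by (simp add: F'_def)
    have closed: "closed (\<Union>g\<in>F'. {w. w - g v \<in> C})" "closed (\<Union>g\<in>F'. {w. g v - w \<in> C})"
      using \<open>finite F'\<close> cone_closed
      by (auto intro!: closed_UN continuous_closed_vimage[of C, unfolded vimage_def] continuous_intros)
    have "N \<inter> orbit_future v \<subseteq> (\<Union>g\<in>F'. {w. w - g v \<in> C})"
      unfolding orbit_future_def F'_def using N(4) cone_form_nonneg by blast
    moreover have "N \<inter> orbit_past v \<subseteq> (\<Union>g\<in>F'. {w. g v - w \<in> C})"
    proof
      fix w assume w: "w \<in> N \<inter> orbit_past v"
      then obtain g where g: "g \<in> \<Gamma>" "g v - w \<in> C" by (auto simp: orbit_past_def)
      have "- (w - g v) \<in> C" using g(2) by simp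
      then have "l (w - g v) (w - g v) \<ge> 0" using cone_cases by blast
      then show "w \<in> (\<Union>g\<in>F'. {w. g v - w \<in> C})" using N(4) w g by (auto simp: F'_def)
    qed
    ultimately have sub: "closure (N \<inter> orbit_future v) \<subseteq> (\<Union>g\<in>F'. {w. w - g v \<in> C})"
      "closure (N \<inter> orbit_past v) \<subseteq> (\<Union>g\<in>F'. {w. g v - w \<in> C})"
      using closed closure_minimal by blast+
    have cl: "u \<in> closure (N \<inter> A)" if "u \<in> closure A" for A
      using open_Int_closure_subset[OF N(1), of A] N(2) that by blast
    show "u \<in> orbit_future v \<or> u \<notin> closure (orbit_future v)"
      using sub(1) cl[of "orbit_future v"] unfolding orbit_future_def F'_def by blast
    show "u \<in> orbit_past v \<or> u \<notin> closure (orbit_past v)"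
      using sub(2) cl[of "orbit_past v"] unfolding orbit_past_def F'_def by blast
  qed
  then show "\<exists>W. open W \<and> v \<in> W \<and> W \<inter> closure (orbit_future v) \<subseteq> orbit_future v \<and>
      W \<inter> closure (orbit_past v) \<subseteq> orbit_past v"
    using W(1,2) by (intro exI[of _ W]) blast
qed

end

lemma discriminant_bound:
  fixes k p q x :: real
  assumes "k > 0" "p \<ge> 0" "q \<ge> 0" "x \<ge> 0" "k * x\<^sup>2 \<le> p + q * x"
  shows "x \<le> 1 + (p + q) / k"
proof (cases "x \<le> 1")
  case True
  then show ?thesis using assms by (simp add: add_increasing2)
next
  case False
  then have "p \<le> p * x" using assms(2) by (simp add: mult_le_cancel_left1)
  then have "x * (k * x) \<le> x * (p + q)" using assms(5) by (simp add: power2_eq_square algebra_simps)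
  then have "k * x \<le> p + q" using False by simp
  then have "x \<le> (p + q) / k" using assms(1) by (simp add: field_simps)
  then show ?thesis by simp
qed

context lorentz_cone
begin

lemma form_bound:
  obtains B where "B > 0" "\<And>x y. \<bar>l x y\<bar> \<le> B * norm x * norm y"
  using bilinear_bounded_pos[OF bilinear_form] by auto

text \<open>Compactness of the unit sphere of \<open>T\<close> makes negativity uniform; for trivial
  \<open>T\<close> the sphere is empty and the constant 1 serves.\<close>

lemma negative_definite_bound:
  fixes T :: "'a set" and S :: "'a \<Rightarrow> 'a"
  assumes T: "subspace T" and S: "linear S" and neg: "\<And>x. x \<in> T \<Longrightarrow> x \<noteq> 0 \<Longrightarrow> l (S x) (S x) < 0"
  obtains \<kappa> where "\<kappa> > 0" "\<And>x. x \<in> T \<Longrightarrow> l (S x) (S x) \<le> - \<kappa> * (norm x)\<^sup>2"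
proof (cases "T \<inter> sphere 0 1 = {}")
  case True
  have zero: "x = 0" if "x \<in> T" for x
  proof (rule ccontr)
    assume "x \<noteq> 0"
    then have "(1 / norm x) *\<^sub>R x \<in> T \<inter> sphere 0 1" using subspace_scale[OF T that] by simp
    then show False using True by blast
  qed
  have "l (S x) (S x) \<le> - 1 * (norm x)\<^sup>2" if "x \<in> T" for x
    using zero[OF that] linear_0[OF S] by (simp add: form_linear)
  then show ?thesis using that zero_less_one by blast
next
  case False
  have "continuous_on (T \<inter> sphere 0 1) S"
    using linear_continuous_on[OF S[unfolded linear_conv_bounded_linear]] .
  then have cont: "continuous_on (T \<inter> sphere 0 1) (\<lambda>x. l (S x) (S x))"
    by (intro form_continuous_intros(1))
  have comp: "compact (T \<inter> sphere 0 1)" using closed_subspace[OF T] by (simp add: closed_Int_compact)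
  obtain m where m: "m \<in> T \<inter> sphere 0 1"
    "\<And>x. x \<in> T \<inter> sphere 0 1 \<Longrightarrow> l (S x) (S x) \<le> l (S m) (S m)"
    using continuous_attains_sup[OF comp False cont] by blast
  have "m \<noteq> 0" using m(1) by auto
  then have pos: "- l (S m) (S m) > 0" using neg[of m] m(1) by simp
  moreover have "l (S x) (S x) \<le> - (- l (S m) (S m)) * (norm x)\<^sup>2" if "x \<in> T" for x
  proof (cases "x = 0")
    case False
    have "(1 / norm x) *\<^sub>R x \<in> T \<inter> sphere 0 1" using subspace_scale[OF T that] False by simp
    from m(2)[OF this] have "l (S x) (S x) / (norm x)\<^sup>2 \<le> l (S m) (S m)"
      by (simp add: linear_scale[OF S] form_linear power2_eq_square)
    then show ?thesis using False by (simp add: field_simps)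
  qed (use linear_0[OF S] in \<open>simp add: form_linear\<close>)
  ultimately show ?thesis using that by blast
qed

end

text \<open>Covers both types: \<open>v0 = 0\<close> and \<open>a = 0\<close> give the translations of type (i).\<close>

locale parabolic_action = lorentz_cone l C
  for l :: "'a::euclidean_space \<Rightarrow> 'a \<Rightarrow> real" and C +
  fixes v0 :: 'a and T :: "'a set" and a :: "'a \<Rightarrow> 'a"
  assumes v0: "v0 \<in> C" "l v0 v0 = 0" and T: "subspace T" and a: "linear a"
    and T_v0: "x \<in> T \<Longrightarrow> l x v0 = 0" and a_v0: "l (a x) v0 = 0"
    and negative: "x \<in> T \<Longrightarrow> x \<noteq> 0 \<Longrightarrow> l (x + t *\<^sub>R a x) (x + t *\<^sub>R a x) < 0"
begin

lemma action_formula: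
  "type_ii_action l v0 a x v = v + (x + l v v0 *\<^sub>R a x)
    - (1/2 * l (a x) x + l v (a x) + 1/2 * l v v0 * l (a x) (a x)) *\<^sub>R v0"
  by (simp add: type_ii_action_def nu_def algebra_simps)

lemma lorentz_affine_action: "lorentz_affine l C (type_ii_action l v0 a x)"
proof -
  have m: "l (- a x) v0 = 0" using a_v0 by (simp add: form_linear)
  have lin: "linear_part (type_ii_action l v0 a x) = nu l v0 (a x)"
    by (auto simp: linear_part_def type_ii_action_def nu_def form_linear)
  have inv: "nu l v0 (- a x) (nu l v0 (a x) v) = v" "nu l v0 (a x) (nu l v0 (- a x) v) = v" for v
    using nu_add[OF v0(2) a_v0 m] nu_add[OF v0(2) m a_v0] by simp_all
  define c where "c = x - (1/2 * l (a x) x) *\<^sub>R v0"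
  have act: "type_ii_action l v0 a x v = nu l v0 (a x) v + c" for v
    by (simp add: type_ii_action_def c_def)
  have "bij (type_ii_action l v0 a x)"
    by (rule bij_betw_byWitness[where f' = "\<lambda>v. nu l v0 (- a x) (v - c)"]) (auto simp: act inv)
  then show ?thesis
    unfolding lorentz_affine_def lin
    using linear_nu nu_isometry[OF v0(2) a_v0] nu_cone[OF v0(2,1) a_v0] by auto
qed

lemma displacement_form:
  assumes "x \<in> T"
  shows "l (w + r *\<^sub>R v0 - (x + t *\<^sub>R a x)) (w + r *\<^sub>R v0 - (x + t *\<^sub>R a x))
    = l w w + 2 * r * l w v0 - 2 * l w (x + t *\<^sub>R a x) + l (x + t *\<^sub>R a x) (x + t *\<^sub>R a x)"
proof -
  define s where "s = x + t *\<^sub>R a x"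
  have "l s v0 = 0" "l v0 s = 0"
    using T_v0[OF assms] a_v0 form_commute[of v0 s] by (simp_all add: s_def form_linear)
  then show ?thesis
    using v0(2) form_commute[of v0 w] form_commute[of s w]
    unfolding s_def[symmetric] by (simp add: form_linear)
qed

text \<open>Up to sign the displacement is \<open>x + t a x\<close> plus a multiple of
  \<open>v0\<close>. As \<open>v0\<close> is null and orthogonal to \<open>x + t a x\<close>, that
  multiple does not contribute to the square.\<close>

lemma action_causal:
  assumes "x \<in> T" "l (type_ii_action l v0 a x v - v) (type_ii_action l v0 a x v - v) \<ge> 0"
  shows "x = 0"
proof (rule ccontr)
  assume "x \<noteq> 0"
  define t where "t = l v v0"
  obtain r where r: "type_ii_action l v0 a x v - v = - (0 + r *\<^sub>R v0 - (x + t *\<^sub>R a x))"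
    using that[of "1/2 * l (a x) x + l v (a x) + 1/2 * l v v0 * l (a x) (a x)"]
    by (simp add: action_formula t_def)
  have "l (0 + r *\<^sub>R v0 - (x + t *\<^sub>R a x)) (0 + r *\<^sub>R v0 - (x + t *\<^sub>R a x)) < 0"
    unfolding displacement_form[OF assms(1)] using negative[OF assms(1) \<open>x \<noteq> 0\<close>]
    by (simp add: form_linear)
  then show False using assms(2) unfolding r by (simp only: form_linear minus_minus)
qed

text \<open>Near the hyperplane \<open>l0 = l0 v\<close> the definite term beats the quadratic growth of the \<open>v0\<close>
  component, as the latter is multiplied by \<open>l0 (w - v)\<close>.\<close>

lemma action_locally_bounded:
  obtains W where "open W" "v \<in> W" "\<And>u. u \<in> W \<Longrightarrow> \<exists>N R. open N \<and> u \<in> N \<and>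
    (\<forall>w\<in>N. \<forall>x\<in>T. l (w - type_ii_action l v0 a x v) (w - type_ii_action l v0 a x v) \<ge> 0 \<longrightarrow> norm x \<le> R)"
proof -
  define t where "t = l v v0"
  define S where "S x = x + t *\<^sub>R a x" for x
  have S: "linear S" unfolding S_def using a by (intro linear_compose_add linear_ident linear_compose_scale_right)
  obtain \<kappa> where \<kappa>: "\<kappa> > 0" "\<And>x. x \<in> T \<Longrightarrow> l (S x) (S x) \<le> - \<kappa> * (norm x)\<^sup>2"
    using negative_definite_bound[OF T S] negative unfolding S_def by metis
  obtain B where B: "B > 0" "\<And>x y. \<bar>l x y\<bar> \<le> B * norm x * norm y" using form_bound by blast
  obtain A where A: "A > 0" "\<And>x. norm (a x) \<le> A * norm x" using linear_bounded_pos[OF a] by blast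
  obtain M where M: "M > 0" "\<And>x. norm (S x) \<le> M * norm x" using linear_bounded_pos[OF S] by blast
  define r where "r x = 1/2 * l (a x) x + l v (a x) + 1/2 * t * l (a x) (a x)" for x
  define K1 where "K1 = 1/2 * B * A + 1/2 * \<bar>t\<bar> * B * A * A"
  define K2 where "K2 = B * norm v * A"
  have K: "K1 \<ge> 0" "K2 \<ge> 0" using B A by (simp_all add: K1_def K2_def)
  have r: "\<bar>r x\<bar> \<le> K1 * (norm x)\<^sup>2 + K2 * norm x" for x
  proof -
    have "\<bar>l (a x) x\<bar> \<le> B * (A * norm x) * norm x"
      by (rule order_trans[OF B(2)]) (intro mult_right_mono mult_left_mono A, use B in auto)
    moreover have "\<bar>l v (a x)\<bar> \<le> B * norm v * (A * norm x)"
      by (rule order_trans[OF B(2)]) (intro mult_left_mono A, use B in auto)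
    moreover have "\<bar>l (a x) (a x)\<bar> \<le> B * (A * norm x) * (A * norm x)"
      by (rule order_trans[OF B(2)]) (intro mult_mono A mult_left_mono, use B A in auto)
    then have "\<bar>t\<bar> * \<bar>l (a x) (a x)\<bar> \<le> \<bar>t\<bar> * (B * (A * norm x) * (A * norm x))"
      by (rule mult_left_mono) simp
    moreover have "\<bar>r x\<bar> \<le> 1/2 * \<bar>l (a x) x\<bar> + \<bar>l v (a x)\<bar> + 1/2 * (\<bar>t\<bar> * \<bar>l (a x) (a x)\<bar>)"
      unfolding r_def abs_mult[symmetric] by simp
    ultimately have "\<bar>r x\<bar> \<le> 1/2 * (B * (A * norm x) * norm x) + B * norm v * (A * norm x)
        + 1/2 * (\<bar>t\<bar> * (B * (A * norm x) * (A * norm x)))" by linarith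
    also have "\<dots> = K1 * (norm x)\<^sup>2 + K2 * norm x"
      by (simp add: K1_def K2_def power2_eq_square algebra_simps)
    finally show ?thesis .
  qed
  \<comment> \<open>The quadratic growth \<open>2 * \<delta> * K1\<close> of the
    \<open>v0\<close>-term may use up at most half of \<open>\<kappa>\<close>; the added 1 makes the
    division legitimate even if \<open>K1 = 0\<close>.\<close>
  define D where "D = K1 + 1"
  define \<delta> where "\<delta> = \<kappa> / (4 * D)"
  have \<delta>: "\<delta> > 0" "2 * \<delta> * K1 \<le> \<kappa> / 2"
  proof -
    have D: "D > 0" "K1 \<le> D" using K by (simp_all add: D_def)
    then show "\<delta> > 0" using \<kappa> by (simp add: \<delta>_def)
    then have "2 * \<delta> * K1 \<le> 2 * \<delta> * D" using D by simp
    also have "\<dots> = \<kappa> / 2" using D by (simp add: \<delta>_def)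
    finally show "2 * \<delta> * K1 \<le> \<kappa> / 2" .
  qed
  define W where "W = {u. \<bar>l (u - v) v0\<bar> < \<delta>}"
  have "open W" unfolding W_def by (intro open_Collect_less continuous_intros)
  moreover have "v \<in> W" using \<delta> by (simp add: W_def form_linear)
  moreover have "\<exists>N R. open N \<and> u \<in> N \<and> (\<forall>w\<in>N. \<forall>x\<in>T.
      l (w - type_ii_action l v0 a x v) (w - type_ii_action l v0 a x v) \<ge> 0 \<longrightarrow> norm x \<le> R)"
    if u: "u \<in> W" for u
  proof -
    define \<rho> where "\<rho> = norm (u - v) + 1"
    define p where "p = B * \<rho> * \<rho>"
    define q where "q = 2 * B * \<rho> * M + 2 * \<delta> * K2"
    have \<rho>: "\<rho> > 0" by (simp add: \<rho>_def add_nonneg_pos)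
    have pq: "p \<ge> 0" "q \<ge> 0" using B \<rho> M \<delta> K by (simp_all add: p_def q_def)
    \<comment> \<open>On the unit ball around \<open>u\<close> the surviving half of the definite
      term gives a quadratic inequality in \<open>norm x\<close> whose coefficients do not depend on
      \<open>w\<close>.\<close>
    have "norm x \<le> 1 + (p + q) / (\<kappa> / 2)"
      if w: "w \<in> W \<inter> ball u 1" and x: "x \<in> T"
        and pos: "l (w - type_ii_action l v0 a x v) (w - type_ii_action l v0 a x v) \<ge> 0" for w x
    proof (rule discriminant_bound)
      define e where "e = w - v"
      have "norm e \<le> norm (w - u) + norm (u - v)"
        using norm_triangle_ineq[of "w - u" "u - v"] by (simp add: e_def)
      then have e: "norm e \<le> \<rho>" using w by (simp add: \<rho>_def dist_norm norm_minus_commute)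
      have e0: "\<bar>l e v0\<bar> \<le> \<delta>" using w by (simp add: W_def e_def)
      have "w - type_ii_action l v0 a x v = e + r x *\<^sub>R v0 - (x + t *\<^sub>R a x)"
        by (simp add: action_formula e_def r_def t_def)
      then have "0 \<le> l e e + 2 * r x * l e v0 - 2 * l e (S x) + l (S x) (S x)"
        using pos displacement_form[OF x, of e "r x" t] by (simp add: S_def)
      moreover have "l e e \<le> p"
      proof -
        have "B * norm e * norm e \<le> p" unfolding p_def using e B \<rho> by (intro mult_mono) auto
        then show ?thesis using B(2)[of e e] by linarith
      qed
      moreover have "- (2 * l e (S x)) \<le> 2 * B * \<rho> * M * norm x"
      proof -
        have "B * norm e * norm (S x) \<le> B * \<rho> * (M * norm x)"
          using e B \<rho> M(2)[of x] by (intro mult_mono) auto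
        then have "\<bar>l e (S x)\<bar> \<le> B * \<rho> * (M * norm x)" using B(2)[of e "S x"] by linarith
        moreover have "2 * B * \<rho> * M * norm x = 2 * (B * \<rho> * (M * norm x))" by simp
        ultimately show ?thesis by linarith
      qed
      moreover have "2 * r x * l e v0 \<le> \<kappa> / 2 * (norm x)\<^sup>2 + 2 * \<delta> * K2 * norm x"
      proof -
        have "r x * l e v0 \<le> \<bar>r x\<bar> * \<bar>l e v0\<bar>" by (metis abs_ge_self abs_mult)
        also have "\<dots> \<le> (K1 * (norm x)\<^sup>2 + K2 * norm x) * \<delta>"
          using r[of x] e0 K by (intro mult_mono) auto
        finally have "2 * r x * l e v0 \<le> (2 * \<delta> * K1) * (norm x)\<^sup>2 + 2 * \<delta> * K2 * norm x"
          by (simp add: algebra_simps)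
        also have "\<dots> \<le> \<kappa> / 2 * (norm x)\<^sup>2 + 2 * \<delta> * K2 * norm x"
          using \<delta>(2) by (intro add_right_mono mult_right_mono) auto
        finally show ?thesis .
      qed
      ultimately have "0 \<le> p + (\<kappa> / 2 * (norm x)\<^sup>2 + 2 * \<delta> * K2 * norm x)
          + 2 * B * \<rho> * M * norm x - \<kappa> * (norm x)\<^sup>2"
        using \<kappa>(2)[OF x] by linarith
      then show "\<kappa> / 2 * (norm x)\<^sup>2 \<le> p + q * norm x" by (simp add: q_def algebra_simps)
    qed (use \<kappa> pq in auto)
    then show ?thesis
      using u \<open>open W\<close>
      by (intro exI[of _ "W \<inter> ball u 1"] exI[of _ "1 + (p + q) / (\<kappa> / 2)"] conjI) auto
  qed
  ultimately show ?thesis using that by blast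
qed

lemma action_strictly_causal:
  assumes \<Lambda>: "additive_subgroup \<Lambda>" "\<Lambda> \<subseteq> T" "discrete \<Lambda>"
    and flat: "flat_lorentz_group l C (type_ii_action l v0 a ` \<Lambda>)"
  shows "strictly_causal C (type_ii_action l v0 a ` \<Lambda>)"
proof -
  interpret flat_group l C "type_ii_action l v0 a ` \<Lambda>" using flat by unfold_locales
  show ?thesis
  proof (rule strictly_causalI)
    fix g v assume g: "g \<in> type_ii_action l v0 a ` \<Lambda>" "l (g v - v) (g v - v) \<ge> 0"
    then obtain x where x: "x \<in> \<Lambda>" "g = type_ii_action l v0 a x" by auto
    then have "x = 0" using action_causal[of x v] g(2) \<Lambda>(2) by auto
    then show "g = id"
      using x(2) linear_0[OF a] by (auto simp: action_formula form_linear)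
  next
    fix v
    obtain W where W: "open W" "v \<in> W" "\<And>u. u \<in> W \<Longrightarrow> \<exists>N R. open N \<and> u \<in> N \<and> (\<forall>w\<in>N. \<forall>x\<in>T.
        l (w - type_ii_action l v0 a x v) (w - type_ii_action l v0 a x v) \<ge> 0 \<longrightarrow> norm x \<le> R)"
      using action_locally_bounded[of v] by blast
    have "\<exists>N F. open N \<and> u \<in> N \<and> finite F \<and> (\<forall>w\<in>N. \<forall>g\<in>type_ii_action l v0 a ` \<Lambda>.
        l (w - g v) (w - g v) \<ge> 0 \<longrightarrow> g \<in> F)" if u: "u \<in> W" for u
    proof -
      obtain N R where N: "open N" "u \<in> N" "\<And>w x. w \<in> N \<Longrightarrow> x \<in> T \<Longrightarrow>
          l (w - type_ii_action l v0 a x v) (w - type_ii_action l v0 a x v) \<ge> 0 \<Longrightarrow> norm x \<le> R"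
        using W(3)[OF u] by blast
      have "finite (type_ii_action l v0 a ` {x \<in> \<Lambda>. norm x \<le> R})"
        using finite_discrete_bounded[OF \<Lambda>(1,3)] by blast
      then show ?thesis
        using N \<Lambda>(2) by (intro exI[of _ N] exI[of _ "type_ii_action l v0 a ` {x \<in> \<Lambda>. norm x \<le> R}"]) auto
    qed
    then show "\<exists>W. open W \<and> v \<in> W \<and> (\<forall>u\<in>W. \<exists>N F. open N \<and> u \<in> N \<and> finite F \<and>
        (\<forall>w\<in>N. \<forall>g\<in>type_ii_action l v0 a ` \<Lambda>. l (w - g v) (w - g v) \<ge> 0 \<longrightarrow> g \<in> F))"
      using W(1,2) by blast
  qed
qed

end

section \<open>Pencils of injective maps\<close>

lemma linear_inj_image_eq:
  fixes f :: "'a::euclidean_space \<Rightarrow> 'a"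
  assumes "linear f" "subspace N" "f ` N \<subseteq> N" "inj_on f N"
  shows "f ` N = N"
proof -
  have "dim (f ` N) = dim N"
    using dim_image_eq[OF assms(1), of N, unfolded span_eq_iff[THEN iffD2, OF assms(2)]] assms(4) by blast
  then show ?thesis
    using assms(1-3) by (intro subspace_dim_equal linear_subspace_image) simp_all
qed

text \<open>A basis of \<open>T\<close> and its image are both completed to bases of
  \<open>N\<close>; the added parts have equal size, so a bijection between them extends
  \<open>S\<close>.\<close>

lemma linear_extend_isomorphism:
  fixes S :: "'a::euclidean_space \<Rightarrow> 'a"
  assumes N: "subspace N" and T: "subspace T" "T \<subseteq> N"
    and S: "linear S" "S ` T \<subseteq> N" "inj_on S T"
  obtains M where "linear M" "M ` N \<subseteq> N" "inj_on M N" "\<And>x. x \<in> T \<Longrightarrow> M x = S x"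
proof -
  obtain B where B: "B \<subseteq> T" "independent B" "T \<subseteq> span B"
    using maximal_independent_subset[of T] by blast
  have spanB: "span B = T" using B T(1) by (simp add: span_subspace)
  obtain B' where B': "B \<subseteq> B'" "B' \<subseteq> N" "independent B'" "N \<subseteq> span B'"
    using maximal_independent_subset_extend[of B N] B T(2) by blast
  have spanB': "span B' = N" using B' N by (simp add: span_subspace)
  have injB: "inj_on S (span B)" using S(3) spanB by simp
  have indS: "independent (S ` B)" using linear_independent_injective_image[OF S(1) B(2) injB] .
  have "S ` B \<subseteq> N" using B(1) S(2) by blast
  then obtain D where D: "S ` B \<subseteq> D" "D \<subseteq> N" "independent D" "N \<subseteq> span D"
    using maximal_independent_subset_extend[of "S ` B" N] indS by blast
  have fin: "finite B'" "finite D" using B'(3) D(3) independent_imp_finite by auto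
  have finB: "finite B" using fin(1) B'(1) finite_subset by blast
  have "card B' = dim N" "card D = dim N" using basis_card_eq_dim B' D by auto
  moreover have "card (S ` B) = card B"
    using S(3) B(1) by (intro card_image) (rule inj_on_subset)
  ultimately have "card (B' - B) = card (D - S ` B)"
    using B'(1) D(1) finB by (simp add: card_Diff_subset)
  then obtain \<phi> where \<phi>: "bij_betw \<phi> (B' - B) (D - S ` B)"
    using finite_same_card_bij[of "B' - B" "D - S ` B"] fin by auto
  define F where "F b = (if b \<in> B then S b else \<phi> b)" for b
  obtain M where M: "linear M" "\<And>b. b \<in> B' \<Longrightarrow> M b = F b"
    using linear_independent_extend[OF B'(3), of F] by blast
  have M\<phi>: "M b = \<phi> b" "M b \<in> D - S ` B" if "b \<in> B' - B" for b
    using M(2)[of b] that \<phi> by (auto simp: F_def bij_betw_def)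
  have MB: "M b = S b" if "b \<in> B" for b using M(2)[of b] that B'(1) by (auto simp: F_def)
  have "inj_on M B'"
  proof (rule inj_onI)
    fix x y assume xy: "x \<in> B'" "y \<in> B'" "M x = M y"
    consider "x \<in> B" "y \<in> B" | "x \<in> B" "y \<notin> B" | "x \<notin> B" "y \<in> B" | "x \<notin> B" "y \<notin> B" by blast
    then show "x = y"
    proof cases
      case 1
      then show ?thesis using xy(3) MB inj_onD[OF S(3)] B(1) by auto
    next
      case 2
      then show ?thesis using xy MB[of x] M\<phi>(2)[of y] by (metis DiffD2 DiffI imageI)
    next
      case 3
      then show ?thesis using xy MB[of y] M\<phi>(2)[of x] by (metis DiffD2 DiffI imageI)
    next
      case 4
      then show ?thesis using xy M\<phi>(1)[of x] M\<phi>(1)[of y] \<phi> by (auto simp: bij_betw_def inj_on_def)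
    qed
  qed
  moreover have MB': "M ` B' \<subseteq> D"
  proof
    fix y assume "y \<in> M ` B'"
    then obtain b where b: "b \<in> B'" "y = M b" by blast
    then show "y \<in> D" using M\<phi>(2)[of b] MB[of b] D(1) by (cases "b \<in> B") auto
  qed
  then have "independent (M ` B')" using D(3) independent_mono by blast
  ultimately have inj: "inj_on M N"
    using linear_inj_on_span_iff_independent_image[OF M(1), of B'] spanB' by simp
  have "M ` N \<subseteq> N"
    unfolding spanB'[symmetric] linear_span_image[OF M(1), symmetric]
    using MB' D(2) spanB' N by (metis order_trans span_minimal)
  moreover have "M x = S x" if "x \<in> T" for x
    using linear_eq_on[OF M(1) S(1), of x B] MB that spanB by blast
  ultimately show ?thesis using that M(1) inj by blast
qed

text \<open>Over the real line the bundle with fibre \<open>(1 + t a) T\<close> and its complement in \<open>N\<close> are trivial: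
  a continuous family of automorphisms \<open>U t\<close> of \<open>N\<close> extends \<open>1 + t a\<close>.  Locally \<open>U s + (t - s) a\<close>
  will do; the pieces are glued by composing with constant automorphisms.\<close>

locale injective_pencil =
  fixes N T :: "'a::euclidean_space set" and a :: "'a \<Rightarrow> 'a"
  assumes N: "subspace N" and T: "subspace T" "T \<subseteq> N"
    and a: "linear a" "\<And>x. a x \<in> N"
    and kernel: "\<And>x t. x \<in> T \<Longrightarrow> x + t *\<^sub>R a x = 0 \<Longrightarrow> x = 0"
begin

definition extends :: "real \<Rightarrow> ('a \<Rightarrow> 'a) \<Rightarrow> bool" where
  "extends t M \<longleftrightarrow> linear M \<and> M ` N \<subseteq> N \<and> inj_on M N \<and> (\<forall>x\<in>T. M x = x + t *\<^sub>R a x)"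

text \<open>Continuity is asked vector by vector; in finite dimension this yields joint continuity,
  see \<open>family_continuous\<close>.\<close>

definition family :: "real set \<Rightarrow> (real \<Rightarrow> 'a \<Rightarrow> 'a) \<Rightarrow> bool" where
  "family J U \<longleftrightarrow> (\<forall>t\<in>J. extends t (U t)) \<and> (\<forall>w\<in>N. continuous_on J (\<lambda>t. U t w))"

lemma family_subset: "family J U \<Longrightarrow> I \<subseteq> J \<Longrightarrow> family I U"
  unfolding family_def using continuous_on_subset by blast

lemma extends_exists: "\<exists>M. extends t M"
proof -
  have S: "linear (\<lambda>x. x + t *\<^sub>R a x)"
    using a(1) by (intro linear_compose_add linear_ident linear_compose_scale_right)
  have "inj_on (\<lambda>x. x + t *\<^sub>R a x) T"
    using linear_injective_on_subspace_0[OF S T(1)] kernel by blast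
  moreover have "(\<lambda>x. x + t *\<^sub>R a x) ` T \<subseteq> N"
    using T(2) a(2) N by (auto intro!: subspace_add subspace_scale)
  ultimately show ?thesis
    using linear_extend_isomorphism[OF N T S] unfolding extends_def by metis
qed

lemma local_family: "\<exists>d>0. \<exists>U. family {s - d..s + d} U"
proof -
  obtain M where M: "extends s M" using extends_exists by blast
  then have lin: "linear M" and MN: "M ` N \<subseteq> N" and inj: "inj_on M N"
    and MT: "\<And>x. x \<in> T \<Longrightarrow> M x = x + s *\<^sub>R a x" by (auto simp: extends_def)
  have "\<forall>x\<in>N. M x = 0 \<longrightarrow> x = 0" using linear_injective_on_subspace_0[OF lin N] inj by blast
  then obtain c where c: "c > 0" "\<And>x. x \<in> N \<Longrightarrow> norm (M x) \<ge> c * norm x"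
    using injective_imp_isometric[OF closed_subspace[OF N] N lin[unfolded linear_conv_bounded_linear]]
    by blast
  obtain A where A: "A > 0" "\<And>x. norm (a x) \<le> A * norm x" using linear_bounded_pos[OF a(1)] by blast
  \<comment> \<open>\<open>M\<close> is bounded below by \<open>c\<close> on \<open>N\<close>, and
    the perturbation \<open>(t - s) a\<close> has norm at most \<open>d * A = c / 2\<close>, too
    small to create a kernel.\<close>
  define d where "d = c / (2 * A)"
  have d: "d > 0" "d * A < c" using c A by (simp_all add: d_def)
  define U where "U t w = M w + (t - s) *\<^sub>R a w" for t w
  have "extends t (U t)" if t: "t \<in> {s - d..s + d}" for t
    unfolding extends_def
  proof (intro conjI ballI)
    show linU: "linear (U t)"
      unfolding U_def using lin a(1) by (intro linear_compose_add linear_compose_scale_right)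
    show "U t ` N \<subseteq> N"
      unfolding U_def using MN a(2) N by (auto intro!: subspace_add subspace_scale)
    show "inj_on (U t) N"
    proof (rule linear_injective_on_subspace_0[OF linU N, THEN iffD2], intro ballI impI, rule ccontr)
      fix x assume x: "x \<in> N" "U t x = 0" "x \<noteq> 0"
      have "M x = - ((t - s) *\<^sub>R a x)" using x(2) by (simp add: U_def eq_neg_iff_add_eq_0)
      then have "c * norm x \<le> \<bar>t - s\<bar> * norm (a x)" using c(2)[OF x(1)] by simp
      also have "\<dots> \<le> d * (A * norm x)" using t A d by (intro mult_mono) auto
      finally have "c * norm x \<le> (d * A) * norm x" by simp
      then show False using d(2) x(3) by simp
    qed
    show "U t x = x + t *\<^sub>R a x" if "x \<in> T" for x
      using MT[OF that] by (simp add: U_def algebra_simps)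
  qed
  moreover have "continuous_on J (\<lambda>t. U t w)" for J w
    unfolding U_def by (intro continuous_intros)
  ultimately have "family {s - d..s + d} U" unfolding family_def by blast
  then show ?thesis using d by blast
qed

text \<open>Precomposing with the constant automorphism \<open>M\<close> followed by the inverse of
  \<open>U s\<close> prescribes the value at \<open>s\<close>. This automorphism is the identity on
  \<open>T\<close>, so the extension property survives for all \<open>t\<close>.\<close>

lemma family_adjust:
  assumes U: "family J U" "s \<in> J" and M: "extends s M"
  obtains U' where "family J U'" "\<And>w. w \<in> N \<Longrightarrow> U' s w = M w"
proof -
  have Us: "linear (U s)" "U s ` N \<subseteq> N" "inj_on (U s) N" "\<And>x. x \<in> T \<Longrightarrow> U s x = x + s *\<^sub>R a x"
    using U by (auto simp: family_def extends_def)
  have M': "linear M" "M ` N \<subseteq> N" "inj_on M N" "\<And>x. x \<in> T \<Longrightarrow> M x = x + s *\<^sub>R a x"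
    using M by (auto simp: extends_def)
  obtain G where G: "range G \<subseteq> N" "linear G" "\<And>v. v \<in> N \<Longrightarrow> G (U s v) = v"
    using linear_exists_left_inverse_on[OF Us(1) N Us(3)] by blast
  have UG: "U s (G w) = w" if "w \<in> N" for w
  proof -
    have "w \<in> U s ` N" using linear_inj_image_eq[OF Us(1) N Us(2,3)] that by simp
    then show ?thesis using G(3) by auto
  qed
  define H where "H w = G (M w)" for w
  have H: "linear H" "\<And>w. H w \<in> N" unfolding H_def using linear_compose[OF M'(1) G(2)] G(1) by (auto simp: o_def)
  have injH: "inj_on H N"
  proof (rule inj_onI)
    fix x y assume xy: "x \<in> N" "y \<in> N" "H x = H y"
    then have "M x = M y" using UG[of "M x"] UG[of "M y"] M'(2) unfolding H_def by (metis image_subset_iff)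
    then show "x = y" using inj_onD[OF M'(3)] xy by blast
  qed
  have HT: "H x = x" if "x \<in> T" for x
    using G(3)[of x] Us(4)[OF that] M'(4)[OF that] T(2) that by (auto simp: H_def)
  define U' where "U' t w = U t (H w)" for t w
  have "extends t (U' t)" if "t \<in> J" for t
  proof -
    have t: "linear (U t)" "U t ` N \<subseteq> N" "inj_on (U t) N" "\<And>x. x \<in> T \<Longrightarrow> U t x = x + t *\<^sub>R a x"
      using U(1) that by (auto simp: family_def extends_def)
    have "linear (U' t)" unfolding U'_def using linear_compose[OF H(1) t(1)] by (simp add: o_def)
    moreover have "inj_on (U' t) N"
      unfolding U'_def using injH t(3) H(2) by (auto simp: inj_on_def)
    ultimately show ?thesis
      unfolding extends_def using t(2,4) H(2) HT by (auto simp: U'_def)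
  qed
  moreover have "continuous_on J (\<lambda>t. U' t w)" for w
    using U(1) H(2) by (simp add: family_def U'_def)
  ultimately have "family J U'" unfolding family_def by blast
  moreover have "U' s w = M w" if "w \<in> N" for w
    using UG[of "M w"] M'(2) that by (auto simp: U'_def H_def)
  ultimately show ?thesis using that by blast
qed

lemma family_concat:
  assumes U: "family {x..y} U" and W: "family {y..z} W" and "x \<le> y" "y \<le> z"
    and eq: "\<And>w. w \<in> N \<Longrightarrow> U y w = W y w"
  shows "family {x..z} (\<lambda>t. if t \<le> y then U t else W t)"
  unfolding family_def
proof (intro conjI ballI)
  show "extends t (if t \<le> y then U t else W t)" if "t \<in> {x..z}" for t
    using that U W by (auto simp: family_def)
  fix w assume w: "w \<in> N"
  have "continuous_on ({x..y} \<union> {y..z}) (\<lambda>t. if t \<le> y then U t w else W t w)"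
    using U W w eq[OF w] by (intro continuous_on_cases) (auto simp: family_def)
  moreover have "{x..y} \<union> {y..z} = {x..z}" using assms(3,4) by auto
  moreover have "(if t \<le> y then U t else W t) w = (if t \<le> y then U t w else W t w)" for t by simp
  ultimately show "continuous_on {x..z} (\<lambda>t. (if t \<le> y then U t else W t) w)" by simp
qed

lemma family_interval:
  assumes "x \<le> y"
  shows "\<exists>U. family {x..y} U"
  using assms
proof (induction rule: Bolzano)
  case (trans x y z)
  then obtain U W where UW: "family {x..y} U" "family {y..z} W" by blast
  have "extends y (U y)" using UW(1) trans(3) by (simp add: family_def)
  then obtain W' where W': "family {y..z} W'" "\<And>w. w \<in> N \<Longrightarrow> W' y w = U y w"
    using family_adjust[OF UW(2), of y "U y"] trans(4) by auto
  then show ?case using family_concat[OF UW(1) W'(1) trans(3,4)] by metis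
next
  case (local s)
  obtain d U where d: "d > 0" "family {s - d..s + d} U" using local_family by blast
  have "family {x..y} U" if "x \<le> s" "s \<le> y" "y - x < d" for x y
    by (rule family_subset[OF d(2)]) (use that in auto)
  then show ?case using d(1) by blast
qed

text \<open>The values on the old interval are kept, so that the successive families stabilise at
  each \<open>t\<close>.\<close>

lemma family_extend:
  assumes U: "family {- r..r} U" "r \<ge> 0"
  obtains U' where "family {- (r + 1)..r + 1} U'" "\<And>t w. t \<in> {- r..r} \<Longrightarrow> w \<in> N \<Longrightarrow> U' t w = U t w"
proof -
  obtain W where W: "family {r..r + 1} W" using family_interval[of r "r + 1"] by auto
  have "extends r (U r)" "extends (- r) (U (- r))" using U by (auto simp: family_def)
  then obtain W1 where W1: "family {r..r + 1} W1" "\<And>w. w \<in> N \<Longrightarrow> W1 r w = U r w"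
    using family_adjust[OF W, of r "U r"] by auto
  define V where "V t = (if t \<le> r then U t else W1 t)" for t
  have V: "family {- r..r + 1} V"
    unfolding V_def by (rule family_concat[OF U(1) W1(1)]) (use U(2) W1(2) in auto)
  obtain X where X: "family {- (r + 1)..- r} X" using family_interval[of "- (r + 1)" "- r"] by auto
  then obtain X1 where X1: "family {- (r + 1)..- r} X1" "\<And>w. w \<in> N \<Longrightarrow> X1 (- r) w = U (- r) w"
    using family_adjust[OF X, of "- r" "U (- r)"] \<open>extends (- r) (U (- r))\<close> by auto
  define Y where "Y t = (if t \<le> - r then X1 t else V t)" for t
  have "family {- (r + 1)..r + 1} Y"
    unfolding Y_def by (rule family_concat[OF X1(1) V]) (use U(2) X1(2) in \<open>auto simp: V_def\<close>)
  moreover have "Y t w = U t w" if "t \<in> {- r..r}" "w \<in> N" for t w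
    using that X1(2)[OF that(2)] by (cases "t = - r") (auto simp: Y_def V_def)
  ultimately show ?thesis using that by blast
qed

lemma global_family:
  obtains U where "family UNIV U"
proof -
  have "\<exists>f. \<forall>n. family {- real n..real n} (f n) \<and>
      (\<forall>t\<in>{- real n..real n}. \<forall>w\<in>N. f (Suc n) t w = f n t w)"
  proof (rule dependent_nat_choice)
    show "\<exists>U. family {- real 0..real 0} U" using family_interval[of 0 0] by simp
    fix U n assume "family {- real n..real n} U"
    then obtain U' where "family {- (real n + 1)..real n + 1} U'"
      "\<And>t w. t \<in> {- real n..real n} \<Longrightarrow> w \<in> N \<Longrightarrow> U' t w = U t w"
      using family_extend[of "real n" U] by auto
    then show "\<exists>U'. family {- real (Suc n)..real (Suc n)} U' \<and>
        (\<forall>t\<in>{- real n..real n}. \<forall>w\<in>N. U' t w = U t w)"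
      by (intro exI[of _ U']) (simp add: add.commute)
  qed
  then obtain f where f: "\<And>n. family {- real n..real n} (f n)"
    "\<And>n t w. t \<in> {- real n..real n} \<Longrightarrow> w \<in> N \<Longrightarrow> f (Suc n) t w = f n t w" by blast
  have mono: "f (n + k) t w = f n t w" if "t \<in> {- real n..real n}" "w \<in> N" for n k t w
  proof (induction k)
    case (Suc k)
    have "t \<in> {- real (n + k)..real (n + k)}" using that(1) by auto
    then show ?case using f(2) that(2) Suc by simp
  qed simp
  define ix where "ix t = nat \<lceil>\<bar>t\<bar>\<rceil>" for t :: real
  have ix: "t \<in> {- real (ix t)..real (ix t)}" for t
  proof -
    have "\<bar>t\<bar> \<le> real (ix t)" unfolding ix_def by (rule real_nat_ceiling_ge)
    then show ?thesis by auto
  qed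
  have ix_le: "ix t \<le> n" if "t \<in> {- real n..real n}" for t n
    using that by (auto simp: ix_def nat_le_iff ceiling_le_iff)
  define U where "U t = f (ix t) t" for t
  have Uf: "U t w = f n t w" if "t \<in> {- real n..real n}" "w \<in> N" for t n w
    using mono[OF ix that(2), of t "n - ix t"] ix_le[OF that(1)] by (simp add: U_def)
  have "extends t (U t)" for t using f(1)[of "ix t"] ix by (simp add: family_def U_def)
  moreover have "continuous_on UNIV (\<lambda>t. U t w)" if w: "w \<in> N" for w
    unfolding continuous_on_eq_continuous_at[OF open_UNIV]
  proof
    fix t :: real
    \<comment> \<open>One more than the index of \<open>t\<close> puts \<open>t\<close> into the
      open interval, where \<open>U\<close> agrees on \<open>N\<close> with a single continuous
      family.\<close>
    define n where "n = Suc (ix t)"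
    let ?J = "{- real n<..<real n}"
    have "continuous_on ?J (\<lambda>t. f n t w)"
      using f(1)[of n] w unfolding family_def by (metis continuous_on_subset greaterThanLessThan_subseteq_atLeastAtMost_iff order_refl)
    then have "continuous_on ?J (\<lambda>t. U t w)"
      by (rule continuous_on_eq) (use Uf[of _ n w] w in auto)
    moreover have "t \<in> ?J" using ix[of t] by (auto simp: n_def)
    ultimately show "isCont (\<lambda>t. U t w) t" by (simp add: continuous_on_eq_continuous_at)
  qed
  ultimately show ?thesis using that unfolding family_def by blast
qed

text \<open>Continuity in \<open>t\<close> is given on vectors of \<open>N\<close>, so the argument
  is expanded in the images of the basis vectors under a projection to \<open>N\<close>.\<close>

lemma family_continuous:
  assumes U: "family UNIV U" and \<tau>: "continuous_on X \<tau>" and \<omega>: "continuous_on X \<omega>" "\<And>v. \<omega> v \<in> N"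
  shows "continuous_on X (\<lambda>v. U (\<tau> v) (\<omega> v))"
proof -
  obtain P where P: "linear P" "\<And>v. P v \<in> N" "\<And>x. x \<in> N \<Longrightarrow> P x = x"
    using subspace_projection[OF N] by blast
  have "U t w = (\<Sum>b\<in>Basis. (w \<bullet> b) *\<^sub>R U t (P b))" if "w \<in> N" for t w
  proof -
    have lin: "linear (U t)" using U by (simp add: family_def extends_def)
    have "U t w = U t (P (\<Sum>b\<in>Basis. (w \<bullet> b) *\<^sub>R b))"
      using P(3)[OF that] by (simp add: euclidean_representation)
    also have "\<dots> = (\<Sum>b\<in>Basis. (w \<bullet> b) *\<^sub>R U t (P b))"
      by (simp add: linear_sum[OF P(1)] linear_sum[OF lin] linear_scale[OF P(1)] linear_scale[OF lin])
    finally show ?thesis .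
  qed
  then have eq: "U (\<tau> v) (\<omega> v) = (\<Sum>b\<in>Basis. (\<omega> v \<bullet> b) *\<^sub>R U (\<tau> v) (P b))" for v using \<omega>(2) by blast
  have "continuous_on UNIV (\<lambda>t. U t (P b))" for b using U P(2) by (simp add: family_def)
  then have "continuous_on X (\<lambda>v. U (\<tau> v) (P b))" for b
    using continuous_on_compose2[OF _ \<tau>] by blast
  then show ?thesis unfolding eq by (intro continuous_intros \<omega>(1))
qed

end

section \<open>Converse and splitting for both types\<close>

context lorentz_cone
begin

lemma uniform_lattice_discrete: "uniform_lattice T \<Lambda> \<Longrightarrow> discrete \<Lambda> \<and> \<Lambda> \<subseteq> T"
  by (simp add: uniform_lattice_def)

lemma type_i_converse:
  assumes "type_i l C T L \<Lambda>"
  shows "flat_lorentz_group l C (translation_group \<Lambda>) \<and> strictly_causal C (translation_group \<Lambda>) \<and>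
    splits_as_torus_times_vector_space (translation_group \<Lambda>) T \<Lambda>"
proof -
  have T: "subspace T" "spacelike C T" "uniform_lattice T \<Lambda>" using assms by (auto simp: type_i_def)
  have \<Lambda>: "additive_subgroup \<Lambda>" "\<Lambda> \<subseteq> T" "discrete \<Lambda>"
    using uniform_lattice_subgroup[OF T(3)] uniform_lattice_discrete[OF T(3)] by simp_all
  interpret parabolic_action l C 0 T "\<lambda>_. 0"
    using T(1) spacelike_negative[OF T(2)] by unfold_locales (auto simp: form_linear linear_zero)
  interpret conjugated_lattice T \<Lambda> "\<lambda>v. v" "\<lambda>v. v" "type_ii_action l 0 (\<lambda>_. 0)"
    using T(1) \<Lambda> by unfold_locales (auto simp: type_ii_action_zero)
  have eq: "translation_group \<Lambda> = type_ii_action l 0 (\<lambda>_. 0) ` \<Lambda>"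
    by (simp add: translation_group_def type_ii_action_zero)
  have flat: "flat_lorentz_group l C (type_ii_action l 0 (\<lambda>_. 0) ` \<Lambda>)"
    using flat_lorentz_groupI lorentz_affine_action by blast
  show ?thesis unfolding eq using flat action_strictly_causal[OF \<Lambda> flat] splits by blast
qed

end

locale parabolic_pencil = parabolic_action + injective_pencil N T a for N +
  fixes v1 :: 'a and P :: "'a \<Rightarrow> 'a"
  assumes v1: "l v1 v1 = 0" "l v0 v1 = 1" and N_eq: "N = {x. l x v0 = 0 \<and> l x v1 = 0}"
    and P: "linear P" "\<And>v. P v \<in> T" "\<And>x. x \<in> T \<Longrightarrow> P x = x" "\<And>v. a (P v) = a v"
    and symmetric: "\<And>x y. x \<in> T \<Longrightarrow> y \<in> T \<Longrightarrow> l (a x) y = l x (a y)"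
begin

lemma v10: "l v1 v0 = 1"
  using v1(2) form_commute[of v1 v0] by simp

definition horizontal :: "'a \<Rightarrow> 'a" where
  "horizontal v = v - l v v1 *\<^sub>R v0 - l v v0 *\<^sub>R v1"

lemma horizontal_mem: "horizontal v \<in> N"
  using v0 v1 v10 by (simp add: horizontal_def N_eq form_linear)

lemma horizontal_decomp: "w \<in> N \<Longrightarrow> horizontal (w + r *\<^sub>R v0 + t *\<^sub>R v1) = w"
  and height_decomp: "w \<in> N \<Longrightarrow> l (w + r *\<^sub>R v0 + t *\<^sub>R v1) v0 = t"
  and v0_coord_decomp: "w \<in> N \<Longrightarrow> l (w + r *\<^sub>R v0 + t *\<^sub>R v1) v1 = r"
  using v0 v1 v10 by (simp_all add: horizontal_def N_eq form_linear)

text \<open>The quadratic form \<open>potential U t\<close> on \<open>N\<close> changes under the action by exactly the shift of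
  the \<open>v0\<close> component.\<close>

definition potential :: "(real \<Rightarrow> 'a \<Rightarrow> 'a) \<Rightarrow> real \<Rightarrow> 'a \<Rightarrow> real" where
  "potential U t w = l (U t w) (a w) - 1/2 * l (U t (P w)) (a w)"

text \<open>The height \<open>l u v0\<close> is kept; on each slice \<open>U t\<close> acts on
  \<open>N\<close>, combined with a shear along \<open>v0\<close> by the potential, and both are
  invertible.\<close>

definition straighten :: "(real \<Rightarrow> 'a \<Rightarrow> 'a) \<Rightarrow> 'a \<Rightarrow> 'a" where
  "straighten U u = U (l u v0) (horizontal u)
    + (l u v1 - potential U (l u v0) (horizontal u)) *\<^sub>R v0 + l u v0 *\<^sub>R v1"

context
  fixes U assumes U: "family UNIV U"
begin

lemma extends_U: "extends t (U t)"
  using U by (simp add: family_def)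

lemma U_props: "linear (U t)" "w \<in> N \<Longrightarrow> U t w \<in> N" "inj_on (U t) N"
    "x \<in> T \<Longrightarrow> U t x = x + t *\<^sub>R a x"
  using extends_U[of t] by (auto simp: extends_def)

lemma bij_straighten: "bij (straighten U)"
proof (rule bijI)
  show "inj (straighten U)"
  proof (rule injI)
    fix u v assume eq: "straighten U u = straighten U v"
    have mem: "U (l u v0) (horizontal u) \<in> N" for u using U_props(2) horizontal_mem by blast
    have t: "l u v0 = l v v0"
      using arg_cong[OF eq, of "\<lambda>z. l z v0"] by (simp add: straighten_def height_decomp[OF mem])
    have "U (l u v0) (horizontal u) = U (l v v0) (horizontal v)"
      using arg_cong[OF eq, of horizontal] by (simp add: straighten_def horizontal_decomp[OF mem])
    then have h: "horizontal u = horizontal v"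
      using U_props(3) horizontal_mem t by (auto dest: inj_onD)
    have "l u v1 - potential U (l u v0) (horizontal u) = l v v1 - potential U (l v v0) (horizontal v)"
      using arg_cong[OF eq, of "\<lambda>z. l z v1"] by (simp add: straighten_def v0_coord_decomp[OF mem])
    then have r: "l u v1 = l v v1" by (simp add: h t)
    have "u = horizontal u + l u v1 *\<^sub>R v0 + l u v0 *\<^sub>R v1" for u by (simp add: horizontal_def)
    then show "u = v" using h t r by metis
  qed
  show "surj (straighten U)"
  proof (rule surjI)
    fix v
    define t where "t = l v v0"
    have "U t ` N = N" using linear_inj_image_eq[OF U_props(1) N _ U_props(3)] U_props(2) by blast
    then have w: "inv_into N (U t) (horizontal v) \<in> N" "U t (inv_into N (U t) (horizontal v)) = horizontal v"
      using horizontal_mem[of v] by (simp_all add: inv_into_into f_inv_into_f)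
    define w where "w = inv_into N (U t) (horizontal v)"
    have "straighten U (w + (l v v1 + potential U t w) *\<^sub>R v0 + t *\<^sub>R v1) = v"
      using w unfolding straighten_def w_def[symmetric]
      by (simp add: height_decomp horizontal_decomp v0_coord_decomp) (simp add: horizontal_def t_def)
    then show "straighten U ((\<lambda>v. inv_into N (U (l v v0)) (horizontal v) + (l v v1 +
        potential U (l v v0) (inv_into N (U (l v v0)) (horizontal v))) *\<^sub>R v0 + l v v0 *\<^sub>R v1) v) = v"
      by (simp add: w_def t_def)
  qed
qed

lemma straighten_continuous: "continuous_on UNIV (straighten U)"
proof -
  have h: "continuous_on UNIV horizontal" unfolding horizontal_def[abs_def] by (intro continuous_intros)
  have t: "continuous_on UNIV (\<lambda>u. l u v0)" by (intro continuous_intros)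
  have lin: "continuous_on UNIV f" if "linear f" for f :: "'a \<Rightarrow> 'a"
    using linear_continuous_on[OF that[unfolded linear_conv_bounded_linear]] .
  have ah: "continuous_on UNIV (\<lambda>u. a (horizontal u))"
    by (rule continuous_on_compose2[OF lin[OF a(1)] h]) simp
  have Ph: "continuous_on UNIV (\<lambda>u. P (horizontal u))"
    by (rule continuous_on_compose2[OF lin[OF P(1)] h]) simp
  have Uh: "continuous_on UNIV (\<lambda>u. U (l u v0) (horizontal u))"
    by (rule family_continuous[OF U t h horizontal_mem])
  have UPh: "continuous_on UNIV (\<lambda>u. U (l u v0) (P (horizontal u)))"
    by (rule family_continuous[OF U t Ph]) (use P(2) T(2) in blast)
  show ?thesis
    unfolding straighten_def[abs_def] potential_def by (intro continuous_intros Uh UPh ah)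
qed

text \<open>The first term of the potential changes by the required \<open>l (U t w) (a x)\<close>,
  by a mixed term in \<open>x\<close> and \<open>w\<close>, and by a quadratic term in
  \<open>x\<close>. The second term involves \<open>U t\<close> only on \<open>T\<close>, where it
  is \<open>1 + t a\<close> and gives a symmetric form; with its factor 1/2 it cancels the mixed
  term and halves the quadratic one.\<close>

lemma potential_shift:
  assumes x: "x \<in> T"
  shows "potential U t (x + w) = potential U t w + 1/2 * l (a x) x + l (U t w) (a x)
    + 1/2 * t * l (a x) (a x)"
proof -
  have U_add: "U t (x + w) = x + t *\<^sub>R a x + U t w"
    using U_props(4)[OF x] linear_add[OF U_props(1)] by simp
  have UP_add: "U t (P (x + w)) = x + t *\<^sub>R a x + P w + t *\<^sub>R a w"
    using U_props(4)[of "x + P w" t] P(2,3,4) x subspace_add[OF T(1) x P(2)]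
    by (simp add: linear_add[OF P(1)] linear_add[OF a(1)] algebra_simps)
  have UP: "U t (P w) = P w + t *\<^sub>R a w" using U_props(4)[OF P(2)] P(4) by simp
  have "l (a w) x = l (P w) (a x)" using symmetric[OF P(2) x, of w] P(4) by simp
  then have s: "l x (a w) = l (P w) (a x)" using form_commute[of x] by simp
  show ?thesis
    unfolding potential_def U_add UP_add UP linear_add[OF a(1)]
    using s form_commute[of "a w" "a x"] form_commute[of "a x" x]
    by (simp add: form_linear algebra_simps)
qed

lemma straighten_equivariant:
  assumes x: "x \<in> T"
  shows "type_ii_action l v0 a x (straighten U u) = straighten U (x + u)"
proof -
  have xN: "x \<in> N" and aN: "a x \<in> N" using x T(2) a(2) by auto
  have xu: "l (x + u) v0 = l u v0" "l (x + u) v1 = l u v1" "horizontal (x + u) = x + horizontal u"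
    using xN by (simp_all add: horizontal_def N_eq form_linear)
  define t w where "t = l u v0" and "w = horizontal u"
  have w: "w \<in> N" "U t w \<in> N" using horizontal_mem U_props(2) by (auto simp: w_def)
  define z where "z = straighten U u"
  have z: "z = U t w + (l u v1 - potential U t w) *\<^sub>R v0 + t *\<^sub>R v1"
    by (simp add: z_def straighten_def t_def w_def)
  have "l z v0 = t" unfolding z using height_decomp w(2) by blast
  moreover have "l z (a x) = l (U t w) (a x)"
    unfolding z using aN form_commute[of v0 "a x"] form_commute[of v1 "a x"]
    by (simp add: N_eq form_linear)
  moreover have "straighten U (x + u) = x + t *\<^sub>R a x + U t w
      + (l u v1 - potential U t (x + w)) *\<^sub>R v0 + t *\<^sub>R v1"
    using U_props(4)[OF x] linear_add[OF U_props(1)]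
    by (simp add: straighten_def xu flip: t_def w_def)
  ultimately show ?thesis
    unfolding z_def[symmetric] action_formula potential_shift[OF x]
    by (simp add: z algebra_simps)
qed

end

lemma conjugated_latticeI:
  assumes "additive_subgroup \<Lambda>" "\<Lambda> \<subseteq> T" "discrete \<Lambda>"
  obtains \<Psi> \<Psi>' where "conjugated_lattice T \<Lambda> \<Psi> \<Psi>' (type_ii_action l v0 a)"
proof -
  obtain U where U: "family UNIV U" using global_family by blast
  have bij: "bij (straighten U)" using bij_straighten[OF U] .
  have inv: "inv (straighten U) (straighten U v) = v" "straighten U (inv (straighten U) v) = v" for v
    using bij by (simp_all add: bij_is_inj bij_is_surj surj_f_inv_f)
  \<comment> \<open>Invariance of domain: a continuous injection of the space into itself has a
    continuous inverse on its image.\<close>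
  have "continuous_on (straighten U ` UNIV) (inv (straighten U))"
    using continuous_on_inverse_open[OF open_UNIV straighten_continuous[OF U]] inv(1) by simp
  then have "continuous_on UNIV (inv (straighten U))" using bij by (simp add: bij_is_surj)
  then have "conjugated_lattice T \<Lambda> (straighten U) (inv (straighten U)) (type_ii_action l v0 a)"
    using assms T(1) straighten_continuous[OF U] inv straighten_equivariant[OF U]
    by unfold_locales auto
  then show ?thesis using that by blast
qed

end

context lorentz_cone
begin

lemma type_ii_converse:
  assumes type: "type_ii l C v0 v1 T a \<Lambda>" and kernels: "trivial_kernels T a"
  shows "flat_lorentz_group l C (type_ii_action l v0 a ` \<Lambda>) \<and>
    strictly_causal C (type_ii_action l v0 a ` \<Lambda>) \<and>
    splits_as_torus_times_vector_space (type_ii_action l v0 a ` \<Lambda>) T \<Lambda>"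
proof -
  define N where "N = {x. l x v0 = 0 \<and> l x v1 = 0}"
  have v: "v0 \<in> C" "l v0 v0 = 0" "l v1 v1 = 0" "l v0 v1 = 1"
    and T: "subspace T" "T \<subseteq> N" "uniform_lattice T \<Lambda>" and aN: "a ` T \<subseteq> N"
    and a: "\<And>x y. x \<in> T \<Longrightarrow> y \<in> T \<Longrightarrow> a (x + y) = a x + a y" "\<And>r x. x \<in> T \<Longrightarrow> a (r *\<^sub>R x) = r *\<^sub>R a x"
    and sym: "\<And>x y. x \<in> T \<Longrightarrow> y \<in> T \<Longrightarrow> l (a x) y = l x (a y)"
    using type unfolding type_ii_def Let_def
    by (auto simp: frontier_cone N_def mem_perp_span mem_perp_singleton subset_iff image_subset_iff)
  have \<Lambda>: "additive_subgroup \<Lambda>" "\<Lambda> \<subseteq> T" "discrete \<Lambda>"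
    using uniform_lattice_subgroup[OF T(3)] uniform_lattice_discrete[OF T(3)] by simp_all
  obtain P where P: "linear P" "\<And>v. P v \<in> T" "\<And>x. x \<in> T \<Longrightarrow> P x = x"
    using subspace_projection[OF T(1)] by blast
  \<comment> \<open>The type constrains \<open>a\<close> on \<open>T\<close> only; precomposing with
    a projection gives a linear map of the whole space that agrees with it on
    \<open>T\<close>.\<close>
  define b where "b w = a (P w)" for w
  have b: "linear b"
    by (rule linearI) (simp_all add: b_def linear_add[OF P(1)] linear_scale[OF P(1)] a P(2))
  have ba: "b x = a x" if "x \<in> T" for x using P(3)[OF that] by (simp add: b_def)
  have bN: "b x \<in> N" for x using aN P(2) by (auto simp: b_def)
  have N: "subspace N" by (auto simp: subspace_def N_def form_linear)
  have kernel: "x = 0" if "x \<in> T" "x + t *\<^sub>R b x = 0" for x t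
    using kernels that ba unfolding trivial_kernels_def by fastforce
  have negative: "l (x + t *\<^sub>R b x) (x + t *\<^sub>R b x) < 0" if x: "x \<in> T" "x \<noteq> 0" for x t
  proof -
    have "x + t *\<^sub>R b x \<in> N" using N x(1) T(2) bN by (auto intro!: subspace_add subspace_scale)
    moreover have "x + t *\<^sub>R b x \<noteq> 0" using kernel x by blast
    ultimately show ?thesis using null_pair_perp_negative[OF v(1,2,4)] by (simp add: N_def)
  qed
  have perp: "\<And>x. x \<in> T \<Longrightarrow> l x v0 = 0" "\<And>x. l (b x) v0 = 0"
    using T(2) bN by (auto simp: N_def)
  have bP: "b (P w) = b w" for w using P(3)[OF P(2)] by (simp add: b_def)
  have symb: "l (b x) y = l x (b y)" if "x \<in> T" "y \<in> T" for x y using sym that ba by simp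
  interpret parabolic_pencil l C v0 T b N v1 P
    by (unfold_locales; fact v T(1,2) linear_add[OF b] linear_scale[OF b]
        linear_add[OF P(1)] linear_scale[OF P(1)] bN N N_def kernel negative P bP perp symb)
  obtain \<Psi> \<Psi>' where conj: "conjugated_lattice T \<Lambda> \<Psi> \<Psi>' (type_ii_action l v0 b)"
    using conjugated_latticeI[OF \<Lambda>] by blast
  interpret conjugated_lattice T \<Lambda> \<Psi> \<Psi>' "type_ii_action l v0 b" by (rule conj)
  have "type_ii_action l v0 a x = type_ii_action l v0 b x" if "x \<in> \<Lambda>" for x
    using ba[of x] that \<Lambda>(2) by (intro ext) (simp add: type_ii_action_def subset_iff)
  then have eq: "type_ii_action l v0 a ` \<Lambda> = type_ii_action l v0 b ` \<Lambda>" by (rule image_cong[OF refl])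
  have flat: "flat_lorentz_group l C (type_ii_action l v0 b ` \<Lambda>)"
    using flat_lorentz_groupI lorentz_affine_action by blast
  show ?thesis unfolding eq using flat action_strictly_causal[OF \<Lambda> flat] splits by blast
qed

end

theorem theorem2:
  fixes l :: "'a::euclidean_space \<Rightarrow> 'a \<Rightarrow> real" and C :: "'a set"
  assumes "lorentzian_form l" and "time_cone l C"
  shows
    "(\<forall>\<Gamma>. flat_lorentz_group l C \<Gamma> \<and> unipotent_group \<Gamma> \<and> strictly_causal C \<Gamma> \<longrightarrow>
        (\<exists>\<Gamma>' p. finite_lorentz_covering l C \<Gamma>' \<Gamma> p \<and>
           ((\<exists>T L \<Lambda>. type_i l C T L \<Lambda> \<and> \<Gamma>' = translation_group \<Lambda>) \<or>
            (\<exists>v0 v1 T a \<Lambda>. type_ii l C v0 v1 T a \<Lambda> \<and> \<Gamma>' = type_ii_action l v0 a ` \<Lambda> \<and>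
               trivial_kernels T a)))) \<and>
     (\<forall>T L \<Lambda>. type_i l C T L \<Lambda> \<longrightarrow>
        flat_lorentz_group l C (translation_group \<Lambda>) \<and>
        strictly_causal C (translation_group \<Lambda>) \<and>
        splits_as_torus_times_vector_space (translation_group \<Lambda>) T \<Lambda>) \<and>
     (\<forall>v0 v1 T a \<Lambda>. type_ii l C v0 v1 T a \<Lambda> \<and> trivial_kernels T a \<longrightarrow>
        flat_lorentz_group l C (type_ii_action l v0 a ` \<Lambda>) \<and>
        strictly_causal C (type_ii_action l v0 a ` \<Lambda>) \<and>
        splits_as_torus_times_vector_space (type_ii_action l v0 a ` \<Lambda>) T \<Lambda>)"
proof (intro conjI allI impI)
  interpret lorentz_cone l C using assms by unfold_locales
  fix \<Gamma> assume \<Gamma>: "flat_lorentz_group l C \<Gamma> \<and> unipotent_group \<Gamma> \<and> strictly_causal C \<Gamma>"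
  then interpret strictly_causal_group l C \<Gamma> by unfold_locales simp_all
  show "\<exists>\<Gamma>' p. finite_lorentz_covering l C \<Gamma>' \<Gamma> p \<and>
           ((\<exists>T L \<Lambda>. type_i l C T L \<Lambda> \<and> \<Gamma>' = translation_group \<Lambda>) \<or>
            (\<exists>v0 v1 T a \<Lambda>. type_ii l C v0 v1 T a \<Lambda> \<and> \<Gamma>' = type_ii_action l v0 a ` \<Lambda> \<and>
               trivial_kernels T a))"
    using finite_lorentz_covering_refl unipotent_strictly_causal_type \<Gamma>
    by (intro exI[of _ \<Gamma>] exI[of _ "\<lambda>x. x"] conjI) simp_all
next
  interpret lorentz_cone l C using assms by unfold_locales
  fix T L \<Lambda> assume "type_i l C T L \<Lambda>"
  then show "flat_lorentz_group l C (translation_group \<Lambda>)" "strictly_causal C (translation_group \<Lambda>)"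
    "splits_as_torus_times_vector_space (translation_group \<Lambda>) T \<Lambda>"
    using type_i_converse by blast+
next
  interpret lorentz_cone l C using assms by unfold_locales
  fix v0 v1 T a \<Lambda> assume "type_ii l C v0 v1 T a \<Lambda> \<and> trivial_kernels T a"
  then show "flat_lorentz_group l C (type_ii_action l v0 a ` \<Lambda>)"
    "strictly_causal C (type_ii_action l v0 a ` \<Lambda>)"
    "splits_as_torus_times_vector_space (type_ii_action l v0 a ` \<Lambda>) T \<Lambda>"
    using type_ii_converse by blast+
qed

end
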